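(* Let $(\mathcal S,U,P)$ be a BCL triple with associated BCL pair $(M_{\phi_1},M_{\phi_2})$ on $H^2_{\mathcal S}(\mathbb T)$. If $H(M_{\phi_1},M_{\phi_2})$ is a compact contraction, then its nonzero part is unitarily equivalent to the diagonal block matrix $$\begin{pmatrix} I_{d_1}&0&0&0\\0&E_{(0,1)}&0&0\\0&0&-I_{d_{-1}}&0\\0&0&0&-E_{(0,1)}\end{pmatrix}.$$
   Context: A BCL triple $(\mathcal S,U,P)$ consists of a complex separable Hilbert space $\mathcal S$, a unitary $U$ on $\mathcal S$ and an orthogonal projection $P$ on $\mathcal S$; $P^\perp=I-P$. $H^2(\mathbb T)$ is the Hardy space of the circle, $S_z$ is multiplication by $z$ on it, and $H^2_{\mathcal S}(\mathbb T)$ ($\mathcal S$-valued Hardy space) is identified with $H^2(\mathbb T)\otimes\mathcal S$. The BCL pair is the commuting pair of isometries $M_{\phi_1}=I\otimes PU^*+S_z\otimes P^\perp U^*$, $M_{\phi_2}=I\otimes UP^\perp+S_z\otimes UP$. For commuting isometries $(V_1,V_2)$, $H(V_1,V_2):=V_2V_2^*-V_1V_1^*-V_2^2V_2^{*2}+V_1V_2V_1^*V_2^*$. The nonzero part of $H(M_{\phi_1},M_{\phi_2})$ is its restriction to the closure of its range. For a real number $a$, $E(a)=\ker(H(M_{\phi_1},M_{\phi_2})-aI)$ is the eigenspace; $d_1=\dim E(1)$, $d_{-1}=\dim E(-1)$ (possibly $0$). $E_{(0,1)}=\bigoplus_{0<a_j<1}a_jQ_j$, where $a_j$ runs over the distinct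 eigenvalues of $H(M_{\phi_1},M_{\phi_2})$ in $(0,1)$ and $Q_j$ is the orthogonal projection onto $E(a_j)$; it is regarded as an operator on $\bigoplus_{0<a_j<1}E(a_j)$. $I_n$ denotes the $n\times n$ identity matrix. *)

theory Defs
  imports "HOL-Analysis.Analysis" "HOL-Library.Poly_Mapping"
begin

section \<open>Complex inner product spaces\<close>

text \<open>The complex inner product is linear in the first argument; its real part is the inner product
  of the underlying real inner product space, so norm and topology are the usual ones.\<close>

class complex_inner = real_inner +
  fixes scaleC :: "complex \<Rightarrow> 'a \<Rightarrow> 'a"  (infixr "*\<^sub>C" 75)
    and cinner :: "'a \<Rightarrow> 'a \<Rightarrow> complex"
  assumes scaleC_add_right: "a *\<^sub>C (x + y) = a *\<^sub>C x + a *\<^sub>C y"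
    and scaleC_add_left: "(a + b) *\<^sub>C x = a *\<^sub>C x + b *\<^sub>C x"
    and scaleC_scaleC: "a *\<^sub>C (b *\<^sub>C x) = (a * b) *\<^sub>C x"
    and scaleC_of_real: "complex_of_real r *\<^sub>C x = r *\<^sub>R x"
    and cinner_commute: "cinner x y = cnj (cinner y x)"
    and cinner_add_left: "cinner (x + y) z = cinner x z + cinner y z"
    and cinner_scaleC_left: "cinner (a *\<^sub>C x) y = a * cinner x y"
    and Re_cinner: "Re (cinner x y) = inner x y"

class chilbert_space = complex_inner + complete_space

subclass (in chilbert_space) banach ..

global_interpretation complex_vector: vector_space "scaleC :: complex \<Rightarrow> 'a \<Rightarrow> 'a::complex_inner"
proof
  fix x :: 'a
  show "1 *\<^sub>C x = x" using scaleC_of_real[of 1 x] by simp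
qed (simp_all add: scaleC_add_right scaleC_add_left scaleC_scaleC)

lemma cinner_add_right: "cinner x (y + z) = cinner x y + cinner x (z::'a::complex_inner)"
  by (metis cinner_add_left cinner_commute complex_cnj_add)

lemma cinner_scaleC_right: "cinner x (a *\<^sub>C y) = cnj a * cinner x (y::'a::complex_inner)"
  by (metis cinner_scaleC_left cinner_commute complex_cnj_mult)

lemma cinner_self: "cinner x x = complex_of_real ((norm (x::'a::complex_inner))\<^sup>2)"
proof (rule complex_eqI)
  show "Re (cinner x x) = Re (complex_of_real ((norm x)\<^sup>2))"
    by (simp add: Re_cinner power2_norm_eq_inner)
  show "Im (cinner x x) = Im (complex_of_real ((norm x)\<^sup>2))"
    using arg_cong[OF cinner_commute[of x x], of Im] by simp
qed

lemma norm_scaleC: "norm (a *\<^sub>C x) = cmod a * norm (x::'a::complex_inner)"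
proof -
  have "complex_of_real ((norm (a *\<^sub>C x))\<^sup>2) = (a * cnj a) * cinner x x"
    unfolding cinner_self[symmetric] by (simp add: cinner_scaleC_left cinner_scaleC_right)
  also have "\<dots> = complex_of_real ((cmod a * norm x)\<^sup>2)"
    by (simp only: cinner_self complex_norm_square[symmetric] power_mult_distrib of_real_mult)
  finally have "complex_of_real ((norm (a *\<^sub>C x))\<^sup>2) = complex_of_real ((cmod a * norm x)\<^sup>2)" .
  then have "(norm (a *\<^sub>C x))\<^sup>2 = (cmod a * norm x)\<^sup>2"
    using of_real_eq_iff by blast
  then show ?thesis by simp
qed

lemma Im_cinner: "Im (cinner x y) = inner x (\<i> *\<^sub>C (y::'a::complex_inner))"
  by (simp add: Re_cinner[symmetric] cinner_scaleC_right)

lemma norm_cinner_le: "cmod (cinner x y) \<le> norm x * norm (y::'a::complex_inner)"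
proof -
  obtain u where u: "cmod u = 1" "u * cinner x y = complex_of_real (cmod (cinner x y))"
  proof (cases "cinner x y = 0")
    case True then show ?thesis using that[of 1] by simp
  next
    case False
    have "cnj (sgn (cinner x y)) * cinner x y = complex_of_real (cmod (cinner x y))"
      using False by (simp add: sgn_div_norm scaleR_conv_of_real complex_norm_square[symmetric]
          mult.commute field_simps power2_eq_square)
    then show ?thesis using that[of "cnj (sgn (cinner x y))"] False by (simp add: norm_sgn)
  qed
  have "cmod (cinner x y) = Re (cinner (u *\<^sub>C x) y)"
    by (simp add: cinner_scaleC_left u)
  also have "\<dots> \<le> norm (u *\<^sub>C x) * norm y"
    by (simp add: Re_cinner norm_cauchy_schwarz)
  finally show ?thesis by (simp add: norm_scaleC u)
qed

lemma bounded_bilinear_scaleC: "bounded_bilinear (scaleC :: complex \<Rightarrow> 'a \<Rightarrow> 'a::complex_inner)"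
proof
  show "(r *\<^sub>R a) *\<^sub>C b = r *\<^sub>R a *\<^sub>C b" for r a and b :: 'a
    by (metis scaleC_of_real scaleC_scaleC scaleR_conv_of_real)
  show "a *\<^sub>C r *\<^sub>R b = r *\<^sub>R a *\<^sub>C b" for r a and b :: 'a
    by (metis scaleC_of_real scaleC_scaleC mult.commute)
  show "\<exists>K. \<forall>a (b::'a). norm (a *\<^sub>C b) \<le> norm a * norm b * K"
    by (intro exI[of _ 1]) (simp add: norm_scaleC)
qed (simp_all add: scaleC_add_left scaleC_add_right)

lemma bounded_bilinear_cinner: "bounded_bilinear (cinner :: 'a \<Rightarrow> 'a::complex_inner \<Rightarrow> complex)"
proof
  show "cinner (r *\<^sub>R a) b = r *\<^sub>R cinner a b" for r and a b :: 'a
    by (simp add: scaleC_of_real[symmetric] cinner_scaleC_left scaleR_conv_of_real)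
  show "cinner a (r *\<^sub>R b) = r *\<^sub>R cinner a b" for r and a b :: 'a
    by (simp add: scaleC_of_real[symmetric] cinner_scaleC_right scaleR_conv_of_real)
  show "\<exists>K. \<forall>a b::'a. norm (cinner a b) \<le> norm a * norm b * K"
    by (intro exI[of _ 1]) (simp add: norm_cinner_le)
qed (simp_all add: cinner_add_left cinner_add_right)

instantiation complex :: chilbert_space
begin
definition scaleC_complex :: "complex \<Rightarrow> complex \<Rightarrow> complex" where "scaleC_complex a x = a * x"
definition cinner_complex :: "complex \<Rightarrow> complex \<Rightarrow> complex" where "cinner_complex x y = x * cnj y"
instance
  by standard (simp_all add: scaleC_complex_def cinner_complex_def algebra_simps
      scaleR_conv_of_real inner_complex_def)
end

instantiation prod :: (complex_inner, complex_inner) complex_inner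
begin
definition scaleC_prod :: "complex \<Rightarrow> 'a \<times> 'b \<Rightarrow> 'a \<times> 'b"
  where "scaleC_prod a x = (a *\<^sub>C fst x, a *\<^sub>C snd x)"
definition cinner_prod :: "'a \<times> 'b \<Rightarrow> 'a \<times> 'b \<Rightarrow> complex"
  where "cinner_prod x y = cinner (fst x) (fst y) + cinner (snd x) (snd y)"
instance
proof
  fix x y :: "'a \<times> 'b"
  show "cinner x y = cnj (cinner y x)"
    unfolding cinner_prod_def by (metis cinner_commute complex_cnj_add)
qed (simp_all add: scaleC_prod_def cinner_prod_def scaleC_add_right scaleC_add_left scaleC_scaleC
      scaleC_of_real cinner_add_left cinner_scaleC_left Re_cinner inner_prod_def prod_eq_iff
      algebra_simps)
end

text \<open>Finitely supported families with the Euclidean inner product; the space of column vectors of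
  length \<open>n\<close> is the subspace of families supported in \<open>{..<n}\<close>.\<close>

instantiation poly_mapping :: (type, complex_inner) complex_inner
begin

lift_definition scaleR_poly_mapping :: "real \<Rightarrow> ('a \<Rightarrow>\<^sub>0 'b) \<Rightarrow> 'a \<Rightarrow>\<^sub>0 'b"
  is "\<lambda>r f i. r *\<^sub>R f i"
  by (erule finite_subset[rotated]) auto

lift_definition scaleC_poly_mapping :: "complex \<Rightarrow> ('a \<Rightarrow>\<^sub>0 'b) \<Rightarrow> 'a \<Rightarrow>\<^sub>0 'b"
  is "\<lambda>r f i. r *\<^sub>C f i"
  by (erule finite_subset[rotated]) auto

definition inner_poly_mapping :: "('a \<Rightarrow>\<^sub>0 'b) \<Rightarrow> ('a \<Rightarrow>\<^sub>0 'b) \<Rightarrow> real" where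
  "inner_poly_mapping f g = (\<Sum>i\<in>Poly_Mapping.keys f. inner (Poly_Mapping.lookup f i) (Poly_Mapping.lookup g i))"
definition cinner_poly_mapping :: "('a \<Rightarrow>\<^sub>0 'b) \<Rightarrow> ('a \<Rightarrow>\<^sub>0 'b) \<Rightarrow> complex" where
  "cinner_poly_mapping f g = (\<Sum>i\<in>Poly_Mapping.keys f. cinner (Poly_Mapping.lookup f i) (Poly_Mapping.lookup g i))"
definition norm_poly_mapping :: "('a \<Rightarrow>\<^sub>0 'b) \<Rightarrow> real" where
  "norm_poly_mapping f = sqrt (inner f f)"
definition dist_poly_mapping :: "('a \<Rightarrow>\<^sub>0 'b) \<Rightarrow> ('a \<Rightarrow>\<^sub>0 'b) \<Rightarrow> real" where
  "dist_poly_mapping f g = norm (f - g)"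
definition sgn_poly_mapping :: "('a \<Rightarrow>\<^sub>0 'b) \<Rightarrow> 'a \<Rightarrow>\<^sub>0 'b" where
  "sgn_poly_mapping f = inverse (norm f) *\<^sub>R f"
definition uniformity_poly_mapping :: "(('a \<Rightarrow>\<^sub>0 'b) \<times> ('a \<Rightarrow>\<^sub>0 'b)) filter" where
  "uniformity_poly_mapping = (INF e\<in>{0<..}. principal {(f, g). dist f g < e})"
definition open_poly_mapping :: "('a \<Rightarrow>\<^sub>0 'b) set \<Rightarrow> bool" where
  "open_poly_mapping S \<longleftrightarrow> (\<forall>f\<in>S. \<forall>\<^sub>F (f', g) in uniformity. f' = f \<longrightarrow> g \<in> S)"

instance
proof
  have inn: "inner f g = (\<Sum>i\<in>A. inner (Poly_Mapping.lookup f i) (Poly_Mapping.lookup g i))"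
    if "finite A" "Poly_Mapping.keys f \<subseteq> A" for f g :: "'a \<Rightarrow>\<^sub>0 'b" and A
    unfolding inner_poly_mapping_def using that
    by (intro sum.mono_neutral_left) (auto simp: in_keys_iff)
  have cinn: "cinner f g = (\<Sum>i\<in>A. cinner (Poly_Mapping.lookup f i) (Poly_Mapping.lookup g i))"
    if "finite A" "Poly_Mapping.keys f \<subseteq> A" for f g :: "'a \<Rightarrow>\<^sub>0 'b" and A
    unfolding cinner_poly_mapping_def using that
    by (intro sum.mono_neutral_left)
      (auto simp: in_keys_iff bounded_bilinear.zero_left[OF bounded_bilinear_cinner])
  fix f g h :: "'a \<Rightarrow>\<^sub>0 'b" and r s :: real and a b :: complex
  let ?A = "Poly_Mapping.keys f \<union> Poly_Mapping.keys g \<union> Poly_Mapping.keys (f + g) \<union> Poly_Mapping.keys (r *\<^sub>R f) \<union> Poly_Mapping.keys (a *\<^sub>C f)"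
  have A: "finite ?A" "Poly_Mapping.keys f \<subseteq> ?A" "Poly_Mapping.keys g \<subseteq> ?A" "Poly_Mapping.keys (f + g) \<subseteq> ?A"
    "Poly_Mapping.keys (r *\<^sub>R f) \<subseteq> ?A" "Poly_Mapping.keys (a *\<^sub>C f) \<subseteq> ?A" by auto
  note inns = A(2-)[THEN inn[OF A(1)]] and cinns = A(2-)[THEN cinn[OF A(1)]]
  show "r *\<^sub>R (f + g) = r *\<^sub>R f + r *\<^sub>R g" "(r + s) *\<^sub>R f = r *\<^sub>R f + s *\<^sub>R f"
    "r *\<^sub>R s *\<^sub>R f = (r * s) *\<^sub>R f" "1 *\<^sub>R f = f"
    by (transfer, simp add: algebra_simps)+
  show "a *\<^sub>C (f + g) = a *\<^sub>C f + a *\<^sub>C g" "(a + b) *\<^sub>C f = a *\<^sub>C f + b *\<^sub>C f"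
    "a *\<^sub>C b *\<^sub>C f = (a * b) *\<^sub>C f" "complex_of_real r *\<^sub>C f = r *\<^sub>R f"
    by (transfer, simp add: scaleC_add_right scaleC_add_left scaleC_scaleC scaleC_of_real)+
  show "inner f g = inner g f"
    unfolding inns by (simp add: inner_commute)
  show "inner (f + g) h = inner f h + inner g h"
    unfolding inns by (simp add: lookup_add inner_add_left sum.distrib)
  show "inner (r *\<^sub>R f) g = r * inner f g"
    unfolding inns by (simp add: scaleR_poly_mapping.rep_eq sum_distrib_left)
  show "0 \<le> inner f f" by (simp add: inner_poly_mapping_def sum_nonneg)
  show "inner f f = 0 \<longleftrightarrow> f = 0"
    by (auto simp: inner_poly_mapping_def sum_nonneg_eq_0_iff in_keys_iff)
       (metis in_keys_iff lookup_zero poly_mapping_eqI)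
  show "cinner f g = cnj (cinner g f)"
    unfolding cinns cnj_sum by (rule sum.cong[OF refl], rule cinner_commute)
  show "cinner (f + g) h = cinner f h + cinner g h"
    unfolding cinns by (simp add: lookup_add cinner_add_left sum.distrib)
  show "cinner (a *\<^sub>C f) g = a * cinner f g"
    unfolding cinns by (simp add: scaleC_poly_mapping.rep_eq cinner_scaleC_left sum_distrib_left)
  show "Re (cinner f g) = inner f g"
    by (simp add: cinner_poly_mapping_def inner_poly_mapping_def Re_cinner)
qed (fact norm_poly_mapping_def dist_poly_mapping_def sgn_poly_mapping_def
      uniformity_poly_mapping_def open_poly_mapping_def)+

end

definition cvec :: "nat \<Rightarrow> (nat \<Rightarrow>\<^sub>0 complex) set" where
  "cvec n = {v. Poly_Mapping.keys v \<subseteq> {..<n}}"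


section \<open>Operators\<close>

definition bounded_clinear :: "('a::complex_inner \<Rightarrow> 'b::complex_inner) \<Rightarrow> bool" where
  "bounded_clinear A \<longleftrightarrow> bounded_linear A \<and> (\<forall>c x. A (c *\<^sub>C x) = c *\<^sub>C A x)"

definition cadjoint :: "('a::complex_inner \<Rightarrow> 'b::complex_inner) \<Rightarrow> 'b \<Rightarrow> 'a" where
  "cadjoint A = (SOME B. \<forall>x y. cinner (A x) y = cinner x (B y))"

definition unitary_op :: "('a::complex_inner \<Rightarrow> 'a) \<Rightarrow> bool" where
  "unitary_op U \<longleftrightarrow> bounded_clinear U \<and> surj U \<and> (\<forall>x y. cinner (U x) (U y) = cinner x y)"

definition orthogonal_projection_op :: "('a::complex_inner \<Rightarrow> 'a) \<Rightarrow> bool" where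
  "orthogonal_projection_op P \<longleftrightarrow>
     bounded_clinear P \<and> P \<circ> P = P \<and> (\<forall>x y. cinner (P x) y = cinner x (P y))"

definition compact_op :: "('a::complex_inner \<Rightarrow> 'b::complex_inner) \<Rightarrow> bool" where
  "compact_op A \<longleftrightarrow> bounded_clinear A \<and> compact (closure (A ` cball 0 1))"

definition contraction_op :: "('a::complex_inner \<Rightarrow> 'b::complex_inner) \<Rightarrow> bool" where
  "contraction_op A \<longleftrightarrow> bounded_clinear A \<and> (\<forall>x. norm (A x) \<le> norm x)"

definition eigenspace :: "('a::complex_inner \<Rightarrow> 'a) \<Rightarrow> real \<Rightarrow> 'a set" where
  "eigenspace A a = {x. A x = complex_of_real a *\<^sub>C x}"

definition proj_onto :: "'a::complex_inner set \<Rightarrow> 'a \<Rightarrow> 'a" where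
  "proj_onto M x = (THE y. y \<in> M \<and> (\<forall>m\<in>M. cinner (x - y) m = 0))"

text \<open>Unitary equivalence of the operator \<open>A\<close> on the subspace \<open>M\<close> with the operator \<open>B\<close> on the
  subspace \<open>N\<close>, where \<open>A\<close> and \<open>B\<close> leave these subspaces invariant.\<close>

definition unitarily_equivalent_on ::
  "'a::complex_inner set \<Rightarrow> ('a \<Rightarrow> 'a) \<Rightarrow> 'b::complex_inner set \<Rightarrow> ('b \<Rightarrow> 'b) \<Rightarrow> bool" where
  "unitarily_equivalent_on M A N B \<longleftrightarrow>
     A ` M \<subseteq> M \<and> B ` N \<subseteq> N \<and>
     (\<exists>W. W ` M = N
        \<and> (\<forall>x\<in>M. \<forall>y\<in>M. W (x + y) = W x + W y)
        \<and> (\<forall>c. \<forall>x\<in>M. W (c *\<^sub>C x) = c *\<^sub>C W x)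
        \<and> (\<forall>x\<in>M. \<forall>y\<in>M. cinner (W x) (W y) = cinner x y)
        \<and> (\<forall>x\<in>M. W (A x) = B (W x)))"


section \<open>The vector-valued Hardy space of the circle\<close>

text \<open>Normalized arc length on the unit circle, as a Borel measure on the plane.\<close>

definition circle_measure :: "complex measure" where
  "circle_measure = distr (uniform_measure lborel {0..<2*pi}) borel cis"

definition fourier_coeff ::
  "(complex \<Rightarrow> 's::{chilbert_space, second_countable_topology}) \<Rightarrow> int \<Rightarrow> 's" where
  "fourier_coeff f n = (LINT z|circle_measure. (z powi (- n)) *\<^sub>C f z)"

definition hardy_fun ::
  "(complex \<Rightarrow> 's::{chilbert_space, second_countable_topology}) set" where
  "hardy_fun = {f. f \<in> borel_measurable circle_measure \<and>
     integrable circle_measure (\<lambda>z. (norm (f z))\<^sup>2) \<and> (\<forall>n<0. fourier_coeff f n = 0)}"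

definition hardy_rel ::
  "(complex \<Rightarrow> 's::{chilbert_space, second_countable_topology}) \<Rightarrow> (complex \<Rightarrow> 's) \<Rightarrow> bool" where
  "hardy_rel f g \<longleftrightarrow> f \<in> hardy_fun \<and> g \<in> hardy_fun \<and> (AE z in circle_measure. f z = g z)"

lemma space_circle [simp]: "space circle_measure = UNIV"
  and sets_circle [simp, measurable_cong]: "sets circle_measure = sets borel"
  by (simp_all add: circle_measure_def)

lemma measurable_cis_uniform: "cis \<in> measurable (uniform_measure lborel {0..<2*pi}) borel"
proof -
  have "cis \<in> borel_measurable borel"
    by (intro borel_measurable_continuous_onI continuous_intros)
  then show ?thesis by (simp add: measurable_def)
qed

lemma finite_measure_circle: "finite_measure circle_measure"
proof -
  have "finite_measure (uniform_measure lborel {0..<2*pi})"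
    by standard (auto simp: emeasure_uniform_measure ennreal_divide_eq_top_iff ennreal_eq_0_iff)
  then show ?thesis unfolding circle_measure_def
    by (rule finite_measure.finite_measure_distr) (rule measurable_cis_uniform)
qed

lemma AE_circle_norm: "AE z in circle_measure. cmod z = 1"
  unfolding circle_measure_def by (subst AE_distr_iff) (auto simp: measurable_cis_uniform)

lemma borel_measurable_scaleC [measurable]:
  fixes g :: "'b \<Rightarrow> 's::{chilbert_space, second_countable_topology}"
  assumes "f \<in> borel_measurable M" "g \<in> borel_measurable M"
  shows "(\<lambda>x. f x *\<^sub>C g x) \<in> borel_measurable M"
  using assms
  by (rule borel_measurable_continuous_Pair)
     (intro bounded_bilinear.continuous_on[OF bounded_bilinear_scaleC] continuous_intros)

lemma borel_measurable_cinner [measurable]: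
  fixes g :: "'b \<Rightarrow> 's::{chilbert_space, second_countable_topology}"
  assumes "f \<in> borel_measurable M" "g \<in> borel_measurable M"
  shows "(\<lambda>x. cinner (f x) (g x)) \<in> borel_measurable M"
  using assms
  by (rule borel_measurable_continuous_Pair)
     (intro bounded_bilinear.continuous_on[OF bounded_bilinear_cinner] continuous_intros)

lemma borel_measurable_powi [measurable]: "(\<lambda>z::complex. z powi n) \<in> borel_measurable borel"
  unfolding power_int_def by measurable

lemma hardy_fun_measurable:
  "f \<in> hardy_fun \<Longrightarrow> f \<in> borel_measurable circle_measure"
  by (simp add: hardy_fun_def)

lemma integrable_cinner_hardy:
  assumes "f \<in> hardy_fun" "g \<in> hardy_fun"
  shows "integrable circle_measure (\<lambda>z. cinner (f z) (g z))"
proof (rule Bochner_Integration.integrable_bound)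
  show "integrable circle_measure (\<lambda>z. (norm (f z))\<^sup>2 + (norm (g z))\<^sup>2)"
    using assms by (simp add: hardy_fun_def)
  show "(\<lambda>z. cinner (f z) (g z)) \<in> borel_measurable circle_measure"
    using assms[THEN hardy_fun_measurable] by (rule borel_measurable_cinner)
  have "cmod (cinner x y) \<le> norm ((norm x)\<^sup>2 + (norm y)\<^sup>2)" for x y :: 'a
  proof -
    have "2 * (norm x * norm y) \<le> (norm x)\<^sup>2 + (norm y)\<^sup>2"
      using sum_squares_bound[of "norm x" "norm y"] by simp
    moreover have "0 \<le> norm x * norm y" by simp
    ultimately have "norm x * norm y \<le> (norm x)\<^sup>2 + (norm y)\<^sup>2" by linarith
    with norm_cinner_le[of x y] show ?thesis by simp
  qed
  then show "AE z in circle_measure. cmod (cinner (f z) (g z)) \<le> norm ((norm (f z))\<^sup>2 + (norm (g z))\<^sup>2)"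
    by simp
qed

lemma integrable_fourier_hardy:
  fixes f :: "complex \<Rightarrow> 's::{chilbert_space, second_countable_topology}"
  assumes "f \<in> borel_measurable circle_measure" "integrable circle_measure (\<lambda>z. (norm (f z))\<^sup>2)"
  shows "integrable circle_measure (\<lambda>z. (z powi n) *\<^sub>C f z)"
proof (rule Bochner_Integration.integrable_bound)
  interpret finite_measure circle_measure by (rule finite_measure_circle)
  show "integrable circle_measure (\<lambda>z. (norm (f z))\<^sup>2 + 1)"
    using assms by simp
  show "(\<lambda>z. (z powi n) *\<^sub>C f z) \<in> borel_measurable circle_measure"
    using assms(1) by measurable
  have "x \<le> norm (x\<^sup>2 + 1)" if "0 \<le> x" for x :: real
    using sum_squares_bound[of x 1] that by simp
  then show "AE z in circle_measure. norm ((z powi n) *\<^sub>C f z) \<le> norm ((norm (f z))\<^sup>2 + 1)"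
    using AE_circle_norm by (auto simp: norm_scaleC norm_power_int)
qed

lemma hardy_fun_zero: "(\<lambda>_. 0) \<in> hardy_fun"
  by (simp add: hardy_fun_def fourier_coeff_def)

lemma hardy_fun_add:
  fixes f :: "complex \<Rightarrow> 's::{chilbert_space, second_countable_topology}"
  assumes "f \<in> hardy_fun" "g \<in> hardy_fun"
  shows "(\<lambda>z. f z + g z) \<in> hardy_fun"
proof -
  have fg: "f \<in> borel_measurable circle_measure" "g \<in> borel_measurable circle_measure"
    using assms[THEN hardy_fun_measurable] .
  have sq: "integrable circle_measure (\<lambda>z. (norm (f z))\<^sup>2)"
    "integrable circle_measure (\<lambda>z. (norm (g z))\<^sup>2)"
    using assms by (simp_all add: hardy_fun_def)
  have "integrable circle_measure (\<lambda>z. (norm (f z + g z))\<^sup>2)"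
  proof (rule Bochner_Integration.integrable_bound)
    show "integrable circle_measure (\<lambda>z. 2 * (norm (f z))\<^sup>2 + 2 * (norm (g z))\<^sup>2)"
      using sq by simp
    show "(\<lambda>z. (norm (f z + g z))\<^sup>2) \<in> borel_measurable circle_measure"
      using fg by measurable
    have "(norm (x + y))\<^sup>2 \<le> 2 * (norm x)\<^sup>2 + 2 * (norm y)\<^sup>2" for x y :: 's
    proof -
      have "(norm (x + y))\<^sup>2 \<le> (norm x + norm y)\<^sup>2"
        by (intro power_mono norm_triangle_ineq norm_ge_zero)
      also have "\<dots> \<le> 2 * (norm x)\<^sup>2 + 2 * (norm y)\<^sup>2"
        using sum_squares_bound[of "norm x" "norm y"] by (simp add: power2_sum)
      finally show ?thesis .
    qed
    then show "AE z in circle_measure.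
        norm ((norm (f z + g z))\<^sup>2) \<le> norm (2 * (norm (f z))\<^sup>2 + 2 * (norm (g z))\<^sup>2)"
      by simp
  qed
  moreover have "fourier_coeff (\<lambda>z. f z + g z) n = fourier_coeff f n + fourier_coeff g n" for n
    using integrable_fourier_hardy[OF fg(1) sq(1)] integrable_fourier_hardy[OF fg(2) sq(2)]
    by (simp add: fourier_coeff_def scaleC_add_right)
  ultimately show ?thesis
    using assms fg by (simp add: hardy_fun_def)
qed

lemma hardy_fun_scaleC:
  fixes f :: "complex \<Rightarrow> 's::{chilbert_space, second_countable_topology}"
  assumes "f \<in> hardy_fun"
  shows "(\<lambda>z. c *\<^sub>C f z) \<in> hardy_fun"
proof -
  have f: "f \<in> borel_measurable circle_measure"
    using assms by (rule hardy_fun_measurable)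
  have sq: "integrable circle_measure (\<lambda>z. (norm (f z))\<^sup>2)"
    using assms by (simp add: hardy_fun_def)
  have bl: "bounded_linear (\<lambda>x::'s. c *\<^sub>C x)"
    by (rule bounded_bilinear.bounded_linear_right[OF bounded_bilinear_scaleC])
  have "fourier_coeff (\<lambda>z. c *\<^sub>C f z) n = c *\<^sub>C fourier_coeff f n" for n
    unfolding fourier_coeff_def
    using integral_bounded_linear[OF bl integrable_fourier_hardy[OF f sq], of "- n"]
    by (simp add: scaleC_scaleC mult.commute)
  moreover have "(\<lambda>z. c *\<^sub>C f z) \<in> borel_measurable circle_measure"
    using f by measurable
  ultimately show ?thesis
    using assms sq by (simp add: hardy_fun_def norm_scaleC power_mult_distrib)
qed

lemma hardy_fun_scaleR:
  "f \<in> hardy_fun \<Longrightarrow> (\<lambda>z. r *\<^sub>R f z) \<in> hardy_fun"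
  using hardy_fun_scaleC[of f "complex_of_real r"] by (simp add: scaleC_of_real)

lemma hardy_fun_uminus:
  "f \<in> hardy_fun \<Longrightarrow> (\<lambda>z. - f z) \<in> hardy_fun"
  using hardy_fun_scaleR[of f "-1"] by simp

lemma hardy_fun_diff:
  "f \<in> hardy_fun \<Longrightarrow> g \<in> hardy_fun \<Longrightarrow> (\<lambda>z. f z - g z) \<in> hardy_fun"
  using hardy_fun_add[OF _ hardy_fun_uminus[of g], of f] by simp

text \<open>\<open>H\<^sup>2\<close> of the circle with values in \<open>'s\<close>: square integrable functions whose negative Fourier
  coefficients vanish, modulo equality almost everywhere.\<close>

quotient_type (overloaded) 's hardy = "complex \<Rightarrow> 's::{chilbert_space, second_countable_topology}"
  / partial: hardy_rel
proof (rule part_equivpI)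
  show "\<exists>f. hardy_rel f f"
    using hardy_fun_zero by (auto simp: hardy_rel_def)
  show "symp hardy_rel" by (rule sympI) (auto simp: hardy_rel_def)
  show "transp hardy_rel" by (rule transpI) (auto simp: hardy_rel_def)
qed

instantiation hardy :: ("{chilbert_space, second_countable_topology}") complex_inner
begin

lift_definition zero_hardy :: "'a hardy" is "\<lambda>_. 0"
  by (simp add: hardy_rel_def hardy_fun_zero)

lift_definition plus_hardy :: "'a hardy \<Rightarrow> 'a hardy \<Rightarrow> 'a hardy" is "\<lambda>f g z. f z + g z"
  by (auto simp: hardy_rel_def hardy_fun_add)

lift_definition minus_hardy :: "'a hardy \<Rightarrow> 'a hardy \<Rightarrow> 'a hardy" is "\<lambda>f g z. f z - g z"
  by (auto simp: hardy_rel_def hardy_fun_diff)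

lift_definition uminus_hardy :: "'a hardy \<Rightarrow> 'a hardy" is "\<lambda>f z. - f z"
  by (auto simp: hardy_rel_def hardy_fun_uminus)

lift_definition scaleR_hardy :: "real \<Rightarrow> 'a hardy \<Rightarrow> 'a hardy" is "\<lambda>r f z. r *\<^sub>R f z"
  by (auto simp: hardy_rel_def hardy_fun_scaleR)

lift_definition scaleC_hardy :: "complex \<Rightarrow> 'a hardy \<Rightarrow> 'a hardy" is "\<lambda>c f z. c *\<^sub>C f z"
  by (auto simp: hardy_rel_def hardy_fun_scaleC)

lift_definition cinner_hardy :: "'a hardy \<Rightarrow> 'a hardy \<Rightarrow> complex"
  is "\<lambda>f g. LINT z|circle_measure. cinner (f z) (g z)"
proof -
  fix f f' g g' :: "complex \<Rightarrow> 'a"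
  assume "hardy_rel f f'" "hardy_rel g g'"
  then show "(LINT z|circle_measure. cinner (f z) (g z)) = (LINT z|circle_measure. cinner (f' z) (g' z))"
    by (intro integral_cong_AE borel_measurable_cinner)
       (auto simp: hardy_rel_def hardy_fun_measurable)
qed

definition inner_hardy :: "'a hardy \<Rightarrow> 'a hardy \<Rightarrow> real" where
  "inner_hardy F G = Re (cinner F G)"
definition norm_hardy :: "'a hardy \<Rightarrow> real" where
  "norm_hardy F = sqrt (inner F F)"
definition dist_hardy :: "'a hardy \<Rightarrow> 'a hardy \<Rightarrow> real" where
  "dist_hardy F G = norm (F - G)"
definition sgn_hardy :: "'a hardy \<Rightarrow> 'a hardy" where
  "sgn_hardy F = inverse (norm F) *\<^sub>R F"
definition uniformity_hardy :: "('a hardy \<times> 'a hardy) filter" where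
  "uniformity_hardy = (INF e\<in>{0<..}. principal {(F, G). dist F G < e})"
definition open_hardy :: "'a hardy set \<Rightarrow> bool" where
  "open_hardy S \<longleftrightarrow> (\<forall>F\<in>S. \<forall>\<^sub>F (F', G) in uniformity. F' = F \<longrightarrow> G \<in> S)"

instance
proof
  fix F G K :: "'a hardy" and r s :: real and a b :: complex
  note hr = hardy_rel_def hardy_fun_add hardy_fun_diff hardy_fun_uminus hardy_fun_scaleR
    hardy_fun_scaleC hardy_fun_zero
  show "F + G + K = F + (G + K)" "F + G = G + F" "0 + F = F" "- F + F = 0" "F - G = F + - G"
    by (transfer; simp add: hr algebra_simps)+
  show "r *\<^sub>R (F + G) = r *\<^sub>R F + r *\<^sub>R G" "(r + s) *\<^sub>R F = r *\<^sub>R F + s *\<^sub>R F"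
    "r *\<^sub>R s *\<^sub>R F = (r * s) *\<^sub>R F" "1 *\<^sub>R F = F"
    by (transfer; simp add: hr scaleR_add_right scaleR_add_left)+
  show "a *\<^sub>C (F + G) = a *\<^sub>C F + a *\<^sub>C G" "(a + b) *\<^sub>C F = a *\<^sub>C F + b *\<^sub>C F"
    "a *\<^sub>C b *\<^sub>C F = (a * b) *\<^sub>C F" "complex_of_real r *\<^sub>C F = r *\<^sub>R F"
    by (transfer; simp add: hr scaleC_add_right scaleC_add_left scaleC_scaleC scaleC_of_real)+
  have cc: "cinner F G = cnj (cinner G F)" for F G :: "'a hardy"
  proof transfer
    fix f g :: "complex \<Rightarrow> 'a"
    show "(LINT z|circle_measure. cinner (f z) (g z)) = cnj (LINT z|circle_measure. cinner (g z) (f z))"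
      unfolding Bochner_Integration.integral_cnj[symmetric]
      by (rule Bochner_Integration.integral_cong[OF refl]) (rule cinner_commute)
  qed
  then show "cinner F G = cnj (cinner G F)" .
  show ca: "cinner (F + G) K = cinner F K + cinner G K"
    by transfer (simp add: hardy_rel_def integrable_cinner_hardy cinner_add_left)
  have cs: "cinner (a *\<^sub>C F) G = a * cinner F G" for a and F G :: "'a hardy"
    by transfer (simp add: cinner_scaleC_left)
  then show "cinner (a *\<^sub>C F) G = a * cinner F G" .
  show "Re (cinner F G) = inner F G" by (simp add: inner_hardy_def)
  show "inner F G = inner G F" using cc[of F G] by (simp add: inner_hardy_def)
  show "inner (F + G) K = inner F K + inner G K" by (simp add: inner_hardy_def ca)
  have "complex_of_real r *\<^sub>C F = r *\<^sub>R F"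
    by (transfer; simp add: hr scaleC_of_real)
  then show "inner (r *\<^sub>R F) G = r * inner F G"
    using cs[of "complex_of_real r" F G] by (simp add: inner_hardy_def)
  have cnn: "cinner F F = complex_of_real (LINT z|circle_measure. (norm (rep_hardy F z))\<^sup>2)"
    by (simp add: cinner_hardy.rep_eq cinner_self del: of_real_power)
  then show "0 \<le> inner F F" by (simp add: inner_hardy_def)
  show "inner F F = 0 \<longleftrightarrow> F = 0"
    unfolding inner_hardy_def
  proof transfer
    fix f :: "complex \<Rightarrow> 'a" assume "hardy_rel f f"
    then have f: "f \<in> hardy_fun" by (simp add: hardy_rel_def)
    then have "(LINT z|circle_measure. (norm (f z))\<^sup>2) = 0 \<longleftrightarrow>
        (AE z in circle_measure. (norm (f z))\<^sup>2 = 0)"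
      by (intro integral_nonneg_eq_0_iff_AE) (auto simp: hardy_fun_def)
    then show "Re (LINT z|circle_measure. cinner (f z) (f z)) = 0 \<longleftrightarrow> hardy_rel f (\<lambda>_. 0)"
      using f by (simp add: hr cinner_self del: of_real_power)
  qed
qed (fact norm_hardy_def dist_hardy_def sgn_hardy_def uniformity_hardy_def open_hardy_def)+

end

text \<open>Under the identification of \<open>H\<^sup>2 \<otimes> 's\<close> with \<open>'s hardy\<close>, the operator \<open>S\<^sub>z \<otimes> I\<close> is
  multiplication by \<open>z\<close>, and \<open>S\<^sub>z \<otimes> A\<close> is \<open>mult_z \<circ> id_tensor A\<close>.\<close>

lift_definition mult_z ::
  "'s::{chilbert_space, second_countable_topology} hardy \<Rightarrow> 's hardy" is "\<lambda>f z. z *\<^sub>C f z"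
proof -
  fix f g :: "complex \<Rightarrow> 's" assume fg: "hardy_rel f g"
  have *: "(\<lambda>z. z *\<^sub>C f z) \<in> hardy_fun" if f: "f \<in> hardy_fun" for f :: "complex \<Rightarrow> 's"
  proof -
    have fm: "f \<in> borel_measurable circle_measure"
      using f by (rule hardy_fun_measurable)
    have zf: "(\<lambda>z. z *\<^sub>C f z) \<in> borel_measurable circle_measure"
      by (rule borel_measurable_scaleC) (use fm in simp_all)
    have "integrable circle_measure (\<lambda>z. (norm (z *\<^sub>C f z))\<^sup>2)
        \<longleftrightarrow> integrable circle_measure (\<lambda>z. (norm (f z))\<^sup>2)"
      using AE_circle_norm zf fm by (intro integrable_cong_AE) (auto simp: norm_scaleC)
    moreover have "fourier_coeff (\<lambda>z. z *\<^sub>C f z) n = fourier_coeff f (n - 1)" for n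
      unfolding fourier_coeff_def
    proof (rule integral_cong_AE)
      show "(\<lambda>z. (z powi - n) *\<^sub>C z *\<^sub>C f z) \<in> borel_measurable circle_measure"
        using zf by measurable
      show "(\<lambda>z. (z powi - (n - 1)) *\<^sub>C f z) \<in> borel_measurable circle_measure"
        using fm by measurable
      have "(z powi - n) * z = z powi - (n - 1)" if "cmod z = 1" for z
      proof -
        have "z \<noteq> 0" using that by auto
        then show ?thesis using power_int_add_1[of z "- n"] by simp
      qed
      then show "AE z in circle_measure. (z powi - n) *\<^sub>C z *\<^sub>C f z = (z powi - (n - 1)) *\<^sub>C f z"
        using AE_circle_norm by (auto simp: scaleC_scaleC)
    qed
    ultimately show ?thesis using f zf by (simp add: hardy_fun_def)
  qed
  from fg show "hardy_rel (\<lambda>z. z *\<^sub>C f z) (\<lambda>z. z *\<^sub>C g z)"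
    by (auto simp: hardy_rel_def *)
qed

text \<open>The operator \<open>I \<otimes> A\<close>, acting pointwise, for a bounded operator \<open>A\<close>; the value for other \<open>A\<close> is irrelevant.\<close>

lift_definition id_tensor ::
  "('s \<Rightarrow> 's) \<Rightarrow> 's::{chilbert_space, second_countable_topology} hardy \<Rightarrow> 's hardy"
  is "\<lambda>A f z. if bounded_clinear A then A (f z) else 0"
proof -
  fix A :: "'s \<Rightarrow> 's" and f g :: "complex \<Rightarrow> 's" assume fg: "hardy_rel f g"
  have *: "(\<lambda>z. A (f z)) \<in> hardy_fun" if f: "f \<in> hardy_fun" and A: "bounded_clinear A"
    for f :: "complex \<Rightarrow> 's"
  proof -
    interpret A: bounded_linear A using A by (simp add: bounded_clinear_def)
    obtain K where K: "\<And>x. norm (A x) \<le> norm x * K" using A.bounded by blast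
    have fm: "f \<in> borel_measurable circle_measure"
      using f by (rule hardy_fun_measurable)
    have sq: "integrable circle_measure (\<lambda>z. (norm (f z))\<^sup>2)"
      using f by (simp add: hardy_fun_def)
    have Af: "(\<lambda>z. A (f z)) \<in> borel_measurable circle_measure"
      by (intro measurable_compose[OF fm] borel_measurable_continuous_onI
          A.continuous_on continuous_on_id)
    have "integrable circle_measure (\<lambda>z. (norm (A (f z)))\<^sup>2)"
    proof (rule Bochner_Integration.integrable_bound)
      show "integrable circle_measure (\<lambda>z. (norm (f z))\<^sup>2 * K\<^sup>2)"
        using sq by simp
      show "(\<lambda>z. (norm (A (f z)))\<^sup>2) \<in> borel_measurable circle_measure"
        using Af by measurable
      have "(norm (A x))\<^sup>2 \<le> (norm x)\<^sup>2 * K\<^sup>2" for x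
        using power_mono[OF K[of x] norm_ge_zero, of 2] by (simp add: power_mult_distrib)
      then show "AE z in circle_measure. norm ((norm (A (f z)))\<^sup>2) \<le> norm ((norm (f z))\<^sup>2 * K\<^sup>2)"
        by simp
    qed
    moreover have "fourier_coeff (\<lambda>z. A (f z)) n = A (fourier_coeff f n)" for n
      unfolding fourier_coeff_def
      using integral_bounded_linear[OF A.bounded_linear_axioms integrable_fourier_hardy[OF fm sq], of "- n"] A
      by (simp add: bounded_clinear_def)
    ultimately show ?thesis using f Af by (simp add: hardy_fun_def A.zero)
  qed
  from fg show "hardy_rel (\<lambda>z. if bounded_clinear A then A (f z) else 0)
      (\<lambda>z. if bounded_clinear A then A (g z) else 0)"
    by (cases "bounded_clinear A") (auto simp: hardy_rel_def * hardy_fun_zero)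
qed


section \<open>BCL pairs and the operator \<open>H\<close>\<close>

definition BCL_triple :: "('s::{chilbert_space, second_countable_topology} \<Rightarrow> 's) \<Rightarrow> ('s \<Rightarrow> 's) \<Rightarrow> bool" where
  "BCL_triple U P \<longleftrightarrow> unitary_op U \<and> orthogonal_projection_op P"

definition perp :: "('s::complex_inner \<Rightarrow> 's) \<Rightarrow> 's \<Rightarrow> 's" where
  "perp P x = x - P x"

definition M_phi1 ::
  "('s \<Rightarrow> 's) \<Rightarrow> ('s \<Rightarrow> 's) \<Rightarrow> 's::{chilbert_space, second_countable_topology} hardy \<Rightarrow> 's hardy" where
  "M_phi1 U P F =
     id_tensor (P \<circ> cadjoint U) F + mult_z (id_tensor (perp P \<circ> cadjoint U) F)"

definition M_phi2 ::
  "('s \<Rightarrow> 's) \<Rightarrow> ('s \<Rightarrow> 's) \<Rightarrow> 's::{chilbert_space, second_countable_topology} hardy \<Rightarrow> 's hardy" where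
  "M_phi2 U P F = id_tensor (U \<circ> perp P) F + mult_z (id_tensor (U \<circ> P) F)"

definition H_op :: "('h::complex_inner \<Rightarrow> 'h) \<Rightarrow> ('h \<Rightarrow> 'h) \<Rightarrow> 'h \<Rightarrow> 'h" where
  "H_op V1 V2 x =
     V2 (cadjoint V2 x) - V1 (cadjoint V1 x)
     - V2 (V2 (cadjoint V2 (cadjoint V2 x))) + V1 (V2 (cadjoint V1 (cadjoint V2 x)))"

definition nonzero_part_space :: "('h::complex_inner \<Rightarrow> 'h) \<Rightarrow> 'h set" where
  "nonzero_part_space T = closure (range T)"

definition eigenvalues01 :: "('h::complex_inner \<Rightarrow> 'h) \<Rightarrow> real set" where
  "eigenvalues01 T = {a. 0 < a \<and> a < 1 \<and> eigenspace T a \<noteq> {0}}"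

text \<open>The Hilbert space direct sum of the (for self-adjoint \<open>T\<close> mutually orthogonal) eigenspaces
  \<open>E(a)\<close>, \<open>0 < a < 1\<close>, as a closed subspace.\<close>

definition E01_space :: "('h::complex_inner \<Rightarrow> 'h) \<Rightarrow> 'h set" where
  "E01_space T = closure (complex_vector.span (\<Union>a\<in>eigenvalues01 T. eigenspace T a))"

definition E01 :: "('h::complex_inner \<Rightarrow> 'h) \<Rightarrow> 'h \<Rightarrow> 'h" where
  "E01 T x = (\<Sum>\<^sub>\<infinity>a\<in>eigenvalues01 T. a *\<^sub>R proj_onto (eigenspace T a) x)"

text \<open>The block diagonal operator with diagonal blocks \<open>I\<close>, \<open>E\<close>, \<open>-I\<close>, \<open>-E\<close> on
  \<open>block_space m K n = \<complex>\<^sup>m \<oplus> K \<oplus> \<complex>\<^sup>n \<oplus> K\<close>.\<close>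

definition block_space ::
  "nat \<Rightarrow> 'h set \<Rightarrow> nat \<Rightarrow> ((nat \<Rightarrow>\<^sub>0 complex) \<times> 'h \<times> (nat \<Rightarrow>\<^sub>0 complex) \<times> 'h) set" where
  "block_space m K n = cvec m \<times> K \<times> cvec n \<times> K"

definition block_op ::
  "('h \<Rightarrow> 'h::complex_inner) \<Rightarrow> (nat \<Rightarrow>\<^sub>0 complex) \<times> 'h \<times> (nat \<Rightarrow>\<^sub>0 complex) \<times> 'h
    \<Rightarrow> (nat \<Rightarrow>\<^sub>0 complex) \<times> 'h \<times> (nat \<Rightarrow>\<^sub>0 complex) \<times> 'h" where
  "block_op E = (\<lambda>(v, x, w, y). (v, E x, - w, - E y))"

end

(* Write V1, V2 for the BCL pair and W for the defect projection I - V2 V2*. Since V1 and V2 commute,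
   H = Q1 - Q2 with the orthogonal projections Q1 = V2 W V2* and Q2 = V1 W V1*. Put K = Q1 + Q2 - I.
   Then H K = - K H and H^2 + K^2 = I. The second identity confines the eigenvalues of H to [-1, 1];
   together the two show that, for |a| < 1, K / sqrt (1 - a^2) maps E(-a) unitarily onto E(a). The
   orthogonal sum J of these unitaries over the eigenvalues a in (0,1) satisfies J H = - H J, and the
   spectral theorem for the compact self-adjoint H splits the closure of its range into
   E(1), the sum of the E(a), E(-1), and the sum of the E(-a). *)

theory Submission
  imports Defs
begin

text \<open>The relations between H and K hold for any two orthogonal projections, so the spectral
  argument is carried out for an abstract anticommuting pair. On E(a) the operator K^2 is the scalar
  1 - a^2. For |a| < 1 this is positive and supplies the normalisation 1 / sqrt (1 - a^2). At a = 1
  and a = -1 it is zero: K gives no link between E(1) and E(-1), so d_1 and d_{-1} enter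
  independently, and they are finite by compactness. The target matrix places both copies of the
  (0,1) part on the same space, hence the negative eigenspaces must be carried over to the positive
  ones, where H turns into -H. The main obstacle is analytic: adjoints are chosen by an indefinite
  description that is meaningful through the Riesz theorem, and orthogonal series must converge;
  both rest on completeness, which for the quotient space of Hardy functions has to be proved by a
  Riesz-Fischer argument.\<close>

interpretation scaleC: bounded_bilinear "scaleC :: complex \<Rightarrow> 'a \<Rightarrow> 'a::complex_inner"
  by (rule bounded_bilinear_scaleC)

interpretation cinner: bounded_bilinear "cinner :: 'a \<Rightarrow> 'a::complex_inner \<Rightarrow> complex"
  by (rule bounded_bilinear_cinner)

declare cinner.zero_left [simp] cinner.zero_right [simp]

lemma cinner_eq_0_commute: "cinner x y = 0 \<longleftrightarrow> cinner y (x::'a::complex_inner) = 0"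
  by (metis cinner_commute complex_cnj_zero)

lemma cinner_self_eq_0 [simp]: "cinner x x = 0 \<longleftrightarrow> x = (0::'a::complex_inner)"
  by (simp add: cinner_self)

lemma norm_add_orthogonal:
  fixes x y :: "'a::complex_inner"
  assumes "cinner x y = 0"
  shows "(norm (x + y))\<^sup>2 = (norm x)\<^sup>2 + (norm y)\<^sup>2"
proof -
  have "inner x y = 0" using assms Re_cinner[of x y] by simp
  then show ?thesis by (simp add: power2_norm_eq_inner inner_add_left inner_add_right inner_commute)
qed

lemma scaleR_eq_scaleC: "r *\<^sub>R x = complex_of_real r *\<^sub>C (x::'a::complex_inner)"
  by (simp add: scaleC_of_real)

section \<open>Orthogonal projections onto closed subspaces\<close>

definition closed_csubspace :: "'a::complex_inner set \<Rightarrow> bool" where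
  "closed_csubspace M \<longleftrightarrow> complex_vector.subspace M \<and> closed M"

lemma closed_csubspaceD:
  assumes "closed_csubspace M"
  shows "closed M" "0 \<in> M" "x \<in> M \<Longrightarrow> y \<in> M \<Longrightarrow> x + y \<in> M" "x \<in> M \<Longrightarrow> c *\<^sub>C x \<in> M"
    "x \<in> M \<Longrightarrow> r *\<^sub>R x \<in> M" "x \<in> M \<Longrightarrow> y \<in> M \<Longrightarrow> x - y \<in> M" "x \<in> M \<Longrightarrow> - x \<in> M"
  using assms
  by (auto simp: closed_csubspace_def complex_vector.subspace_def scaleR_eq_scaleC
      complex_vector.subspace_diff complex_vector.subspace_neg)

text \<open>The parallelogram law makes a minimising sequence Cauchy, and completeness supplies its
  limit.\<close>

lemma exists_closest_point:
  fixes M :: "'a::chilbert_space set"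
  assumes M: "closed_csubspace M"
  obtains y where "y \<in> M" "\<And>m. m \<in> M \<Longrightarrow> norm (x - y) \<le> norm (x - m)"
proof -
  note MD = closed_csubspaceD[OF M]
  define d where "d = infdist x M"
  have d0: "0 \<le> d" by (simp add: d_def infdist_nonneg)
  have dle: "d \<le> norm (x - m)" if "m \<in> M" for m
    using infdist_le[OF that, of x] by (simp add: d_def dist_norm)
  have "\<exists>m\<in>M. norm (x - m) < d + 1 / real (Suc n)" for n
  proof (rule ccontr)
    assume "\<not> ?thesis"
    then have "d + 1 / real (Suc n) \<le> infdist x M"
      unfolding infdist_def using MD(2)
      by (auto intro!: cINF_greatest simp: dist_norm not_less)
    then show False by (simp add: d_def)
  qed
  then obtain y where yM: "\<And>n. y n \<in> M" and y: "\<And>n. norm (x - y n) < d + 1 / real (Suc n)"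
    by metis
  have nd: "(\<lambda>n. norm (x - y n)) \<longlonglongrightarrow> d"
  proof (rule tendsto_sandwich[OF _ _ tendsto_const])
    show "\<forall>\<^sub>F n in sequentially. d \<le> norm (x - y n)" using dle yM by simp
    show "\<forall>\<^sub>F n in sequentially. norm (x - y n) \<le> d + 1 / real (Suc n)"
      by (intro always_eventually allI less_imp_le y)
    have "(\<lambda>n. d + 1 / real (Suc n)) \<longlonglongrightarrow> d + 0"
      by (intro tendsto_intros LIMSEQ_Suc lim_1_over_n)
    then show "(\<lambda>n. d + 1 / real (Suc n)) \<longlonglongrightarrow> d" by simp
  qed
  \<comment> \<open>The midpoint of \<open>y n\<close> and \<open>y m\<close> lies in
    \<open>M\<close>, so its distance \<open>h\<close> from \<open>x\<close> is at least
    \<open>d\<close>.\<close>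
  have par: "(norm (y n - y m))\<^sup>2 \<le> 2 * ((norm (x - y n))\<^sup>2 - d\<^sup>2) + 2 * ((norm (x - y m))\<^sup>2 - d\<^sup>2)" for n m
  proof -
    define h where "h = norm (x - (1/2) *\<^sub>R (y n + y m))"
    have "(1/2) *\<^sub>R (y n + y m) \<in> M" by (intro MD yM)
    then have "d\<^sup>2 \<le> h\<^sup>2"
      unfolding h_def by (intro power_mono dle d0)
    moreover have "(norm (y n - y m))\<^sup>2 + 4 * h\<^sup>2
        = 2 * (norm (x - y n))\<^sup>2 + 2 * (norm (x - y m))\<^sup>2"
      unfolding h_def by (simp add: power2_norm_eq_inner algebra_simps inner_commute)
    ultimately show ?thesis by (simp add: right_diff_distrib)
  qed
  have "(\<lambda>n. (norm (x - y n))\<^sup>2 - d\<^sup>2) \<longlonglongrightarrow> d\<^sup>2 - d\<^sup>2"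
    by (intro tendsto_intros nd)
  then have sq: "(\<lambda>n. (norm (x - y n))\<^sup>2 - d\<^sup>2) \<longlonglongrightarrow> 0" by simp
  have "Cauchy y"
  proof (rule metric_CauchyI)
    fix e :: real assume e: "0 < e"
    then have "\<forall>\<^sub>F n in sequentially. (norm (x - y n))\<^sup>2 - d\<^sup>2 < e\<^sup>2 / 4"
      using order_tendstoD(2)[OF sq, of "e\<^sup>2/4"] by simp
    then obtain N where N: "\<And>n. n \<ge> N \<Longrightarrow> (norm (x - y n))\<^sup>2 - d\<^sup>2 < e\<^sup>2 / 4"
      by (auto simp: eventually_sequentially)
    have "dist (y n) (y m) < e" if "n \<ge> N" "m \<ge> N" for n m
    proof -
      have "(norm (y n - y m))\<^sup>2 < e\<^sup>2"
        using par[of n m] N[OF that(1)] N[OF that(2)] by argo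
      then show ?thesis using e by (auto simp: dist_norm intro: power2_less_imp_less)
    qed
    then show "\<exists>N. \<forall>n\<ge>N. \<forall>m\<ge>N. dist (y n) (y m) < e" by blast
  qed
  then obtain l where l: "y \<longlonglongrightarrow> l"
    using Cauchy_convergent_iff convergent_def by blast
  have lM: "l \<in> M" using closed_sequentially[OF MD(1)] yM l by blast
  have "(\<lambda>n. norm (x - y n)) \<longlonglongrightarrow> norm (x - l)" by (intro tendsto_intros l)
  then have "norm (x - l) = d" using nd LIMSEQ_unique by blast
  then show thesis using that lM dle by blast
qed

text \<open>Orthogonality is the first-order condition at the closest point.\<close>

lemma exists_orthogonal_projection:
  fixes M :: "'a::chilbert_space set"
  assumes M: "closed_csubspace M"
  obtains y where "y \<in> M" "\<And>m. m \<in> M \<Longrightarrow> cinner (x - y) m = 0"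
proof -
  note MD = closed_csubspaceD[OF M]
  obtain y where y: "y \<in> M" "\<And>m. m \<in> M \<Longrightarrow> norm (x - y) \<le> norm (x - m)"
    using exists_closest_point[OF M] by blast
  have re: "inner (x - y) m = 0" if m: "m \<in> M" for m
  proof (rule ccontr)
    assume ne: "inner (x - y) m \<noteq> 0"
    then have m0: "inner m m > 0" by auto
    \<comment> \<open>The minimiser of the quadratic |x - y - t m|^2 in the real variable t.\<close>
    define t where "t = inner (x - y) m / inner m m"
    have "y + t *\<^sub>R m \<in> M" using MD y m by blast
    then have "(norm (x - y))\<^sup>2 \<le> (norm (x - (y + t *\<^sub>R m)))\<^sup>2"
      using y(2) by (simp add: power_mono)
    also have "x - (y + t *\<^sub>R m) = (x - y) - t *\<^sub>R m" by simp
    also have "(norm ((x - y) - t *\<^sub>R m))\<^sup>2 = (norm (x - y))\<^sup>2 - 2 * t * inner (x - y) m + t\<^sup>2 * inner m m"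
      unfolding power2_norm_eq_inner
      by (simp add: inner_diff_left inner_diff_right inner_commute power2_eq_square)
    also have "\<dots> = (norm (x - y))\<^sup>2 - (inner (x - y) m)\<^sup>2 / inner m m"
      using m0 by (simp add: t_def power2_eq_square field_simps)
    finally have "(inner (x - y) m)\<^sup>2 / inner m m \<le> 0" by simp
    moreover have "(inner (x - y) m)\<^sup>2 / inner m m > 0" using ne m0 by simp
    ultimately show False by simp
  qed
  \<comment> \<open>The imaginary part of the complex product is the real product with
    \<open>\<i> *\<^sub>C m\<close>, which is again in \<open>M\<close>.\<close>
  have "cinner (x - y) m = 0" if m: "m \<in> M" for m
    using re[OF m] re[OF MD(4)[OF m, of \<i>]] by (intro complex_eqI) (simp_all add: Re_cinner Im_cinner)
  with y(1) that show thesis by blast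
qed

text \<open>The difference of two candidates lies in \<open>M\<close> and is orthogonal to
  \<open>M\<close>, hence to itself. This rule evaluates the definite description in
  \<open>proj_onto\<close>.\<close>

lemma proj_onto_eqI:
  assumes M: "closed_csubspace M" and "y \<in> M" "\<And>m. m \<in> M \<Longrightarrow> cinner (x - y) m = 0"
  shows "proj_onto M x = y"
  unfolding proj_onto_def
proof (rule the_equality)
  fix y' assume y': "y' \<in> M \<and> (\<forall>m\<in>M. cinner (x - y') m = 0)"
  then have "y' - y \<in> M" using closed_csubspaceD[OF M] assms by blast
  then have "cinner (x - y) (y' - y) = 0" "cinner (x - y') (y' - y) = 0" using y' assms by blast+
  then have "cinner (y' - y) (y' - y) = 0" by (simp add: cinner.diff_left)
  then show "y' = y" by simp
qed (use assms in blast)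

lemma
  fixes M :: "'a::chilbert_space set"
  assumes M: "closed_csubspace M"
  shows proj_onto_mem: "proj_onto M x \<in> M"
    and proj_onto_orthogonal: "m \<in> M \<Longrightarrow> cinner (x - proj_onto M x) m = 0"
proof -
  obtain y where y: "y \<in> M" "\<And>m. m \<in> M \<Longrightarrow> cinner (x - y) m = 0"
    using exists_orthogonal_projection[OF M] by blast
  have "proj_onto M x = y" by (rule proj_onto_eqI[OF M]) (use y in auto)
  with y show "proj_onto M x \<in> M" "m \<in> M \<Longrightarrow> cinner (x - proj_onto M x) m = 0" by auto
qed

lemma cinner_proj_onto_left:
  fixes M :: "'a::chilbert_space set"
  assumes M: "closed_csubspace M" and "m \<in> M"
  shows "cinner (proj_onto M x) m = cinner x m"
  using proj_onto_orthogonal[OF assms, of x] by (simp add: cinner.diff_left)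

lemma proj_onto_self: "closed_csubspace M \<Longrightarrow> x \<in> M \<Longrightarrow> proj_onto M x = x"
  by (rule proj_onto_eqI) auto

lemma proj_onto_eq_0: "closed_csubspace M \<Longrightarrow> (\<And>m. m \<in> M \<Longrightarrow> cinner x m = 0) \<Longrightarrow> proj_onto M x = 0"
  by (rule proj_onto_eqI) (auto simp: closed_csubspaceD)

lemma proj_onto_add:
  fixes M :: "'a::chilbert_space set"
  assumes M: "closed_csubspace M"
  shows "proj_onto M (x + y) = proj_onto M x + proj_onto M y"
proof (rule proj_onto_eqI[OF M])
  show "proj_onto M x + proj_onto M y \<in> M" by (intro closed_csubspaceD[OF M] proj_onto_mem[OF M])
  fix m assume m: "m \<in> M"
  show "cinner (x + y - (proj_onto M x + proj_onto M y)) m = 0"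
    by (simp add: cinner.diff_left cinner.add_left cinner_proj_onto_left[OF M m])
qed

lemma proj_onto_scaleC:
  fixes M :: "'a::chilbert_space set"
  assumes M: "closed_csubspace M"
  shows "proj_onto M (c *\<^sub>C x) = c *\<^sub>C proj_onto M x"
proof (rule proj_onto_eqI[OF M])
  show "c *\<^sub>C proj_onto M x \<in> M" by (intro closed_csubspaceD[OF M] proj_onto_mem[OF M])
  fix m assume m: "m \<in> M"
  show "cinner (c *\<^sub>C x - c *\<^sub>C proj_onto M x) m = 0"
    by (simp add: cinner.diff_left cinner_scaleC_left cinner_proj_onto_left[OF M m])
qed

lemma norm_proj_onto_le:
  fixes M :: "'a::chilbert_space set"
  assumes M: "closed_csubspace M"
  shows "norm (proj_onto M x) \<le> norm x"
proof -
  have "cinner (proj_onto M x) (x - proj_onto M x) = 0"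
    using proj_onto_orthogonal[OF M proj_onto_mem[OF M]] cinner_eq_0_commute by blast
  from norm_add_orthogonal[OF this] have "(norm (proj_onto M x))\<^sup>2 \<le> (norm x)\<^sup>2" by simp
  then show ?thesis by (rule power2_le_imp_le) simp
qed

lemma bounded_clinear_proj_onto:
  fixes M :: "'a::chilbert_space set"
  assumes M: "closed_csubspace M"
  shows "bounded_clinear (proj_onto M)"
  unfolding bounded_clinear_def
proof
  show "bounded_linear (proj_onto M)"
  proof (rule bounded_linear_intro[where K = 1])
    show "proj_onto M (r *\<^sub>R x) = r *\<^sub>R proj_onto M x" for r x
      unfolding scaleR_eq_scaleC by (rule proj_onto_scaleC[OF M])
  qed (simp_all add: proj_onto_add[OF M] norm_proj_onto_le[OF M])
qed (simp add: proj_onto_scaleC[OF M])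

section \<open>Closed spans\<close>

lemma closed_csubspace_closure:
  fixes S :: "'a::complex_inner set"
  assumes S: "complex_vector.subspace S"
  shows "closed_csubspace (closure S)"
  unfolding closed_csubspace_def complex_vector.subspace_def
proof (intro conjI ballI allI)
  show "0 \<in> closure S" using S closure_subset complex_vector.subspace_0 by blast
  fix x assume "x \<in> closure S"
  then obtain f where f: "\<And>n. f n \<in> S" "f \<longlonglongrightarrow> x" by (auto simp: closure_sequential)
  { fix y assume "y \<in> closure S"
    then obtain g where g: "\<And>n. g n \<in> S" "g \<longlonglongrightarrow> y" by (auto simp: closure_sequential)
    have "(\<lambda>n. f n + g n) \<longlonglongrightarrow> x + y" by (intro tendsto_intros f g)
    moreover have "\<And>n. f n + g n \<in> S" using f g S complex_vector.subspace_add by blast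
    ultimately show "x + y \<in> closure S"
      unfolding closure_sequential by (intro exI[of _ "\<lambda>n. f n + g n"]) simp }
  fix c
  have "(\<lambda>n. c *\<^sub>C f n) \<longlonglongrightarrow> c *\<^sub>C x" by (intro scaleC.tendsto tendsto_intros f)
  moreover have "\<And>n. c *\<^sub>C f n \<in> S" using f S complex_vector.subspace_scale by blast
  ultimately show "c *\<^sub>C x \<in> closure S"
    unfolding closure_sequential by (intro exI[of _ "\<lambda>n. c *\<^sub>C f n"]) simp
qed simp

abbreviation closed_span :: "'a::complex_inner set \<Rightarrow> 'a set" where
  "closed_span S \<equiv> closure (complex_vector.span S)"

lemma closed_csubspace_closed_span: "closed_csubspace (closed_span S)"
  by (intro closed_csubspace_closure complex_vector.subspace_span)

lemma closed_span_superset: "S \<subseteq> closed_span S"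
  using complex_vector.span_superset closure_subset by blast

lemma closed_span_minimal: "S \<subseteq> M \<Longrightarrow> closed_csubspace M \<Longrightarrow> closed_span S \<subseteq> M"
  unfolding closed_csubspace_def by (intro closure_minimal complex_vector.span_minimal) auto

definition orthocomp :: "'a::complex_inner set \<Rightarrow> 'a set" where
  "orthocomp S = {x. \<forall>s\<in>S. cinner x s = 0}"

lemma closed_csubspace_kernel:
  assumes "bounded_clinear A"
  shows "closed_csubspace {x. A x = 0}"
proof -
  interpret A: bounded_linear A using assms by (simp add: bounded_clinear_def)
  have "{x. A x = 0} = A -` {0}" by auto
  then have "closed {x. A x = 0}"
    by (simp add: continuous_closed_vimage A.isCont)
  then show ?thesis using assms
    by (auto simp: closed_csubspace_def complex_vector.subspace_def A.add A.zero bounded_clinear_def)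
qed

lemma bounded_clinear_cinner_left: "bounded_clinear (\<lambda>x. cinner x (s::'a::complex_inner))"
  by (simp add: bounded_clinear_def cinner.bounded_linear_left cinner_scaleC_left scaleC_complex_def)

lemma closed_csubspace_INT:
  "(\<And>i. i \<in> I \<Longrightarrow> closed_csubspace (M i)) \<Longrightarrow> closed_csubspace (\<Inter>i\<in>I. M i)"
  unfolding closed_csubspace_def by (auto intro!: complex_vector.subspace_Inter)

lemma closed_csubspace_orthocomp: "closed_csubspace (orthocomp S)"
proof -
  have "orthocomp S = (\<Inter>s\<in>S. {x. cinner x s = 0})" by (auto simp: orthocomp_def)
  then show ?thesis
    by (simp add: closed_csubspace_INT closed_csubspace_kernel[OF bounded_clinear_cinner_left])
qed

text \<open>The vectors orthogonal to \<open>T\<close> form a closed subspace, so orthogonality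
  passes from \<open>S\<close> to its closed span; with the roles exchanged it then passes to the
  closed span of \<open>T\<close>.\<close>

lemma orthogonal_closed_span:
  assumes "\<And>s t. s \<in> S \<Longrightarrow> t \<in> T \<Longrightarrow> cinner s t = 0" "x \<in> closed_span S" "y \<in> closed_span T"
  shows "cinner x (y :: 'a::complex_inner) = 0"
proof -
  have "S \<subseteq> orthocomp T" using assms(1) by (auto simp: orthocomp_def)
  then have "x \<in> orthocomp T"
    using assms(2) closed_span_minimal[OF _ closed_csubspace_orthocomp] by blast
  then have "T \<subseteq> orthocomp {x}" by (auto simp: orthocomp_def cinner_eq_0_commute)
  then have "y \<in> orthocomp {x}"
    using assms(3) closed_span_minimal[OF _ closed_csubspace_orthocomp] by blast
  then show ?thesis by (auto simp: orthocomp_def cinner_eq_0_commute)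
qed

section \<open>Adjoints\<close>

text \<open>The kernel of a nonzero functional has codimension one, so a vector \<open>u\<close>
  orthogonal to it represents \<open>f\<close> up to a scalar.\<close>

lemma riesz_representation:
  fixes f :: "'a::chilbert_space \<Rightarrow> complex"
  assumes f: "bounded_clinear f"
  obtains v where "\<And>x. f x = cinner x v"
proof (cases "\<forall>x. f x = 0")
  case True
  then show thesis using that[of 0] by simp
next
  case False
  interpret f: bounded_linear f using f by (simp add: bounded_clinear_def)
  obtain x0 where x0: "f x0 \<noteq> 0" using False by blast
  have N: "closed_csubspace {x. f x = 0}" using closed_csubspace_kernel[OF f] .
  define u where "u = x0 - proj_onto {x. f x = 0} x0"
  have u: "cinner u m = 0" if "f m = 0" for m
    unfolding u_def using proj_onto_orthogonal[OF N] that by blast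
  have fu: "f u \<noteq> 0" using x0 proj_onto_mem[OF N, of x0] by (simp add: u_def f.diff)
  then have u0: "u \<noteq> 0" by (auto simp: f.zero)
  have "f x = cinner x (cnj (f u / cinner u u) *\<^sub>C u)" for x
  proof -
    \<comment> \<open>Subtracting this multiple of \<open>u\<close> moves \<open>x\<close> into the
      kernel, to which \<open>u\<close> is orthogonal.\<close>
    have "f (x - (f x / f u) *\<^sub>C u) = 0"
      using f fu by (simp add: f.diff bounded_clinear_def scaleC_complex_def)
    then have "cinner (x - (f x / f u) *\<^sub>C u) u = 0" using u cinner_eq_0_commute by blast
    then have "cinner x u = f x / f u * cinner u u" by (simp add: cinner.diff_left cinner_scaleC_left)
    then show ?thesis using fu u0 by (simp add: cinner_scaleC_right)
  qed
  then show thesis using that by blast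
qed

text \<open>\<open>cadjoint\<close> chooses some solution of the adjoint equation; the Riesz theorem
  provides one, using completeness of the domain.\<close>

lemma cinner_cadjoint_right:
  fixes A :: "'a::chilbert_space \<Rightarrow> 'b::complex_inner"
  assumes A: "bounded_clinear A"
  shows "cinner x (cadjoint A y) = cinner (A x) y"
proof -
  interpret A: bounded_linear A using A by (simp add: bounded_clinear_def)
  have "\<exists>v. \<forall>x. cinner (A x) y = cinner x v" for y
  proof -
    have "bounded_clinear (\<lambda>x. cinner (A x) y)"
      using A bounded_linear_compose[OF cinner.bounded_linear_left A.bounded_linear_axioms]
      by (simp add: bounded_clinear_def cinner_scaleC_left scaleC_complex_def)
    then show ?thesis using riesz_representation by metis
  qed
  then have "\<exists>B. \<forall>x y. cinner (A x) y = cinner x (B y)" by metis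
  then have "\<forall>x y. cinner (A x) y = cinner x (cadjoint A y)"
    unfolding cadjoint_def by (rule someI_ex)
  then show ?thesis by metis
qed

lemma cinner_cadjoint_left:
  fixes A :: "'a::chilbert_space \<Rightarrow> 'b::complex_inner"
  assumes A: "bounded_clinear A"
  shows "cinner (cadjoint A y) x = cinner y (A x)"
  by (metis cinner_commute cinner_cadjoint_right[OF A])

lemma cinner_eqI: "(\<And>z. cinner z x = cinner z y) \<Longrightarrow> x = (y::'a::complex_inner)"
  by (metis cinner.diff_right cinner_self_eq_0 diff_self eq_iff_diff_eq_0)

text \<open>A bound K for A carries over by |A* x|^2 = <A A* x, x> \<le> K |A* x| |x|.\<close>

lemma bounded_clinear_cadjoint:
  fixes A :: "'a::chilbert_space \<Rightarrow> 'b::complex_inner"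
  assumes A: "bounded_clinear A"
  shows "bounded_clinear (cadjoint A)"
proof -
  interpret A: bounded_linear A using A by (simp add: bounded_clinear_def)
  note adj = cinner_cadjoint_right[OF A]
  have add: "cadjoint A (x + y) = cadjoint A x + cadjoint A y" for x y
    by (rule cinner_eqI) (simp add: adj cinner.add_right)
  have scale: "cadjoint A (c *\<^sub>C x) = c *\<^sub>C cadjoint A x" for c x
    by (rule cinner_eqI) (simp add: adj cinner_scaleC_right)
  obtain K where K: "\<And>x. norm (A x) \<le> norm x * K" "K > 0" using A.pos_bounded by blast
  have "norm (cadjoint A x) \<le> norm x * K" for x
  proof -
    have "(norm (cadjoint A x))\<^sup>2 = cmod (cinner (cadjoint A x) (cadjoint A x))"
      by (simp add: cinner_self norm_power)
    also have "\<dots> = cmod (cinner (A (cadjoint A x)) x)" by (simp add: adj)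
    also have "\<dots> \<le> norm (A (cadjoint A x)) * norm x" by (rule norm_cinner_le)
    also have "\<dots> \<le> norm (cadjoint A x) * K * norm x" by (intro mult_right_mono K) simp
    finally have "norm (cadjoint A x) * norm (cadjoint A x) \<le> norm (cadjoint A x) * (norm x * K)"
      by (simp add: power2_eq_square ac_simps)
    then show ?thesis using K(2) by (cases "cadjoint A x = 0") auto
  qed
  then have "bounded_linear (cadjoint A)"
    by (intro bounded_linear_intro[where K = K]) (simp_all add: add scale scaleC_of_real[symmetric] del: scaleC_of_real)
  then show ?thesis by (simp add: bounded_clinear_def scale)
qed

section \<open>Orthogonal series\<close>

lemma norm_sum_orthogonal:
  fixes y :: "'i \<Rightarrow> 'a::complex_inner"
  assumes "finite F" "\<And>a b. a \<in> F \<Longrightarrow> b \<in> F \<Longrightarrow> a \<noteq> b \<Longrightarrow> cinner (y a) (y b) = 0"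
  shows "(norm (sum y F))\<^sup>2 = (\<Sum>a\<in>F. (norm (y a))\<^sup>2)"
  using assms
proof (induction F rule: finite_induct)
  case (insert a F)
  have "cinner (y a) (sum y F) = 0"
    unfolding cinner.sum_right using insert by (intro sum.neutral) auto
  then show ?case using insert by (simp add: norm_add_orthogonal)
qed simp

text \<open>By Pythagoras the squared norm of a finite tail is the tail of the series of squares, so
  the net of finite sums is Cauchy.\<close>

lemma summable_on_orthogonal:
  fixes y :: "'i \<Rightarrow> 'a::chilbert_space"
  assumes orth: "\<And>a b. a \<in> A \<Longrightarrow> b \<in> A \<Longrightarrow> a \<noteq> b \<Longrightarrow> cinner (y a) (y b) = 0"
    and sum: "(\<lambda>a. (norm (y a))\<^sup>2) summable_on A"
  shows "y summable_on A"
proof -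
  let ?n = "\<lambda>a. (norm (y a))\<^sup>2"
  have "\<exists>P. eventually P (finite_subsets_at_top A) \<and>
      (\<forall>F F'. P F \<and> P F' \<longrightarrow> dist (sum y F) (sum y F') < e)" if e: "e > 0" for e
  proof -
    define S where "S = infsum ?n A"
    have "\<forall>\<^sub>F F in finite_subsets_at_top A. S - e\<^sup>2/4 < sum ?n F"
      using order_tendstoD(1)[OF has_sum_infsum[OF sum, unfolded has_sum_def], of "S - e\<^sup>2/4"] e
      by (simp add: S_def)
    then obtain F0 where F0: "finite F0" "F0 \<subseteq> A"
      "\<And>F. finite F \<Longrightarrow> F0 \<subseteq> F \<Longrightarrow> F \<subseteq> A \<Longrightarrow> S - e\<^sup>2/4 < sum ?n F"
      by (auto simp: eventually_finite_subsets_at_top)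
    \<comment> \<open>Beyond \<open>F0\<close> the remaining squares add up to less than e^2/4; two
      such sums then differ by less than e.\<close>
    have near: "norm (sum y F - sum y F0) < e / 2" if F: "finite F" "F0 \<subseteq> F" "F \<subseteq> A" for F
    proof -
      have "sum ?n F \<le> S"
        unfolding S_def using F by (intro finite_sum_le_infsum sum) auto
      then have "sum ?n (F - F0) < e\<^sup>2/4"
        using F0(3)[OF F0(1) order_refl F0(2)] F F0(1) by (simp add: sum_diff)
      moreover have "(norm (sum y (F - F0)))\<^sup>2 = sum ?n (F - F0)"
        using F by (intro norm_sum_orthogonal orth) auto
      ultimately have "(norm (sum y (F - F0)))\<^sup>2 < (e/2)\<^sup>2" by (simp add: power_divide)
      then have "norm (sum y (F - F0)) < e/2" by (rule power2_less_imp_less) (use e in simp)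
      then show ?thesis using F F0(1) by (simp add: sum_diff)
    qed
    define P where "P F \<longleftrightarrow> finite F \<and> F0 \<subseteq> F \<and> F \<subseteq> A" for F
    have "eventually P (finite_subsets_at_top A)"
      unfolding eventually_finite_subsets_at_top P_def using F0 by blast
    moreover have "dist (sum y F) (sum y F') < e" if "P F" "P F'" for F F'
      using near[of F] near[of F'] that dist_triangle_half_r[of "sum y F0" "sum y F" e "sum y F'"]
      by (simp add: P_def dist_norm norm_minus_commute)
    ultimately show ?thesis by blast
  qed
  then have "cauchy_filter (filtermap (sum y) (finite_subsets_at_top A))"
    by (simp add: cauchy_filter_metric_filtermap)
  moreover have "complete (UNIV::'a set)" by (rule complete_UNIV)
  ultimately obtain L where "(sum y \<longlongrightarrow> L) (finite_subsets_at_top A)"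
    using complete_uniform[where S = "UNIV :: 'a set"]
    by (force simp: filterlim_def)
  then show ?thesis unfolding summable_on_def has_sum_def by blast
qed

lemma has_sum_mem_closed_csubspace:
  assumes "(y has_sum s) A" "closed_csubspace M" "\<And>a. a \<in> A \<Longrightarrow> y a \<in> M"
  shows "s \<in> M"
proof (rule Lim_in_closed_set)
  show "closed M" using assms(2) by (rule closed_csubspaceD)
  show "(sum y \<longlongrightarrow> s) (finite_subsets_at_top A)" using assms(1) by (simp add: has_sum_def)
  show "\<forall>\<^sub>F F in finite_subsets_at_top A. sum y F \<in> M"
    by (rule eventually_finite_subsets_at_top_weakI)
       (use assms in \<open>auto intro!: complex_vector.subspace_sum simp: closed_csubspace_def\<close>)
qed (simp)

section \<open>Orthogonal families of closed subspaces\<close>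

lemma has_sum_singleton_support:
  fixes y :: "'i \<Rightarrow> 'b::{topological_comm_monoid_add, t2_space}"
  assumes "(y has_sum s) A" "b \<in> A" "\<And>a. a \<in> A \<Longrightarrow> a \<noteq> b \<Longrightarrow> y a = 0"
  shows "s = y b"
proof -
  have "(y has_sum y b) {b}" by (rule has_sum_finiteI) auto
  moreover have "(y has_sum y b) {b} \<longleftrightarrow> (y has_sum y b) A"
    by (rule has_sum_cong_neutral) (use assms(2,3) in auto)
  ultimately show ?thesis using has_sum_unique[OF assms(1)] by blast
qed

locale orthogonal_family =
  fixes A :: "'i set" and E :: "'i \<Rightarrow> 'a::chilbert_space set"
  assumes closed_csubspace: "a \<in> A \<Longrightarrow> closed_csubspace (E a)"
    and orthogonal: "a \<in> A \<Longrightarrow> b \<in> A \<Longrightarrow> a \<noteq> b \<Longrightarrow> x \<in> E a \<Longrightarrow> y \<in> E b \<Longrightarrow> cinner x y = 0"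
begin

text \<open>The projection onto \<open>E b\<close> is continuous, so it acts termwise, and
  orthogonality leaves only the term at \<open>b\<close>.\<close>

lemma proj_onto_has_sum:
  assumes "(y has_sum s) A" "\<And>a. a \<in> A \<Longrightarrow> y a \<in> E a" "b \<in> A"
  shows "proj_onto (E b) s = y b"
proof -
  note Eb = closed_csubspace[OF assms(3)]
  have "((\<lambda>a. proj_onto (E b) (y a)) has_sum proj_onto (E b) s) A"
    by (rule has_sum_bounded_linear[OF _ assms(1)])
       (use bounded_clinear_proj_onto[OF Eb] in \<open>simp add: bounded_clinear_def\<close>)
  then have "proj_onto (E b) s = proj_onto (E b) (y b)"
    by (rule has_sum_singleton_support)
       (use assms orthogonal in \<open>auto intro!: proj_onto_eq_0[OF Eb]\<close>)
  then show ?thesis using assms proj_onto_self[OF Eb] by simp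
qed

text \<open>Bessel's inequality: for a finite sum \<open>s\<close> of components of \<open>x\<close>
  the remainder \<open>x - s\<close> is orthogonal to \<open>s\<close>, so the squares add up to at
  most |x|^2.\<close>

lemma summable_norm_proj_onto: "(\<lambda>a. (norm (proj_onto (E a) x))\<^sup>2) summable_on A"
proof (rule nonneg_bdd_above_summable_on)
  show "bdd_above (sum (\<lambda>a. (norm (proj_onto (E a) x))\<^sup>2) ` {F. F \<subseteq> A \<and> finite F})"
  proof (rule bdd_aboveI2)
    fix F assume "F \<in> {F. F \<subseteq> A \<and> finite F}"
    then have F: "F \<subseteq> A" "finite F" by auto
    define s where "s = (\<Sum>a\<in>F. proj_onto (E a) x)"
    have orth: "cinner (proj_onto (E a) x) (proj_onto (E b) x) = 0"
      if "a \<in> F" "b \<in> F" "a \<noteq> b" for a b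
      using that F orthogonal[of a b] proj_onto_mem[OF closed_csubspace] by blast
    have "cinner s (proj_onto (E b) x) = cinner x (proj_onto (E b) x)" if b: "b \<in> F" for b
    proof -
      have bA: "b \<in> A" using b F by blast
      have "cinner s (proj_onto (E b) x) = (\<Sum>a\<in>F. if a = b then cinner (proj_onto (E b) x) (proj_onto (E b) x) else 0)"
        unfolding s_def cinner.sum_left using orth b by (intro sum.cong) auto
      also have "\<dots> = cinner (proj_onto (E b) x) (proj_onto (E b) x)" using F b by simp
      also have "\<dots> = cinner x (proj_onto (E b) x)"
        using cinner_proj_onto_left[OF closed_csubspace[OF bA]] proj_onto_mem[OF closed_csubspace[OF bA]] by blast
      finally show ?thesis .
    qed
    then have "cinner (x - s) (proj_onto (E b) x) = 0" if "b \<in> F" for b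
      using that by (simp add: cinner.diff_left)
    then have "cinner (x - s) s = 0" by (simp add: s_def cinner.sum_right)
    from norm_add_orthogonal[OF this] have "(norm s)\<^sup>2 \<le> (norm x)\<^sup>2" by simp
    moreover have "(norm s)\<^sup>2 = (\<Sum>a\<in>F. (norm (proj_onto (E a) x))\<^sup>2)"
      unfolding s_def by (rule norm_sum_orthogonal) (use F orth in auto)
    ultimately show "(\<Sum>a\<in>F. (norm (proj_onto (E a) x))\<^sup>2) \<le> (norm x)\<^sup>2" by simp
  qed
qed simp

lemma has_sum_mem_closed_span:
  assumes "(y has_sum s) A" "\<And>a. a \<in> A \<Longrightarrow> y a \<in> E a"
  shows "s \<in> closed_span (\<Union>a\<in>A. E a)"
  by (rule has_sum_mem_closed_csubspace[OF assms(1) closed_csubspace_closed_span])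
     (use assms(2) closed_span_superset in blast)

lemma orthogonal_members_eq_0:
  assumes "x \<in> closed_span (\<Union>a\<in>A. E a)" "\<And>a y. a \<in> A \<Longrightarrow> y \<in> E a \<Longrightarrow> cinner x y = 0"
  shows "x = 0"
proof -
  have "cinner x x = 0"
    by (rule orthogonal_closed_span[of "{x}" "\<Union>a\<in>A. E a"])
       (use assms closed_span_superset in auto)
  then show ?thesis by simp
qed

text \<open>Bessel's inequality makes the components summable to some \<open>s\<close>. The vectors
  \<open>x\<close> and \<open>s\<close> have the same components, so \<open>x - s\<close> is
  orthogonal to every \<open>E a\<close> and lies in their closed span.\<close>

lemma has_sum_proj_onto:
  assumes x: "x \<in> closed_span (\<Union>a\<in>A. E a)"
  shows "((\<lambda>a. proj_onto (E a) x) has_sum x) A"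
proof -
  have mem: "proj_onto (E a) x \<in> E a" if "a \<in> A" for a
    by (rule proj_onto_mem[OF closed_csubspace[OF that]])
  have "(\<lambda>a. proj_onto (E a) x) summable_on A"
    by (rule summable_on_orthogonal[OF _ summable_norm_proj_onto]) (use mem orthogonal in blast)
  then obtain s where s: "((\<lambda>a. proj_onto (E a) x) has_sum s) A"
    by (auto simp: summable_on_def)
  have "s \<in> closed_span (\<Union>a\<in>A. E a)" by (rule has_sum_mem_closed_span[OF s mem])
  then have "x - s \<in> closed_span (\<Union>a\<in>A. E a)"
    using x closed_csubspaceD(6)[OF closed_csubspace_closed_span] by blast
  moreover have "cinner (x - s) y = 0" if a: "a \<in> A" and y: "y \<in> E a" for a y
  proof -
    have "cinner x y = cinner (proj_onto (E a) x) y"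
      using cinner_proj_onto_left[OF closed_csubspace[OF a] y] by simp
    also have "\<dots> = cinner (proj_onto (E a) s) y"
      using proj_onto_has_sum[OF s mem a] by simp
    also have "\<dots> = cinner s y"
      using cinner_proj_onto_left[OF closed_csubspace[OF a] y] by simp
    finally show ?thesis by (simp add: cinner.diff_left)
  qed
  ultimately have "x - s = 0" by (rule orthogonal_members_eq_0)
  with s show ?thesis by simp
qed

text \<open>Parseval's identity: the expansion of \<open>x\<close> is paired with \<open>y\<close>,
  and the term in \<open>E a\<close> sees only the component of \<open>y\<close> there.\<close>

lemma has_sum_cinner_proj_onto:
  assumes "x \<in> closed_span (\<Union>a\<in>A. E a)"
  shows "((\<lambda>a. cinner (proj_onto (E a) x) (proj_onto (E a) y)) has_sum cinner x y) A"
proof -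
  have "((\<lambda>a. cinner (proj_onto (E a) x) y) has_sum cinner x y) A"
    by (rule has_sum_bounded_linear[OF cinner.bounded_linear_left has_sum_proj_onto[OF assms]])
  moreover have "cinner (proj_onto (E a) x) y = cinner (proj_onto (E a) x) (proj_onto (E a) y)"
    if "a \<in> A" for a
  proof -
    note Ea = closed_csubspace[OF that]
    have "cinner (proj_onto (E a) x) y = cnj (cinner y (proj_onto (E a) x))" by (rule cinner_commute)
    also have "\<dots> = cnj (cinner (proj_onto (E a) y) (proj_onto (E a) x))"
      by (simp only: cinner_proj_onto_left[OF Ea proj_onto_mem[OF Ea]])
    also have "\<dots> = cinner (proj_onto (E a) x) (proj_onto (E a) y)" by (rule cinner_commute[symmetric])
    finally show ?thesis .
  qed
  ultimately show ?thesis by (simp cong: has_sum_cong)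
qed

end

section \<open>Unitaries between subspaces and their orthogonal direct sums\<close>

definition unitary_onto :: "('a::complex_inner \<Rightarrow> 'b::complex_inner) \<Rightarrow> 'a set \<Rightarrow> 'b set \<Rightarrow> bool" where
  "unitary_onto W M N \<longleftrightarrow> W ` M = N \<and> (\<forall>x\<in>M. \<forall>y\<in>M. W (x + y) = W x + W y)
     \<and> (\<forall>c. \<forall>x\<in>M. W (c *\<^sub>C x) = c *\<^sub>C W x) \<and> (\<forall>x\<in>M. \<forall>y\<in>M. cinner (W x) (W y) = cinner x y)"

lemma unitary_ontoD:
  assumes "unitary_onto W M N"
  shows "x \<in> M \<Longrightarrow> W x \<in> N" "z \<in> N \<Longrightarrow> \<exists>x\<in>M. W x = z"
    "x \<in> M \<Longrightarrow> y \<in> M \<Longrightarrow> W (x + y) = W x + W y" "x \<in> M \<Longrightarrow> W (c *\<^sub>C x) = c *\<^sub>C W x"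
    "x \<in> M \<Longrightarrow> y \<in> M \<Longrightarrow> cinner (W x) (W y) = cinner x y"
    "x \<in> M \<Longrightarrow> norm (W x) = norm x"
proof -
  show *: "x \<in> M \<Longrightarrow> W x \<in> N" "z \<in> N \<Longrightarrow> \<exists>x\<in>M. W x = z"
    "x \<in> M \<Longrightarrow> y \<in> M \<Longrightarrow> W (x + y) = W x + W y" "x \<in> M \<Longrightarrow> W (c *\<^sub>C x) = c *\<^sub>C W x"
    "x \<in> M \<Longrightarrow> y \<in> M \<Longrightarrow> cinner (W x) (W y) = cinner x y" for x y z c
    using assms unfolding unitary_onto_def by blast+
  assume "x \<in> M"
  then have "cinner (W x) (W x) = cinner x x" using * by blast
  then have "(norm (W x))\<^sup>2 = (norm x)\<^sup>2" unfolding cinner_self of_real_eq_iff .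
  then show "norm (W x) = norm x" by simp
qed

text \<open>The summands are applied after projection, so the operator is given on the whole space
  and ignores whatever is orthogonal to all \<open>E a\<close>.\<close>

definition direct_sum_op :: "'i set \<Rightarrow> ('i \<Rightarrow> 'a::chilbert_space set) \<Rightarrow> ('i \<Rightarrow> 'a \<Rightarrow> 'b::chilbert_space) \<Rightarrow> 'a \<Rightarrow> 'b" where
  "direct_sum_op A E k x = (\<Sum>\<^sub>\<infinity>a\<in>A. k a (proj_onto (E a) x))"

text \<open>Each \<open>k a\<close> preserves norms, so Bessel's inequality for the
  \<open>E a\<close> yields convergence of the image series. The component of the image in
  \<open>F a\<close> is \<open>k a\<close> of the component in \<open>E a\<close>; Parseval on both
  sides then gives preservation of inner products.\<close>

lemma
  fixes E :: "'i \<Rightarrow> 'a::chilbert_space set" and F :: "'i \<Rightarrow> 'b::chilbert_space set"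
  assumes E: "orthogonal_family A E" and F: "orthogonal_family A F"
    and k: "\<And>a. a \<in> A \<Longrightarrow> unitary_onto (k a) (E a) (F a)"
  shows has_sum_direct_sum_op: "((\<lambda>a. k a (proj_onto (E a) x)) has_sum direct_sum_op A E k x) A"
    and unitary_onto_direct_sum_op:
      "unitary_onto (direct_sum_op A E k) (closed_span (\<Union>a\<in>A. E a)) (closed_span (\<Union>a\<in>A. F a))"
proof -
  interpret E: orthogonal_family A E by fact
  interpret F: orthogonal_family A F by fact
  let ?M = "closed_span (\<Union>a\<in>A. E a)" and ?N = "closed_span (\<Union>a\<in>A. F a)"
  let ?P = "\<lambda>a. proj_onto (E a)" and ?J = "direct_sum_op A E k"
  have P: "?P a x \<in> E a" if "a \<in> A" for a x
    by (rule proj_onto_mem[OF E.closed_csubspace[OF that]])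
  have kP: "k a (?P a x) \<in> F a" if "a \<in> A" for a x
    using unitary_ontoD(1)[OF k[OF that]] P[OF that] by blast
  have J: "((\<lambda>a. k a (?P a x)) has_sum ?J x) A" for x
  proof -
    have "(\<lambda>a. (norm (k a (?P a x)))\<^sup>2) summable_on A"
      using E.summable_norm_proj_onto[of x] unitary_ontoD(6)[OF k P] by (simp cong: summable_on_cong)
    then have "(\<lambda>a. k a (?P a x)) summable_on A"
      by (rule summable_on_orthogonal[rotated]) (use kP F.orthogonal in blast)
    then show ?thesis unfolding direct_sum_op_def by (rule has_sum_infsum)
  qed
  then show "((\<lambda>a. k a (?P a x)) has_sum ?J x) A" .
  have J_eqI: "?J x = s" if "((\<lambda>a. k a (?P a x)) has_sum s) A" for x s
    using has_sum_unique[OF J that] .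
  have PJ: "proj_onto (F a) (?J x) = k a (?P a x)" if "a \<in> A" for a x
    by (rule F.proj_onto_has_sum[OF J kP that])
  have JN: "?J x \<in> ?N" for x by (rule F.has_sum_mem_closed_span[OF J kP])
  show "unitary_onto ?J ?M ?N"
    unfolding unitary_onto_def
  proof (intro conjI ballI allI set_eqI iffI)
    fix y assume y: "y \<in> ?N"
    \<comment> \<open>Preimages of the components of \<open>y\<close>. They have the same norms as
      these components, so they are summable, and their sum is a preimage of
      \<open>y\<close>.\<close>
    define h where "h a = (SOME x. x \<in> E a \<and> k a x = proj_onto (F a) y)" for a
    have h: "h a \<in> E a" "k a (h a) = proj_onto (F a) y" if "a \<in> A" for a
    proof -
      have "\<exists>x. x \<in> E a \<and> k a x = proj_onto (F a) y"
        using unitary_ontoD(2)[OF k[OF that] proj_onto_mem[OF F.closed_csubspace[OF that]]] by blast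
      from someI_ex[OF this] show "h a \<in> E a" "k a (h a) = proj_onto (F a) y"
        unfolding h_def by auto
    qed
    have nh: "norm (h a) = norm (proj_onto (F a) y)" if "a \<in> A" for a
      using unitary_ontoD(6)[OF k[OF that] h(1)[OF that]] h(2)[OF that] by simp
    have "(\<lambda>a. (norm (h a))\<^sup>2) summable_on A"
      using F.summable_norm_proj_onto[of y] nh by (simp cong: summable_on_cong)
    then have "h summable_on A"
      by (rule summable_on_orthogonal[rotated]) (use h E.orthogonal in blast)
    then obtain x where x: "(h has_sum x) A" by (auto simp: summable_on_def)
    have "x \<in> ?M" by (rule E.has_sum_mem_closed_span[OF x h(1)])
    moreover have "?J x = y"
    proof (rule J_eqI)
      have "k a (?P a x) = proj_onto (F a) y" if "a \<in> A" for a
        using E.proj_onto_has_sum[OF x h(1) that] h(2)[OF that] by simp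
      then show "((\<lambda>a. k a (?P a x)) has_sum y) A"
        using F.has_sum_proj_onto[OF y] by (simp cong: has_sum_cong)
    qed
    ultimately show "y \<in> ?J ` ?M" by blast
  next
    fix x y assume "x \<in> ?M" "y \<in> ?M"
    have "((\<lambda>a. k a (?P a x) + k a (?P a y)) has_sum (?J x + ?J y)) A"
      by (intro has_sum_add J)
    moreover have "k a (?P a (x + y)) = k a (?P a x) + k a (?P a y)" if "a \<in> A" for a
      using unitary_ontoD(3)[OF k[OF that] P[OF that] P[OF that]]
      by (simp add: proj_onto_add[OF E.closed_csubspace[OF that]])
    ultimately show "?J (x + y) = ?J x + ?J y" by (intro J_eqI) (simp cong: has_sum_cong)
  next
    fix c x assume "x \<in> ?M"
    have "((\<lambda>a. c *\<^sub>C k a (?P a x)) has_sum (c *\<^sub>C ?J x)) A"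
      by (rule has_sum_bounded_linear[OF scaleC.bounded_linear_right J])
    moreover have "k a (?P a (c *\<^sub>C x)) = c *\<^sub>C k a (?P a x)" if "a \<in> A" for a
      using unitary_ontoD(4)[OF k[OF that] P[OF that]]
      by (simp add: proj_onto_scaleC[OF E.closed_csubspace[OF that]])
    ultimately show "?J (c *\<^sub>C x) = c *\<^sub>C ?J x" by (intro J_eqI) (simp cong: has_sum_cong)
  next
    fix x y assume x: "x \<in> ?M" and y: "y \<in> ?M"
    have "((\<lambda>a. cinner (proj_onto (F a) (?J x)) (proj_onto (F a) (?J y))) has_sum cinner (?J x) (?J y)) A"
      by (rule F.has_sum_cinner_proj_onto[OF JN])
    moreover have "cinner (proj_onto (F a) (?J x)) (proj_onto (F a) (?J y)) = cinner (?P a x) (?P a y)"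
      if "a \<in> A" for a
      using unitary_ontoD(5)[OF k[OF that] P[OF that] P[OF that]] by (simp add: PJ[OF that])
    ultimately have "((\<lambda>a. cinner (?P a x) (?P a y)) has_sum cinner (?J x) (?J y)) A"
      by (simp cong: has_sum_cong)
    then show "cinner (?J x) (?J y) = cinner x y"
      using E.has_sum_cinner_proj_onto[OF x, of y] has_sum_unique by blast
  qed (use JN in auto)
qed

section \<open>Orthonormal bases of finite-dimensional subspaces\<close>

definition orthonormal :: "'a::complex_inner set \<Rightarrow> bool" where
  "orthonormal B \<longleftrightarrow> (\<forall>x\<in>B. \<forall>y\<in>B. cinner x y = (if x = y then 1 else 0))"

lemma orthonormal_independent:
  assumes "orthonormal (B :: 'a::complex_inner set)"
  shows "complex_vector.independent B"
  unfolding complex_vector.independent_explicit_module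
proof (intro allI impI)
  fix F and u :: "'a \<Rightarrow> complex" and v
  assume F: "finite F" "F \<subseteq> B" "(\<Sum>v\<in>F. u v *\<^sub>C v) = 0" "v \<in> F"
  have "0 = cinner (\<Sum>v\<in>F. u v *\<^sub>C v) v" using F by simp
  also have "\<dots> = (\<Sum>w\<in>F. if w = v then u v else 0)"
    unfolding cinner.sum_left using F assms
    by (intro sum.cong) (auto simp: cinner_scaleC_left orthonormal_def subset_iff)
  also have "\<dots> = u v" using F by simp
  finally show "u v = 0" by simp
qed

text \<open>The bound \<open>n\<close> guarantees an orthonormal set of maximal size. If it did not
  span, a vector minus its expansion could be normalised and adjoined.\<close>

lemma orthonormal_basis_exists:
  fixes E :: "'a::complex_inner set"
  assumes E: "complex_vector.subspace E"
    and bound: "\<And>B. finite B \<Longrightarrow> B \<subseteq> E \<Longrightarrow> orthonormal B \<Longrightarrow> card B \<le> n"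
  obtains B where "finite B" "orthonormal B" "complex_vector.span B = E"
proof -
  define Q where "Q B \<longleftrightarrow> finite B \<and> B \<subseteq> E \<and> orthonormal B" for B
  have "Q {}" by (simp add: Q_def orthonormal_def)
  moreover have "\<forall>B. Q B \<longrightarrow> card B < Suc n" using bound by (simp add: Q_def less_Suc_eq_le)
  ultimately obtain B where B: "Q B" and max: "\<And>B'. Q B' \<Longrightarrow> card B' \<le> card B"
    by (metis Lattices_Big.ex_has_greatest_nat)
  have Bf: "finite B" "B \<subseteq> E" "orthonormal B" using B by (auto simp: Q_def)
  have "x \<in> complex_vector.span B" if x: "x \<in> E" for x
  proof -
    define s where "s = (\<Sum>b\<in>B. cinner x b *\<^sub>C b)"
    have sB: "s \<in> complex_vector.span B"
      unfolding s_def by (intro complex_vector.span_sum complex_vector.span_scale complex_vector.span_base)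
    have "s \<in> E" using sB complex_vector.span_minimal[OF Bf(2) E] by blast
    then have dE: "x - s \<in> E" using x E complex_vector.subspace_diff by blast
    have orth: "cinner (x - s) b = 0" if b: "b \<in> B" for b
    proof -
      have "cinner s b = (\<Sum>b'\<in>B. if b' = b then cinner x b else 0)"
        unfolding s_def cinner.sum_left using Bf b
        by (intro sum.cong) (auto simp: cinner_scaleC_left orthonormal_def)
      then show ?thesis using Bf b by (simp add: cinner.diff_left)
    qed
    have "x - s = 0"
    proof (rule ccontr)
      assume ne: "x - s \<noteq> 0"
      define u where "u = complex_of_real (1 / norm (x - s)) *\<^sub>C (x - s)"
      have uu: "cinner u u = 1"
        using ne by (simp add: cinner_self u_def norm_scaleC norm_divide)
      have ub: "cinner u b = 0" "cinner b u = 0" if "b \<in> B" for b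
        using orth[OF that] by (auto simp: u_def cinner_scaleC_left cinner_eq_0_commute[of b])
      have "u \<notin> B" using ub uu by fastforce
      moreover have "Q (insert u B)"
        using Bf uu ub dE E unfolding Q_def u_def
        by (auto simp: orthonormal_def complex_vector.subspace_scale)
      ultimately show False using max[of "insert u B"] Bf by simp
    qed
    then show ?thesis using sB by simp
  qed
  then have "complex_vector.span B = E"
    using complex_vector.span_minimal[OF Bf(2) E] by blast
  with Bf that show thesis by blast
qed

text \<open>Coordinates with respect to the basis, enumerated by \<open>{..<n}\<close>; since
  orthonormal sets are independent, \<open>n\<close> is the dimension.\<close>

lemma unitary_onto_cvec:
  fixes E :: "'a::complex_inner set"
  assumes B: "finite B" "orthonormal B" "complex_vector.span B = E"
  obtains W where "unitary_onto W E (cvec (complex_vector.dim E))"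
proof -
  define n where "n = card B"
  have dim: "complex_vector.dim E = n"
    unfolding n_def using complex_vector.dim_span_eq_card_independent[OF orthonormal_independent[OF B(2)]] B(3) by simp
  obtain f where f: "bij_betw f {..<n} B"
    using ex_bij_betw_nat_finite[OF B(1)] by (auto simp: n_def atLeast0LessThan)
  have ff: "cinner (f i) (f j) = (if i = j then 1 else 0)" if "i < n" "j < n" for i j
    using B(2) f that unfolding orthonormal_def bij_betw_def by (auto simp: inj_on_def)
  \<comment> \<open>The cut-off at \<open>n\<close> keeps the support finite, as
    \<open>Abs_poly_mapping\<close> requires.\<close>
  define W where "W x = Abs_poly_mapping (\<lambda>i. if i < n then cinner x (f i) else 0)" for x
  have lookup_W: "Poly_Mapping.lookup (W x) i = (if i < n then cinner x (f i) else 0)" for x i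
    unfolding W_def by (subst Abs_poly_mapping_inverse) (auto intro: finite_subset[of _ "{..<n}"])
  have keys_W: "Poly_Mapping.keys (W x) \<subseteq> {..<n}" for x
    by (auto simp: in_keys_iff lookup_W split: if_splits)
  have fE: "f i \<in> E" if "i < n" for i
    using that f B(3) complex_vector.span_base[of "f i" B] by (auto simp: bij_betw_def)
  have expand: "x = (\<Sum>i<n. cinner x (f i) *\<^sub>C f i)" if "x \<in> E" for x
  proof -
    obtain u where u: "x = (\<Sum>v\<in>B. u v *\<^sub>C v)"
      using \<open>x \<in> E\<close> complex_vector.span_finite[OF B(1)] B(3) by auto
    have x: "x = (\<Sum>i<n. u (f i) *\<^sub>C f i)"
      unfolding u by (rule sum.reindex_bij_betw[OF f, symmetric])
    have "cinner x (f j) = u (f j)" if j: "j < n" for j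
    proof -
      have "cinner x (f j) = (\<Sum>i<n. if i = j then u (f j) else 0)"
        unfolding x cinner.sum_left using j by (intro sum.cong) (auto simp: cinner_scaleC_left ff)
      then show ?thesis using j by simp
    qed
    with x show ?thesis by simp
  qed
  have "unitary_onto W E (cvec n)"
    unfolding unitary_onto_def
  proof (intro conjI ballI allI set_eqI iffI)
    fix v assume "v \<in> W ` E"
    then show "v \<in> cvec n" using keys_W by (auto simp: cvec_def)
  next
    fix v assume v: "v \<in> cvec n"
    define x where "x = (\<Sum>i<n. Poly_Mapping.lookup v i *\<^sub>C f i)"
    have "x \<in> E"
      unfolding x_def B(3)[symmetric]
      using fE by (intro complex_vector.span_sum complex_vector.span_scale) (simp add: B(3))
    moreover have "W x = v"
    proof (rule poly_mapping_eqI)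
      fix j
      show "Poly_Mapping.lookup (W x) j = Poly_Mapping.lookup v j"
      proof (cases "j < n")
        case True
        have "cinner x (f j) = (\<Sum>i<n. if i = j then Poly_Mapping.lookup v j else 0)"
          unfolding x_def cinner.sum_left using True
          by (intro sum.cong) (auto simp: cinner_scaleC_left ff)
        then show ?thesis using True by (simp add: lookup_W)
      next
        case False
        then have "j \<notin> Poly_Mapping.keys v" using v by (auto simp: cvec_def)
        then show ?thesis using False by (simp add: lookup_W in_keys_iff)
      qed
    qed
    ultimately show "v \<in> W ` E" by blast
  next
    fix x y
    show "W (x + y) = W x + W y"
      by (rule poly_mapping_eqI) (simp add: lookup_W lookup_add cinner.add_left)
  next
    fix c x
    show "W (c *\<^sub>C x) = c *\<^sub>C W x"
      by (rule poly_mapping_eqI) (simp add: lookup_W scaleC_poly_mapping.rep_eq cinner_scaleC_left scaleC_complex_def)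
  next
    fix x y assume x: "x \<in> E" and "y \<in> E"
    have "cinner (W x) (W y) = (\<Sum>i<n. cinner (Poly_Mapping.lookup (W x) i) (Poly_Mapping.lookup (W y) i))"
      unfolding cinner_poly_mapping_def using keys_W
      by (intro sum.mono_neutral_left) (auto simp: in_keys_iff)
    also have "\<dots> = (\<Sum>i<n. cinner x (f i) * cinner (f i) y)"
      using cinner_commute[of _ y] by (intro sum.cong) (auto simp: lookup_W cinner_complex_def)
    also have "\<dots> = cinner (\<Sum>i<n. cinner x (f i) *\<^sub>C f i) y"
      by (simp add: cinner.sum_left cinner_scaleC_left)
    also have "\<dots> = cinner x y" using expand[OF x] by simp
    finally show "cinner (W x) (W y) = cinner x y" .
  qed
  then show thesis using that dim by blast
qed

section \<open>Compact self-adjoint operators\<close>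

lemma closed_csubspace_eigenspace:
  assumes T: "bounded_clinear T"
  shows "closed_csubspace (eigenspace T a)"
proof -
  interpret T: bounded_linear T using T by (simp add: bounded_clinear_def)
  have "bounded_linear (\<lambda>x. T x - complex_of_real a *\<^sub>C x)"
    by (intro bounded_linear_sub T.bounded_linear_axioms scaleC.bounded_linear_right)
  moreover have "T (c *\<^sub>C x) - complex_of_real a *\<^sub>C c *\<^sub>C x = c *\<^sub>C (T x - complex_of_real a *\<^sub>C x)" for c x
    using T by (simp add: bounded_clinear_def scaleC.diff_right scaleC_scaleC mult.commute)
  ultimately have "bounded_clinear (\<lambda>x. T x - complex_of_real a *\<^sub>C x)"
    by (simp add: bounded_clinear_def)
  from closed_csubspace_kernel[OF this] show ?thesis by (simp add: eigenspace_def)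
qed

lemma closed_csubspace_vimage:
  assumes T: "bounded_clinear T" and M: "closed_csubspace M"
  shows "closed_csubspace (T -` M)"
proof -
  interpret T: bounded_linear T using T by (simp add: bounded_clinear_def)
  have "closed (T -` M)"
    by (simp add: continuous_closed_vimage closed_csubspaceD(1)[OF M] T.isCont)
  then show ?thesis using T closed_csubspaceD[OF M]
    by (auto simp: closed_csubspace_def complex_vector.subspace_def T.add T.zero bounded_clinear_def)
qed

lemma closed_span_closed_csubspace: "closed_csubspace M \<Longrightarrow> closed_span M = M"
  using closed_span_minimal[of M M] closed_span_superset[of M] by auto

locale compact_selfadjoint =
  fixes T :: "'a::chilbert_space \<Rightarrow> 'a"
  assumes compact: "compact_op T" and selfadj: "cinner (T x) y = cinner x (T y)"
begin

lemma bounded_clinear: "bounded_clinear T"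
  using compact by (simp add: compact_op_def)

lemma scaleC: "T (c *\<^sub>C x) = c *\<^sub>C T x"
  using bounded_clinear by (simp add: bounded_clinear_def)

sublocale bounded_linear T
  using bounded_clinear by (simp add: bounded_clinear_def)

lemma convergent_subsequence:
  assumes "\<And>n. norm (x n) \<le> 1"
  obtains l r where "strict_mono (r :: nat \<Rightarrow> nat)" "(\<lambda>n. T (x (r n))) \<longlonglongrightarrow> l"
proof -
  have "seq_compact (closure (T ` cball 0 1))"
    using compact compact_imp_seq_compact unfolding compact_op_def by blast
  moreover have "\<forall>n. (\<lambda>n. T (x n)) n \<in> closure (T ` cball 0 1)"
    using assms by (intro allI subsetD[OF closure_subset] imageI) simp
  ultimately show thesis
    using that by (auto elim!: seq_compactE simp: o_def)
qed

lemma eigenspaceD: "x \<in> eigenspace T a \<Longrightarrow> T x = complex_of_real a *\<^sub>C x"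
  by (simp add: eigenspace_def)

lemma orthogonal_family_eigenspace: "orthogonal_family X (eigenspace T)"
proof
  show "closed_csubspace (eigenspace T a)" for a
    by (rule closed_csubspace_eigenspace[OF bounded_clinear])
  fix a b x y assume ab: "a \<noteq> b" and x: "x \<in> eigenspace T a" and y: "y \<in> eigenspace T b"
  have "complex_of_real a * cinner x y = cinner (T x) y"
    by (simp add: eigenspaceD[OF x] cinner_scaleC_left)
  also have "\<dots> = complex_of_real b * cinner x y"
    unfolding selfadj by (simp add: eigenspaceD[OF y] cinner_scaleC_right)
  finally show "cinner x y = 0" using ab by simp
qed

text \<open>If \<open>T\<close> did not vanish on \<open>N\<close>, the norm \<open>m\<close> of its
  restriction would be positive. Compactness extracts from a norming sequence a limit
  \<open>l\<close> of norm \<open>m\<close> with T^2 l = m^2 l, which forces an eigenvector for m or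
  -m inside \<open>N\<close>.\<close>

lemma eq_0_if_no_eigenvector:
  assumes N: "closed_csubspace N" and inv: "\<And>x. x \<in> N \<Longrightarrow> T x \<in> N"
    and none: "\<And>a x. a \<noteq> 0 \<Longrightarrow> x \<in> N \<Longrightarrow> x \<in> eigenspace T a \<Longrightarrow> x = 0"
    and x: "x \<in> N"
  shows "T x = 0"
proof (rule ccontr)
  assume Tx: "T x \<noteq> 0"
  note ND = closed_csubspaceD[OF N]
  define S where "S = (\<lambda>x. norm (T x)) ` (N \<inter> cball 0 1)"
  define m where "m = Sup S"
  obtain B where B: "\<And>x. norm (T x) \<le> norm x * B" "B > 0" using pos_bounded by blast
  have bdd: "bdd_above S"
  proof (rule bdd_aboveI)
    fix s assume "s \<in> S"
    then obtain y where y: "s = norm (T y)" "norm y \<le> 1" by (auto simp: S_def)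
    have "norm y * B \<le> 1 * B" using y B by (intro mult_right_mono) auto
    then show "s \<le> B" using B(1)[of y] y by simp
  qed
  have le: "norm (T y) \<le> m * norm y" if "y \<in> N" for y
  proof (cases "y = 0")
    case False
    have "norm (T ((1 / norm y) *\<^sub>R y)) \<in> S"
      unfolding S_def using that False by (intro imageI) (auto intro: ND)
    then have "norm (T ((1 / norm y) *\<^sub>R y)) \<le> m" unfolding m_def by (rule cSup_upper[OF _ bdd])
    then show ?thesis using False by (simp add: scaleR field_simps)
  qed (simp add: zero)
  have m0: "m > 0"
  proof (rule ccontr)
    assume "\<not> m > 0"
    then have "m * norm x \<le> 0" by (simp add: mult_nonpos_nonneg)
    then show False using le[OF x] Tx by (metis norm_le_zero_iff order_trans)
  qed
  have "\<exists>y. y \<in> N \<and> norm y \<le> 1 \<and> m - 1 / real (Suc n) < norm (T y)" for n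
  proof -
    have "S \<noteq> {}" using ND(2) by (auto simp: S_def)
    then have "\<exists>s\<in>S. m - 1 / real (Suc n) < s"
      using less_cSupD[of S "m - 1 / real (Suc n)"] by (auto simp: m_def)
    then show ?thesis by (auto simp: S_def)
  qed
  then obtain y where y: "\<And>n. y n \<in> N" "\<And>n. norm (y n) \<le> 1"
    "\<And>n. m - 1 / real (Suc n) < norm (T (y n))" by metis
  have Tm: "norm (T (y n)) \<le> m" for n
    using order_trans[OF le[OF y(1)[of n]] mult_left_mono[OF y(2)[of n], of m]] m0 by simp
  have lim: "(\<lambda>n. norm (T (y n))) \<longlonglongrightarrow> m"
  proof (rule tendsto_sandwich[OF _ _ _ tendsto_const])
    have "(\<lambda>n. m - 1 / real (Suc n)) \<longlonglongrightarrow> m - 0"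
      by (intro tendsto_intros LIMSEQ_Suc lim_1_over_n)
    then show "(\<lambda>n. m - 1 / real (Suc n)) \<longlonglongrightarrow> m" by simp
    show "\<forall>\<^sub>F n in sequentially. m - 1 / real (Suc n) \<le> norm (T (y n))"
      by (intro always_eventually allI less_imp_le y(3))
  qed (simp add: Tm)
  obtain l r where r: "strict_mono (r :: nat \<Rightarrow> nat)" and l: "(\<lambda>n. T (y (r n))) \<longlonglongrightarrow> l"
    by (rule convergent_subsequence[OF y(2)])
  have lN: "l \<in> N" by (rule closed_sequentially[OF ND(1) _ l]) (intro inv y)
  have limr: "(\<lambda>n. norm (T (y (r n)))) \<longlonglongrightarrow> m"
    using LIMSEQ_subseq_LIMSEQ[OF lim r] by (simp add: o_def)
  then have nl: "norm l = m" using tendsto_norm[OF l] LIMSEQ_unique by blast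
  \<comment> \<open>a norming sequence for \<open>T\<close> is asymptotically an eigenvector of \<open>T\<^sup>2\<close> for \<open>m\<^sup>2\<close>\<close>
  have key: "(norm (T (T z) - m\<^sup>2 *\<^sub>R z))\<^sup>2 \<le> m\<^sup>2 * (m\<^sup>2 - (norm (T z))\<^sup>2)"
    if z: "z \<in> N" "norm z \<le> 1" for z
  proof -
    have "inner (T (T z)) z = Re (cinner (T z) (T z))" by (simp add: Re_cinner[symmetric] selfadj)
    then have i: "inner (T (T z)) z = (norm (T z))\<^sup>2" by (simp add: cinner_self)
    have "(norm (T (T z) - m\<^sup>2 *\<^sub>R z))\<^sup>2
        = (norm (T (T z)))\<^sup>2 - 2 * m\<^sup>2 * inner (T (T z)) z + (m\<^sup>2 * m\<^sup>2) * (norm z)\<^sup>2"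
      unfolding power2_norm_eq_inner
      by (simp add: inner_diff_left inner_diff_right inner_commute)
    moreover have "(norm (T (T z)))\<^sup>2 \<le> m\<^sup>2 * (norm (T z))\<^sup>2"
      using power_mono[OF le[OF inv[OF z(1)]] norm_ge_zero, of 2] by (simp add: power_mult_distrib)
    moreover have "(m\<^sup>2 * m\<^sup>2) * (norm z)\<^sup>2 \<le> (m\<^sup>2 * m\<^sup>2) * 1"
      using z by (intro mult_left_mono) (auto simp: power_le_one)
    ultimately show ?thesis unfolding i by (simp add: right_diff_distrib)
  qed
  have "(\<lambda>n. m\<^sup>2 * (m\<^sup>2 - (norm (T (y (r n))))\<^sup>2)) \<longlonglongrightarrow> m\<^sup>2 * (m\<^sup>2 - m\<^sup>2)"
    by (intro tendsto_intros limr)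
  then have h: "(\<lambda>n. m\<^sup>2 * (m\<^sup>2 - (norm (T (y (r n))))\<^sup>2)) \<longlonglongrightarrow> 0" by simp
  have "(\<lambda>n. (norm (T (T (y (r n))) - m\<^sup>2 *\<^sub>R y (r n)))\<^sup>2) \<longlonglongrightarrow> 0"
  proof (rule tendsto_sandwich[OF _ _ tendsto_const h])
    show "\<forall>\<^sub>F n in sequentially. (norm (T (T (y (r n))) - m\<^sup>2 *\<^sub>R y (r n)))\<^sup>2
        \<le> m\<^sup>2 * (m\<^sup>2 - (norm (T (y (r n))))\<^sup>2)"
      by (intro always_eventually allI key y)
  qed simp
  then have "(\<lambda>n. sqrt ((norm (T (T (y (r n))) - m\<^sup>2 *\<^sub>R y (r n)))\<^sup>2)) \<longlonglongrightarrow> sqrt 0"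
    by (rule tendsto_real_sqrt)
  then have d: "(\<lambda>n. T (T (y (r n))) - m\<^sup>2 *\<^sub>R y (r n)) \<longlonglongrightarrow> 0"
    by (simp add: tendsto_norm_zero_iff)
  \<comment> \<open>Hence m^2 y (r n) tends to T l. After one more application of \<open>T\<close>
    the limit is T (T l), but it is also m^2 l because T (y (r n)) tends to
    \<open>l\<close>.\<close>
  have "(\<lambda>n. T (T (y (r n))) - (T (T (y (r n))) - m\<^sup>2 *\<^sub>R y (r n))) \<longlonglongrightarrow> T l - 0"
    by (intro tendsto_diff d tendsto l)
  then have "(\<lambda>n. T (m\<^sup>2 *\<^sub>R y (r n))) \<longlonglongrightarrow> T (T l)" by (intro tendsto) simp
  moreover have "(\<lambda>n. T (m\<^sup>2 *\<^sub>R y (r n))) \<longlonglongrightarrow> m\<^sup>2 *\<^sub>R l"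
    unfolding scaleR by (intro tendsto_scaleR tendsto_const l)
  ultimately have TTl: "T (T l) = m\<^sup>2 *\<^sub>R l" using LIMSEQ_unique by blast
  \<comment> \<open>Factorisation T^2 - m^2 = (T - m)(T + m): \<open>v\<close> lies in the
    eigenspace for m, and if \<open>v\<close> is 0 then \<open>l\<close> lies in that for
    -m.\<close>
  define v where "v = T l + m *\<^sub>R l"
  have "v \<in> N" unfolding v_def by (intro ND inv lN)
  moreover have "v \<in> eigenspace T m"
    by (simp add: eigenspace_def v_def add scaleR TTl scaleC_of_real scaleR_add_right power2_eq_square)
  ultimately have "v = 0" using none[of m v] m0 by simp
  then have "T l = (- m) *\<^sub>R l" by (simp add: v_def eq_neg_iff_add_eq_0)
  then have "l \<in> eigenspace T (- m)" unfolding eigenspace_def by (simp only: scaleC_of_real mem_Collect_eq)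
  then have "l = 0" using none[of "- m" l] m0 lN by simp
  then show False using nl m0 by simp
qed

text \<open>The preimage of the closed span under \<open>T\<close> is a closed subspace containing
  each of the eigenspaces.\<close>

lemma closed_span_eigenspaces_invariant:
  assumes "x \<in> closed_span (\<Union>a\<in>X. eigenspace T a)"
  shows "T x \<in> closed_span (\<Union>a\<in>X. eigenspace T a)" (is "_ \<in> ?V")
proof -
  have "eigenspace T a \<subseteq> T -` ?V" if "a \<in> X" for a
  proof
    fix y assume y: "y \<in> eigenspace T a"
    then have "y \<in> ?V" by (intro subsetD[OF closed_span_superset]) (use that in blast)
    then have "complex_of_real a *\<^sub>C y \<in> ?V" by (rule closed_csubspaceD(4)[OF closed_csubspace_closed_span])
    then show "y \<in> T -` ?V" using eigenspaceD[OF y] by simp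
  qed
  then have "?V \<subseteq> T -` ?V"
    by (intro closed_span_minimal closed_csubspace_vimage bounded_clinear closed_csubspace_closed_span) blast
  with assms show ?thesis by blast
qed

text \<open>The orthogonal complement of the eigenspaces for nonzero eigenvalues is invariant under
  \<open>T\<close> and contains no nonzero vector of them, so \<open>T\<close> vanishes on it and
  only the projection of \<open>x\<close> onto the closed span matters. Conversely an eigenvector is
  x = T (x / a).\<close>

lemma closure_range_eq: "closure (range T) = closed_span (\<Union>a\<in>- {0}. eigenspace T a)" (is "_ = ?V")
proof
  have "T x \<in> ?V" for x
  proof -
    let ?N = "orthocomp (\<Union>a\<in>- {0}. eigenspace T a)"
    define p where "p = proj_onto ?V x"
    have p: "p \<in> ?V" unfolding p_def by (rule proj_onto_mem[OF closed_csubspace_closed_span])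
    have "T (x - p) = 0"
    proof (rule eq_0_if_no_eigenvector[OF closed_csubspace_orthocomp])
      have "cinner (x - p) s = 0" if "s \<in> (\<Union>a\<in>- {0}. eigenspace T a)" for s
        unfolding p_def
        by (rule proj_onto_orthogonal[OF closed_csubspace_closed_span subsetD[OF closed_span_superset that]])
      then show "x - p \<in> ?N" unfolding orthocomp_def by blast
      show "T y \<in> ?N" if "y \<in> ?N" for y
        using that by (auto simp: orthocomp_def selfadj eigenspaceD cinner_scaleC_right)
      show "y = 0" if "a \<noteq> 0" "y \<in> ?N" "y \<in> eigenspace T a" for a y
        using that unfolding orthocomp_def by (auto dest!: bspec[of _ _ y])
    qed
    then have "T x = T p" by (simp add: diff)
    then show ?thesis using closed_span_eigenspaces_invariant[OF p] by simp
  qed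
  then show "closure (range T) \<subseteq> ?V" by (intro closure_minimal) auto
next
  have sub: "complex_vector.subspace (range T)"
    unfolding complex_vector.subspace_def
  proof (intro conjI ballI allI)
    show "0 \<in> range T" by (rule range_eqI[of _ _ 0]) (simp add: zero)
    fix x y c assume "x \<in> range T"
    then obtain x' where x': "x = T x'" by blast
    show "x + y \<in> range T" if "y \<in> range T"
      using that by (auto simp: x' add[symmetric])
    show "c *\<^sub>C x \<in> range T" by (auto simp: x' scaleC[symmetric])
  qed
  have "x \<in> range T" if "a \<noteq> 0" "x \<in> eigenspace T a" for a x
  proof -
    have "T (complex_of_real (1 / a) *\<^sub>C x) = x"
      using that by (simp add: scaleC eigenspaceD scaleC_scaleC)
    then show ?thesis by (metis rangeI)
  qed
  then have "(\<Union>a\<in>- {0}. eigenspace T a) \<subseteq> closure (range T)" using closure_subset by blast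
  then show "?V \<subseteq> closure (range T)" by (intro closed_span_minimal closed_csubspace_closure sub)
qed

text \<open>The image of the unit ball is totally bounded; a finite net for it of radius |a|/2 has a
  size that serves for all \<open>B\<close> at once, as the search for a maximal orthonormal set
  requires.\<close>

lemma card_orthonormal_eigenvectors_bounded:
  assumes a: "a \<noteq> 0"
  obtains n where "\<And>B. finite B \<Longrightarrow> B \<subseteq> eigenspace T a \<Longrightarrow> orthonormal B \<Longrightarrow> card B \<le> n"
proof -
  have "compact (closure (T ` cball 0 1))" using compact by (simp add: compact_op_def)
  then obtain k where k: "finite k" "closure (T ` cball 0 1) \<subseteq> (\<Union>x\<in>k. ball x (\<bar>a\<bar> / 2))"
    using a unfolding compact_eq_totally_bounded by (meson half_gt_zero zero_less_abs_iff)
  have "card B \<le> card k" if B: "finite B" "B \<subseteq> eigenspace T a" "orthonormal B" for B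
  proof -
    have nb: "norm b = 1" if "b \<in> B" for b
    proof -
      have "cinner b b = 1" using that B(3) by (simp add: orthonormal_def)
      then have "complex_of_real ((norm b)\<^sup>2) = complex_of_real 1" by (simp only: cinner_self of_real_1)
      then have "(norm b)\<^sup>2 = 1\<^sup>2" by (simp only: of_real_eq_iff power_one)
      then show ?thesis by (simp only: power2_eq_iff_nonneg norm_ge_zero zero_le_one)
    qed
    have "\<exists>c\<in>k. dist c (T b) < \<bar>a\<bar> / 2" if "b \<in> B" for b
    proof -
      have "T b \<in> closure (T ` cball 0 1)" using nb[OF that] by (intro subsetD[OF closure_subset] imageI) simp
      then obtain c where "c \<in> k" "T b \<in> ball c (\<bar>a\<bar> / 2)" using k(2) by blast
      then show ?thesis by auto
    qed
    then obtain c where c: "\<And>b. b \<in> B \<Longrightarrow> c b \<in> k" "\<And>b. b \<in> B \<Longrightarrow> dist (c b) (T b) < \<bar>a\<bar> / 2"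
      by metis
    \<comment> \<open>distinct members of \<open>B\<close> have distance \<open>sqrt 2\<close>, so a ball of radius \<open>\<bar>a\<bar> / 2\<close> contains the image of at most one\<close>
    have "inj_on c B"
    proof (rule inj_onI, rule ccontr)
      fix b b' assume b: "b \<in> B" "b' \<in> B" "c b = c b'" "b \<noteq> b'"
      have "dist (T b) (T b') < \<bar>a\<bar>"
        using dist_triangle_half_r[OF c(2)[OF b(1)]] c(2)[OF b(2)] b(3) by simp
      moreover have "T b - T b' = a *\<^sub>R (b - b')"
        using eigenspaceD[OF subsetD[OF B(2) b(1)]] eigenspaceD[OF subsetD[OF B(2) b(2)]]
        by (simp add: scaleC_of_real scaleR_diff_right)
      ultimately have "norm (b - b') < 1" using a by (simp add: dist_norm)
      then have "(norm (b - b'))\<^sup>2 < 1" by (simp add: power_less_one_iff)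
      moreover have "cinner b (- b') = 0"
        using B(3) b by (simp add: orthonormal_def cinner.minus_right)
      then have "(norm (b - b'))\<^sup>2 = 2"
        using norm_add_orthogonal[of b "- b'"] nb b by simp
      ultimately show False by simp
    qed
    then show ?thesis using c k(1) card_inj_on_le by blast
  qed
  then show thesis using that by blast
qed

lemma unitary_onto_cvec_eigenspace:
  assumes "a \<noteq> 0"
  obtains W where "unitary_onto W (eigenspace T a) (cvec (complex_vector.dim (eigenspace T a)))"
proof -
  have sub: "complex_vector.subspace (eigenspace T a)"
    using closed_csubspace_eigenspace[OF bounded_clinear] by (simp add: closed_csubspace_def)
  obtain n where "\<And>B. finite B \<Longrightarrow> B \<subseteq> eigenspace T a \<Longrightarrow> orthonormal B \<Longrightarrow> card B \<le> n"
    using card_orthonormal_eigenvectors_bounded[OF assms] by blast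
  then obtain B where "finite B" "orthonormal B" "complex_vector.span B = eigenspace T a"
    by (rule orthonormal_basis_exists[OF sub])
  then show thesis using unitary_onto_cvec that by blast
qed

text \<open>By self-adjointness the orthogonal complement of an invariant subspace is invariant
  too.\<close>

lemma proj_onto_commute:
  assumes L: "closed_csubspace L" and inv: "\<And>x. x \<in> L \<Longrightarrow> T x \<in> L"
  shows "proj_onto L (T x) = T (proj_onto L x)"
proof (rule proj_onto_eqI[OF L])
  show "T (proj_onto L x) \<in> L" by (intro inv proj_onto_mem L)
  fix m assume "m \<in> L"
  then show "cinner (T x - T (proj_onto L x)) m = 0"
    unfolding diff[symmetric] selfadj by (intro proj_onto_orthogonal L inv)
qed

text \<open>Summing the expansion of \<open>x\<close> after applying \<open>T\<close> gives the
  defining series of \<open>E01\<close>. Thus the block operator can be handled through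
  \<open>T\<close> itself.\<close>

lemma E01_eq:
  assumes "x \<in> E01_space T"
  shows "E01 T x = T x"
proof -
  interpret E: orthogonal_family "eigenvalues01 T" "eigenspace T" by (rule orthogonal_family_eigenspace)
  have "((\<lambda>a. T (proj_onto (eigenspace T a) x)) has_sum T x) (eigenvalues01 T)"
    using assms unfolding E01_space_def
    by (intro has_sum_bounded_linear[OF bounded_linear_axioms] E.has_sum_proj_onto)
  moreover have "T (proj_onto (eigenspace T a) x) = a *\<^sub>R proj_onto (eigenspace T a) x"
    if "a \<in> eigenvalues01 T" for a
    using eigenspaceD[OF proj_onto_mem[OF E.closed_csubspace[OF that]]] by (simp add: scaleC_of_real)
  ultimately have "((\<lambda>a. a *\<^sub>R proj_onto (eigenspace T a) x) has_sum T x) (eigenvalues01 T)"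
    by (simp cong: has_sum_cong)
  then show ?thesis unfolding E01_def by (rule infsumI)
qed

end

section \<open>Anticommuting self-adjoint pairs\<close>

text \<open>Isolates the relations that the spectral argument uses; the two projections return when
  the locale is interpreted.\<close>

locale anticommuting_pair = compact_selfadjoint T for T :: "'a::chilbert_space \<Rightarrow> 'a" +
  fixes K :: "'a \<Rightarrow> 'a"
  assumes bounded_clinear_K: "bounded_clinear K"
    and selfadj_K: "cinner (K x) y = cinner x (K y)"
    and anticommute: "T (K x) = - K (T x)"
    and squares: "T (T x) + K (K x) = x"
begin

sublocale K: bounded_linear K
  using bounded_clinear_K by (simp add: bounded_clinear_def)

lemma K_scaleC: "K (c *\<^sub>C x) = c *\<^sub>C K x"
  using bounded_clinear_K by (simp add: bounded_clinear_def)

lemma K_eigenspace: "x \<in> eigenspace T a \<Longrightarrow> K x \<in> eigenspace T (- a)"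
  by (simp add: eigenspace_def anticommute K_scaleC scaleC.minus_left)

lemma K_K_eigenspace:
  assumes "x \<in> eigenspace T a"
  shows "K (K x) = (1 - a\<^sup>2) *\<^sub>R x"
proof -
  have "T (T x) = a\<^sup>2 *\<^sub>R x"
    using assms by (simp add: eigenspace_def scaleC_of_real scaleR power2_eq_square)
  then show ?thesis using squares[of x] by (simp add: scaleR_diff_left algebra_simps)
qed

text \<open>On E(a) one has |K x|^2 = <K K x, x> = (1 - a^2) |x|^2, which cannot be
  negative.\<close>

lemma abs_eigenvalue_le_1:
  assumes x: "x \<in> eigenspace T a" and "x \<noteq> 0"
  shows "\<bar>a\<bar> \<le> 1"
proof -
  have "(norm (K x))\<^sup>2 = Re (cinner (K (K x)) x)" by (simp add: selfadj_K cinner_self)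
  also have "\<dots> = (1 - a\<^sup>2) * (norm x)\<^sup>2"
    by (simp add: K_K_eigenspace[OF x] Re_cinner power2_norm_eq_inner)
  finally have "0 \<le> (1 - a\<^sup>2) * (norm x)\<^sup>2" using zero_le_power2 by metis
  then have "a\<^sup>2 \<le> 1" using assms(2) by (simp add: zero_le_mult_iff)
  then show ?thesis by (simp add: abs_square_le_1)
qed

text \<open>With c = 1 / sqrt (1 - a^2) the operator c K squares to the identity on E(a) and on
  E(-a) and exchanges the two, so it is its own inverse; self-adjointness of \<open>K\<close> then
  makes it isometric.\<close>

lemma unitary_onto_K:
  assumes a: "\<bar>a\<bar> < 1"
  shows "unitary_onto (\<lambda>x. (1 / sqrt (1 - a\<^sup>2)) *\<^sub>R K x) (eigenspace T (- a)) (eigenspace T a)"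
proof -
  define c where "c = 1 / sqrt (1 - a\<^sup>2)"
  have pos: "1 - a\<^sup>2 > 0" using a by (simp add: abs_square_less_1)
  then have cc: "c * c * (1 - a\<^sup>2) = 1" by (simp add: c_def)
  note E = closed_csubspaceD[OF closed_csubspace_eigenspace[OF bounded_clinear]]
  have KE: "K x \<in> eigenspace T (- b)" if "x \<in> eigenspace T b" for x b using K_eigenspace[OF that] .
  have "unitary_onto (\<lambda>x. c *\<^sub>R K x) (eigenspace T (- a)) (eigenspace T a)"
    unfolding unitary_onto_def
  proof (intro conjI ballI allI set_eqI iffI)
    fix y assume "y \<in> (\<lambda>x. c *\<^sub>R K x) ` eigenspace T (- a)"
    then show "y \<in> eigenspace T a" using KE[of _ "- a"] E(5)[of _ a] by auto
  next
    fix y assume y: "y \<in> eigenspace T a"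
    have "y = c *\<^sub>R K (c *\<^sub>R K y)"
      using cc by (simp add: K.scaleR K_K_eigenspace[OF y] mult.assoc)
    moreover have "c *\<^sub>R K y \<in> eigenspace T (- a)" by (intro E KE y)
    ultimately show "y \<in> (\<lambda>x. c *\<^sub>R K x) ` eigenspace T (- a)" by blast
  next
    fix x y assume x: "x \<in> eigenspace T (- a)"
    have "cinner (c *\<^sub>R K x) (c *\<^sub>R K y) = of_real (c * c) * cinner (K (K x)) y"
      by (simp add: cinner.scaleR_left cinner.scaleR_right selfadj_K scaleR_conv_of_real)
    also have "\<dots> = of_real (c * c * (1 - a\<^sup>2)) * cinner x y"
      using K_K_eigenspace[OF x] by (simp add: cinner.scaleR_left scaleR_conv_of_real)
    finally show "cinner (c *\<^sub>R K x) (c *\<^sub>R K y) = cinner x y" using cc by simp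
  qed (simp_all add: K.add K_scaleC scaleR_add_right scaleR_eq_scaleC scaleC_scaleC mult.commute
        scaleC_add_right del: scaleC_of_real)
  then show ?thesis by (simp add: c_def)
qed

section \<open>The passage from negative to positive eigenspaces and the four spectral
  blocks\<close>

definition J :: "'a \<Rightarrow> 'a" where
  "J = direct_sum_op (eigenvalues01 T) (\<lambda>a. eigenspace T (- a)) (\<lambda>a x. (1 / sqrt (1 - a\<^sup>2)) *\<^sub>R K x)"

text \<open>The index runs over the positive eigenvalues so that the family is matched with that of
  \<open>E01_space T\<close>; by the unitaries from \<open>K\<close> this catches every eigenvalue
  in (-1,0).\<close>

definition E01_neg_space :: "'a set" where
  "E01_neg_space = closed_span (\<Union>a\<in>eigenvalues01 T. eigenspace T (- a))"

lemma orthogonal_family_neg: "orthogonal_family X (\<lambda>a. eigenspace T (- a))"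
proof
  interpret E: orthogonal_family UNIV "eigenspace T" by (rule orthogonal_family_eigenspace)
  show "closed_csubspace (eigenspace T (- a))" for a by (rule E.closed_csubspace) simp
  show "cinner x y = 0" if "a \<noteq> b" "x \<in> eigenspace T (- a)" "y \<in> eigenspace T (- b)" for a b x y
    by (rule E.orthogonal[of "- a" "- b"]) (use that in simp_all)
qed

lemma unitary_onto_K': "a \<in> eigenvalues01 T \<Longrightarrow>
  unitary_onto (\<lambda>x. (1 / sqrt (1 - a\<^sup>2)) *\<^sub>R K x) (eigenspace T (- a)) (eigenspace T a)"
  by (rule unitary_onto_K) (simp add: eigenvalues01_def)

lemma unitary_onto_J: "unitary_onto J E01_neg_space (E01_space T)"
  unfolding J_def E01_neg_space_def E01_space_def
  by (rule unitary_onto_direct_sum_op[OF orthogonal_family_neg orthogonal_family_eigenspace unitary_onto_K'])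

text \<open>\<open>T\<close> commutes with the projections onto its eigenspaces and anticommutes
  with \<open>K\<close>, so the sign appears in each summand.\<close>

lemma J_T: "J (T x) = - T (J x)"
proof -
  let ?E = "\<lambda>a. eigenspace T (- a)" and ?k = "\<lambda>a x. (1 / sqrt (1 - a\<^sup>2)) *\<^sub>R K x"
  interpret E: orthogonal_family "eigenvalues01 T" ?E by (rule orthogonal_family_neg)
  have sums: "((\<lambda>a. ?k a (proj_onto (?E a) x)) has_sum J x) (eigenvalues01 T)" for x
    unfolding J_def
    by (rule has_sum_direct_sum_op[OF orthogonal_family_neg orthogonal_family_eigenspace unitary_onto_K'])
  have "((\<lambda>a. - T (?k a (proj_onto (?E a) x))) has_sum - T (J x)) (eigenvalues01 T)"
    by (rule has_sum_bounded_linear[OF bounded_linear_minus[OF bounded_linear_axioms] sums])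
  moreover have "- T (?k a (proj_onto (?E a) x)) = ?k a (proj_onto (?E a) (T x))"
    if a: "a \<in> eigenvalues01 T" for a
  proof -
    note Ea = E.closed_csubspace[OF a]
    have "T y \<in> ?E a" if "y \<in> ?E a" for y
      unfolding eigenspaceD[OF that] by (rule closed_csubspaceD(4)[OF Ea that])
    then have "proj_onto (?E a) (T x) = T (proj_onto (?E a) x)"
      by (rule proj_onto_commute[OF Ea])
    then show ?thesis by (simp add: scaleR anticommute)
  qed
  ultimately have "((\<lambda>a. ?k a (proj_onto (?E a) (T x))) has_sum - T (J x)) (eigenvalues01 T)"
    by (simp cong: has_sum_cong)
  then show ?thesis using sums[of "T x"] has_sum_unique by blast
qed

text \<open>The indices follow the order of the diagonal blocks. Every index from 3 on yields the
  negative part, so only \<open>{..<4}\<close> gives an orthogonal family.\<close>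

definition part :: "nat \<Rightarrow> real set" where
  "part i = (if i = 0 then {1} else if i = 1 then eigenvalues01 T
     else if i = 2 then {- 1} else uminus ` eigenvalues01 T)"

definition block :: "nat \<Rightarrow> 'a set" where
  "block i = closed_span (\<Union>a\<in>part i. eigenspace T a)"

lemma block_simps: "block 0 = eigenspace T 1" "block (Suc 0) = E01_space T" "block 2 = eigenspace T (- 1)"
  "block 3 = E01_neg_space"
  by (simp_all add: block_def part_def E01_space_def E01_neg_space_def
      closed_span_closed_csubspace[OF closed_csubspace_eigenspace[OF bounded_clinear]])

lemma block_invariant: "x \<in> block i \<Longrightarrow> T x \<in> block i"
  unfolding block_def by (rule closed_span_eigenspaces_invariant)

lemma orthogonal_family_block: "orthogonal_family {..<4} block"
proof
  interpret E: orthogonal_family UNIV "eigenspace T" by (rule orthogonal_family_eigenspace)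
  show "closed_csubspace (block i)" for i unfolding block_def by (rule closed_csubspace_closed_span)
  fix i j :: nat and x y assume ij: "i \<in> {..<4}" "j \<in> {..<4}" "i \<noteq> j" and x: "x \<in> block i" and y: "y \<in> block j"
  have "part i \<inter> part j = {}"
    using ij by (auto simp: part_def eigenvalues01_def split: if_splits)
  then have "cinner s t = 0"
    if "s \<in> (\<Union>a\<in>part i. eigenspace T a)" "t \<in> (\<Union>a\<in>part j. eigenspace T a)" for s t
  proof -
    obtain a b where "a \<in> part i" "s \<in> eigenspace T a" "b \<in> part j" "t \<in> eigenspace T b"
      using \<open>s \<in> _\<close> \<open>t \<in> _\<close> by blast
    moreover from this have "a \<noteq> b" using \<open>part i \<inter> part j = {}\<close> by blast
    ultimately show ?thesis using E.orthogonal[of a b s t] by simp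
  qed
  then show "cinner x y = 0"
    by (rule orthogonal_closed_span[OF _ x[unfolded block_def] y[unfolded block_def]])
qed

text \<open>A nonzero eigenvalue lies in [-1,1] and hence in one of the four parts. For the last
  part, an eigenvalue in (-1,0) has to be the negative of one in (0,1).\<close>

lemma closed_span_block: "closed_span (\<Union>i<4. block i) = nonzero_part_space T"
  unfolding nonzero_part_space_def closure_range_eq
proof
  have "block i \<subseteq> closed_span (\<Union>a\<in>- {0}. eigenspace T a)" if "i < 4" for i
  proof -
    have "part i \<subseteq> - {0}" by (auto simp: part_def eigenvalues01_def)
    then show ?thesis
      unfolding block_def by (intro closure_mono complex_vector.span_mono) blast
  qed
  then show "closed_span (\<Union>i<4. block i) \<subseteq> closed_span (\<Union>a\<in>- {0}. eigenspace T a)"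
    by (intro closed_span_minimal closed_csubspace_closed_span) blast
next
  have "x \<in> closed_span (\<Union>i<4. block i)" if a: "a \<noteq> 0" and x: "x \<in> eigenspace T a" for a x
  proof (cases "x = 0")
    case True
    then show ?thesis by (simp add: closed_csubspaceD(2)[OF closed_csubspace_closed_span])
  next
    case False
    \<comment> \<open>Makes \<open>K x\<close> a genuine eigenvector for -a, needed when a is
      negative.\<close>
    have "K x \<noteq> 0" if "\<bar>a\<bar> < 1"
    proof
      assume "K x = 0"
      then have "(1 - a\<^sup>2) *\<^sub>R x = 0" using K_K_eigenspace[OF x] by (simp add: K.zero)
      then show False using False that by (simp add: abs_square_less_1[symmetric])
    qed
    then have "\<exists>i<4. a \<in> part i"
    proof -
      consider "a = 1" | "a = - 1" | "0 < a" "a < 1" | "- 1 < a" "a < 0"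
        using abs_eigenvalue_le_1[OF x False] a by linarith
      then show ?thesis
      proof cases
        case 3
        then have "a \<in> eigenvalues01 T" using x False by (auto simp: eigenvalues01_def)
        then show ?thesis by (intro exI[of _ 1]) (simp add: part_def)
      next
        case 4
        then have "K x \<noteq> 0" using \<open>\<bar>a\<bar> < 1 \<Longrightarrow> K x \<noteq> 0\<close> by simp
        then have "- a \<in> eigenvalues01 T" using 4 K_eigenspace[OF x] by (auto simp: eigenvalues01_def)
        then show ?thesis by (intro exI[of _ 3]) (auto simp: part_def image_iff intro: bexI[of _ "- a"])
      qed (auto intro: exI[of _ 0] exI[of _ 2] simp: part_def)
    qed
    then obtain i where "i < 4" "a \<in> part i" by blast
    then have "x \<in> block i"
      unfolding block_def by (intro subsetD[OF closed_span_superset]) (use x in blast)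
    then show ?thesis by (intro subsetD[OF closed_span_superset]) (use \<open>i < 4\<close> in blast)
  qed
  then show "closed_span (\<Union>a\<in>- {0}. eigenspace T a) \<subseteq> closed_span (\<Union>i<4. block i)"
    by (intro closed_span_minimal closed_csubspace_closed_span) blast
qed

text \<open>The unitary decomposes a vector into its four spectral components, takes coordinates of
  those in E(1) and E(-1), keeps the second, and moves the fourth by \<open>J\<close>.\<close>

lemma unitarily_equivalent_block_op:
  "unitarily_equivalent_on (nonzero_part_space T) T
     (block_space (complex_vector.dim (eigenspace T 1)) (E01_space T)
        (complex_vector.dim (eigenspace T (- 1))))
     (block_op (E01 T))"
proof -
  let ?M = "nonzero_part_space T"
  interpret L: orthogonal_family "{..<4}" block by (rule orthogonal_family_block)
  define d1 d2 where "d1 = complex_vector.dim (eigenspace T 1)" and "d2 = complex_vector.dim (eigenspace T (- 1))"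
  obtain \<phi> where \<phi>: "unitary_onto \<phi> (block 0) (cvec d1)"
    using unitary_onto_cvec_eigenspace[of 1] by (auto simp: d1_def block_simps)
  obtain \<psi> where \<psi>: "unitary_onto \<psi> (block 2) (cvec d2)"
    using unitary_onto_cvec_eigenspace[of "- 1"] by (auto simp: d2_def block_simps)
  have J: "unitary_onto J (block 3) (E01_space T)" using unitary_onto_J by (simp add: block_simps)
  have b1: "E01_space T = block (Suc 0)" by (simp add: block_simps)
  define P where "P i = proj_onto (block i)" for i
  have bl: "closed_csubspace (block i)" for i unfolding block_def by (rule closed_csubspace_closed_span)
  have P: "P i x \<in> block i" for i x unfolding P_def by (rule proj_onto_mem[OF bl])
  have P_add: "P i (x + y) = P i x + P i y" and P_scaleC: "P i (c *\<^sub>C x) = c *\<^sub>C P i x"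
    and P_T: "P i (T x) = T (P i x)" for i x y c
    unfolding P_def by (simp_all add: proj_onto_add bl proj_onto_scaleC proj_onto_commute block_invariant)
  have sum4: "sum f {..<4::nat} = f 0 + f 1 + f 2 + f 3" for f :: "nat \<Rightarrow> 'c::comm_monoid_add"
    by (simp add: eval_nat_numeral)
  define W where "W x = (\<phi> (P 0 x), P (Suc 0) x, \<psi> (P 2 x), J (P 3 x))" for x
  have TM: "T x \<in> ?M" if "x \<in> ?M" for x
    using that unfolding nonzero_part_space_def closure_range_eq by (rule closed_span_eigenspaces_invariant)
  have minus: "unitary_onto W' M' N' \<Longrightarrow> closed_csubspace M' \<Longrightarrow> x \<in> M' \<Longrightarrow> W' (- x) = - W' x"
    for W' :: "'a \<Rightarrow> 'c::complex_inner" and M' N' x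
    using unitary_ontoD(4)[of W' M' N' x "- 1"] by (simp add: scaleC.minus_left)
  show ?thesis
    unfolding unitarily_equivalent_on_def d1_def[symmetric] d2_def[symmetric]
  proof (intro conjI exI[of _ W] ballI allI set_eqI iffI subsetI)
    fix y assume "y \<in> T ` ?M" then show "y \<in> ?M" using TM by blast
  next
    fix y assume "y \<in> block_op (E01 T) ` block_space d1 (E01_space T) d2"
    then obtain v p w q where y: "y = (v, E01 T p, - w, - E01 T q)" "v \<in> cvec d1" "p \<in> E01_space T"
      "w \<in> cvec d2" "q \<in> E01_space T"
      by (auto simp: block_op_def block_space_def)
    have "E01 T z \<in> E01_space T" if "z \<in> E01_space T" for z
      using that block_invariant[of z "Suc 0"] E01_eq[OF that] by (simp add: block_simps)
    moreover have "- z \<in> E01_space T" if "z \<in> E01_space T" for z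
      using that closed_csubspaceD(7)[OF bl[of "Suc 0"]] by (simp add: block_simps)
    ultimately show "y \<in> block_space d1 (E01_space T) d2"
      using y by (simp add: block_space_def cvec_def)
  next
    fix y assume "y \<in> W ` ?M"
    then show "y \<in> block_space d1 (E01_space T) d2"
      using unitary_ontoD(1)[OF \<phi> P] unitary_ontoD(1)[OF \<psi> P] unitary_ontoD(1)[OF J P] P[of "Suc 0"]
      by (auto simp: W_def block_space_def b1)
  next
    fix y assume "y \<in> block_space d1 (E01_space T) d2"
    then obtain v p w q where y: "y = (v, p, w, q)" "v \<in> cvec d1" "p \<in> block (Suc 0)"
      "w \<in> cvec d2" "q \<in> E01_space T"
      by (auto simp: block_space_def b1)
    obtain v' w' q' where v': "v' \<in> block 0" "\<phi> v' = v" and w': "w' \<in> block 2" "\<psi> w' = w"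
      and q': "q' \<in> block 3" "J q' = q"
      using unitary_ontoD(2)[OF \<phi> y(2)] unitary_ontoD(2)[OF \<psi> y(4)] unitary_ontoD(2)[OF J y(5)] by blast
    \<comment> \<open>Preimages of the four entries of \<open>y\<close>; their sum has exactly these
      as its components.\<close>
    define z where "z i = (if i = 0 then v' else if i = 1 then p else if i = 2 then w' else q')" for i :: nat
    have z: "z i \<in> block i" if "i \<in> {..<4}" for i
    proof -
      have "i = 0 \<or> i = 1 \<or> i = 2 \<or> i = 3" using that by auto
      then show ?thesis using v' w' q' y by (auto simp: z_def)
    qed
    have s: "(z has_sum sum z {..<4}) {..<4}" by (rule has_sum_finite) simp
    have "sum z {..<4} \<in> ?M"
      unfolding closed_span_block[symmetric] by (rule L.has_sum_mem_closed_span[OF s z])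
    moreover have "P i (sum z {..<4}) = z i" if "i < 4" for i
      unfolding P_def by (rule L.proj_onto_has_sum[OF s z]) (use that in auto)
    then have "W (sum z {..<4}) = y"
      using v' w' q' y(1) by (simp add: W_def z_def)
    ultimately show "y \<in> W ` ?M" by blast
  next
    fix x y
    show "W (x + y) = W x + W y"
      unfolding W_def P_add using unitary_ontoD(3)[OF \<phi> P P] unitary_ontoD(3)[OF \<psi> P P] unitary_ontoD(3)[OF J P P]
      by simp
  next
    fix c x
    show "W (c *\<^sub>C x) = c *\<^sub>C W x"
      unfolding W_def P_scaleC using unitary_ontoD(4)[OF \<phi> P] unitary_ontoD(4)[OF \<psi> P] unitary_ontoD(4)[OF J P]
      by (simp add: scaleC_prod_def)
  next
    fix x y assume x: "x \<in> ?M"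
    have "((\<lambda>i. cinner (P i x) (P i y)) has_sum cinner x y) {..<4}"
      unfolding P_def using x by (intro L.has_sum_cinner_proj_onto) (simp add: closed_span_block)
    then have "cinner x y = (\<Sum>i<4. cinner (P i x) (P i y))"
      using has_sum_unique has_sum_finite finite_lessThan by blast
    then show "cinner (W x) (W y) = cinner x y"
      unfolding W_def using unitary_ontoD(5)[OF \<phi> P P] unitary_ontoD(5)[OF \<psi> P P] unitary_ontoD(5)[OF J P P]
      by (simp add: cinner_prod_def sum4)
  next
    fix x
    \<comment> \<open>On the blocks \<open>T\<close> is 1, \<open>E01 T\<close>, -1 and, after
      transport by \<open>J\<close>, the negative of \<open>E01 T\<close>.\<close>
    have "T (P 0 x) = P 0 x" "T (P 2 x) = - P 2 x"
      using P[of 0 x] P[of 2 x] by (simp_all add: block_simps eigenspace_def scaleC.minus_left)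
    moreover have "E01 T (P (Suc 0) x) = T (P (Suc 0) x)" "E01 T (J (P 3 x)) = T (J (P 3 x))"
      using P[of "Suc 0" x] unitary_ontoD(1)[OF J P] by (simp_all add: b1[symmetric] E01_eq)
    ultimately show "W (T x) = block_op (E01 T) (W x)"
      unfolding W_def P_T by (simp add: block_op_def J_T minus[OF \<psi> bl P])
  qed
qed

end

section \<open>Differences of projections\<close>

lemma bounded_clinear_compose:
  "bounded_clinear A \<Longrightarrow> bounded_clinear B \<Longrightarrow> bounded_clinear (\<lambda>x. A (B x))"
  by (simp add: bounded_clinear_def bounded_linear_compose)

lemma bounded_clinear_add:
  "bounded_clinear A \<Longrightarrow> bounded_clinear B \<Longrightarrow> bounded_clinear (\<lambda>x. A x + B x)"
  by (simp add: bounded_clinear_def bounded_linear_add scaleC_add_right)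

lemma bounded_clinear_diff:
  "bounded_clinear A \<Longrightarrow> bounded_clinear B \<Longrightarrow> bounded_clinear (\<lambda>x. A x - B x)"
  by (simp add: bounded_clinear_def bounded_linear_sub scaleC.diff_right)

lemma bounded_clinear_ident: "bounded_clinear (\<lambda>x. x)"
  by (simp add: bounded_clinear_def bounded_linear_ident)

lemma orthogonal_projection_opD:
  assumes "orthogonal_projection_op Q"
  shows "bounded_clinear Q" "Q (Q x) = Q x" "cinner (Q x) y = cinner x (Q y)"
    "Q (x + y) = Q x + Q y" "Q (x - y) = Q x - Q y" "Q (- x) = - Q x"
proof -
  interpret Q: bounded_linear Q using assms by (simp add: orthogonal_projection_op_def bounded_clinear_def)
  show "bounded_clinear Q" "Q (Q x) = Q x" "cinner (Q x) y = cinner x (Q y)"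
    using assms by (simp_all add: orthogonal_projection_op_def fun_eq_iff)
  show "Q (x + y) = Q x + Q y" "Q (x - y) = Q x - Q y" "Q (- x) = - Q x"
    by (rule Q.add Q.diff Q.neg)+
qed

text \<open>Idempotence gives (Q1 - Q2)^2 = Q1 + Q2 - Q1 Q2 - Q2 Q1, while (Q1 + Q2 - I)^2 is I
  minus this. The products of the two operators are Q1 Q2 - Q2 Q1 in one order and its negative in
  the other.\<close>

lemma anticommuting_pair_projections:
  fixes Q1 Q2 :: "'a::chilbert_space \<Rightarrow> 'a"
  assumes Q1: "orthogonal_projection_op Q1" and Q2: "orthogonal_projection_op Q2"
    and compact: "compact_op (\<lambda>x. Q1 x - Q2 x)"
  shows "anticommuting_pair (\<lambda>x. Q1 x - Q2 x) (\<lambda>x. Q1 x + Q2 x - x)"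
proof
  note Q1D = orthogonal_projection_opD[OF Q1] and Q2D = orthogonal_projection_opD[OF Q2]
  show "compact_op (\<lambda>x. Q1 x - Q2 x)" by (rule compact)
  show "bounded_clinear (\<lambda>x. Q1 x + Q2 x - x)"
    by (rule bounded_clinear_diff[OF bounded_clinear_add[OF Q1D(1) Q2D(1)] bounded_clinear_ident])
  fix x y
  show "cinner (Q1 x - Q2 x) y = cinner x (Q1 y - Q2 y)"
    by (simp add: cinner.diff_left cinner.diff_right Q1D(3) Q2D(3))
  show "cinner (Q1 x + Q2 x - x) y = cinner x (Q1 y + Q2 y - y)"
    by (simp add: cinner.diff_left cinner.diff_right cinner.add_left cinner.add_right Q1D(3) Q2D(3))
  show "Q1 (Q1 x + Q2 x - x) - Q2 (Q1 x + Q2 x - x)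
      = - (Q1 (Q1 x - Q2 x) + Q2 (Q1 x - Q2 x) - (Q1 x - Q2 x))"
    by (simp add: Q1D(2,4,5) Q2D(2,4,5))
  show "Q1 (Q1 x - Q2 x) - Q2 (Q1 x - Q2 x)
      + (Q1 (Q1 x + Q2 x - x) + Q2 (Q1 x + Q2 x - x) - (Q1 x + Q2 x - x)) = x"
    by (simp add: Q1D(2,4,5) Q2D(2,4,5))
qed

section \<open>Isometries and their defect projections\<close>

definition isometry_op :: "('a::complex_inner \<Rightarrow> 'b::complex_inner) \<Rightarrow> bool" where
  "isometry_op V \<longleftrightarrow> bounded_clinear V \<and> (\<forall>x y. cinner (V x) (V y) = cinner x y)"

lemma cadjoint_isometry:
  fixes V :: "'a::chilbert_space \<Rightarrow> 'b::complex_inner"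
  assumes "isometry_op V"
  shows "cadjoint V (V x) = x"
proof (rule cinner_eqI)
  fix z
  have "cinner z (cadjoint V (V x)) = cinner (V z) (V x)"
    using assms by (intro cinner_cadjoint_right) (simp add: isometry_op_def)
  also have "\<dots> = cinner z x" using assms by (simp add: isometry_op_def)
  finally show "cinner z (cadjoint V (V x)) = cinner z x" .
qed

text \<open>Idempotence survives because V* V = I cancels between the two factors.\<close>

lemma orthogonal_projection_op_conjugate:
  fixes V :: "'a::chilbert_space \<Rightarrow> 'a"
  assumes V: "isometry_op V" and Q: "orthogonal_projection_op Q"
  shows "orthogonal_projection_op (\<lambda>x. V (Q (cadjoint V x)))"
proof -
  note QD = orthogonal_projection_opD[OF Q]
  have bV: "bounded_clinear V" using V by (simp add: isometry_op_def)
  show ?thesis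
    unfolding orthogonal_projection_op_def
  proof (intro conjI allI)
    show "bounded_clinear (\<lambda>x. V (Q (cadjoint V x)))"
      by (rule bounded_clinear_compose[OF bV bounded_clinear_compose[OF QD(1) bounded_clinear_cadjoint[OF bV]]])
    show "(\<lambda>x. V (Q (cadjoint V x))) \<circ> (\<lambda>x. V (Q (cadjoint V x))) = (\<lambda>x. V (Q (cadjoint V x)))"
      by (simp add: fun_eq_iff cadjoint_isometry[OF V] QD(2))
    fix x y
    have "cinner (V (Q (cadjoint V x))) y = cinner (Q (cadjoint V x)) (cadjoint V y)"
      by (rule cinner_cadjoint_right[OF bV, symmetric])
    also have "\<dots> = cinner (cadjoint V x) (Q (cadjoint V y))" by (rule QD(3))
    also have "\<dots> = cinner x (V (Q (cadjoint V y)))" by (rule cinner_cadjoint_left[OF bV])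
    finally show "cinner (V (Q (cadjoint V x))) y = cinner x (V (Q (cadjoint V y)))" .
  qed
qed

text \<open>With D = I - V2 V2* the terms of H in V2 alone combine to V2 D V2*, and the other two to
  -V1 D V1*; H is therefore a difference of conjugated projections.\<close>

lemma unitarily_equivalent_H_op:
  fixes V1 V2 :: "'a::chilbert_space \<Rightarrow> 'a"
  assumes V1: "isometry_op V1" and V2: "isometry_op V2" and comm: "\<And>x. V1 (V2 x) = V2 (V1 x)"
    and compact: "compact_op (H_op V1 V2)"
  defines "T \<equiv> H_op V1 V2"
  shows "unitarily_equivalent_on (nonzero_part_space T) T
     (block_space (complex_vector.dim (eigenspace T 1)) (E01_space T)
        (complex_vector.dim (eigenspace T (- 1))))
     (block_op (E01 T))"
proof -
  have bV: "bounded_clinear V1" "bounded_clinear V2" using V1 V2 by (simp_all add: isometry_op_def)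
  note bA = bV[THEN bounded_clinear_cadjoint]
  interpret V1: bounded_linear V1 using bV by (simp add: bounded_clinear_def)
  interpret V2: bounded_linear V2 using bV by (simp add: bounded_clinear_def)
  define D where "D x = x - V2 (cadjoint V2 x)" for x
  have D: "orthogonal_projection_op D"
    unfolding orthogonal_projection_op_def
  proof (intro conjI allI)
    interpret A2: bounded_linear "cadjoint V2" using bA by (simp add: bounded_clinear_def)
    show "bounded_clinear D"
      unfolding D_def[abs_def]
      by (rule bounded_clinear_diff[OF bounded_clinear_ident bounded_clinear_compose[OF bV(2) bA(2)]])
    show "D \<circ> D = D"
      by (simp add: fun_eq_iff D_def A2.diff cadjoint_isometry[OF V2] V2.zero)
    fix x y
    have "cinner (V2 (cadjoint V2 x)) y = cinner (cadjoint V2 x) (cadjoint V2 y)"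
      by (rule cinner_cadjoint_right[OF bV(2), symmetric])
    also have "\<dots> = cinner x (V2 (cadjoint V2 y))" by (rule cinner_cadjoint_left[OF bV(2)])
    finally show "cinner (D x) y = cinner x (D y)"
      by (simp add: D_def cinner.diff_left cinner.diff_right)
  qed
  \<comment> \<open>Adjoint form of the commutation; it turns the last term of \<open>H_op\<close>
    into V1 V2 V2* V1*, as needed for V1 D V1*.\<close>
  have comm': "cadjoint V1 (cadjoint V2 x) = cadjoint V2 (cadjoint V1 x)" for x
    by (rule cinner_eqI) (simp add: cinner_cadjoint_right bV comm)
  have "T = (\<lambda>x. V2 (D (cadjoint V2 x)) - V1 (D (cadjoint V1 x)))"
    by (simp add: fun_eq_iff T_def H_op_def D_def V1.diff V2.diff comm')
  then interpret anticommuting_pair T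
    "\<lambda>x. V2 (D (cadjoint V2 x)) + V1 (D (cadjoint V1 x)) - x"
    using anticommuting_pair_projections[OF orthogonal_projection_op_conjugate[OF V2 D]
        orthogonal_projection_op_conjugate[OF V1 D]] compact unfolding T_def by simp
  show ?thesis by (rule unitarily_equivalent_block_op)
qed

section \<open>Completeness of the Hardy space\<close>

lemma hardy_cases:
  obtains f where "f \<in> hardy_fun" "F = abs_hardy f"
proof -
  have "hardy_rel (rep_hardy F) (rep_hardy F)" by (rule Quotient3_rep_reflp[OF Quotient3_hardy])
  then show thesis
    using that[of "rep_hardy F"] Quotient3_abs_rep[OF Quotient3_hardy, of F] by (simp add: hardy_rel_def)
qed

lemma
  assumes f: "f \<in> hardy_fun"
  shows abs_hardy_scaleC: "c *\<^sub>C abs_hardy f = abs_hardy (\<lambda>z. c *\<^sub>C f z)"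
    and abs_hardy_mult_z: "mult_z (abs_hardy f) = abs_hardy (\<lambda>z. z *\<^sub>C f z)"
    and abs_hardy_id_tensor: "bounded_clinear A \<Longrightarrow> id_tensor A (abs_hardy f) = abs_hardy (\<lambda>z. A (f z))"
    and hardy_fun_mult_z: "(\<lambda>z. z *\<^sub>C f z) \<in> hardy_fun"
    and hardy_fun_compose: "bounded_clinear A \<Longrightarrow> (\<lambda>z. A (f z)) \<in> hardy_fun"
proof -
  have ff: "hardy_rel f f" using f by (simp add: hardy_rel_def)
  show "c *\<^sub>C abs_hardy f = abs_hardy (\<lambda>z. c *\<^sub>C f z)"
    "mult_z (abs_hardy f) = abs_hardy (\<lambda>z. z *\<^sub>C f z)"
    "bounded_clinear A \<Longrightarrow> id_tensor A (abs_hardy f) = abs_hardy (\<lambda>z. A (f z))"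
    using ff by (simp_all add: scaleC_hardy.abs_eq mult_z.abs_eq id_tensor.abs_eq)
  show "(\<lambda>z. z *\<^sub>C f z) \<in> hardy_fun"
    using mult_z.rsp ff by (auto simp: rel_fun_def hardy_rel_def)
  have "hardy_rel (\<lambda>z. if bounded_clinear A then A (f z) else 0) (\<lambda>z. if bounded_clinear A then A (f z) else 0)"
    by (rule id_tensor.rsp[unfolded rel_fun_def, rule_format, OF refl ff])
  then show "(\<lambda>z. A (f z)) \<in> hardy_fun" if "bounded_clinear A"
    using that by (simp add: hardy_rel_def)
qed

lemma
  assumes f: "f \<in> hardy_fun" and g: "g \<in> hardy_fun"
  shows abs_hardy_add: "abs_hardy f + abs_hardy g = abs_hardy (\<lambda>z. f z + g z)"
    and abs_hardy_diff: "abs_hardy f - abs_hardy g = abs_hardy (\<lambda>z. f z - g z)"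
    and cinner_abs_hardy: "cinner (abs_hardy f) (abs_hardy g) = (LINT z|circle_measure. cinner (f z) (g z))"
proof -
  have "hardy_rel f f" "hardy_rel g g" using f g by (simp_all add: hardy_rel_def)
  then show "abs_hardy f + abs_hardy g = abs_hardy (\<lambda>z. f z + g z)"
    "abs_hardy f - abs_hardy g = abs_hardy (\<lambda>z. f z - g z)"
    "cinner (abs_hardy f) (abs_hardy g) = (LINT z|circle_measure. cinner (f z) (g z))"
    by (simp_all add: plus_hardy.abs_eq minus_hardy.abs_eq cinner_hardy.abs_eq)
qed

lemma norm_abs_hardy:
  assumes f: "f \<in> hardy_fun"
  shows "(norm (abs_hardy f))\<^sup>2 = (LINT z|circle_measure. (norm (f z))\<^sup>2)"
proof -
  have "complex_of_real ((norm (abs_hardy f))\<^sup>2) = complex_of_real (LINT z|circle_measure. (norm (f z))\<^sup>2)"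
    unfolding cinner_self[symmetric] cinner_abs_hardy[OF f f]
    unfolding cinner_self integral_complex_of_real ..
  then show ?thesis by (simp only: of_real_eq_iff)
qed

text \<open>A weighted pointwise estimate in place of the Cauchy-Schwarz inequality; the free weight
  \<open>e\<close> balances the two terms.\<close>

lemma
  fixes g :: "complex \<Rightarrow> 's::{chilbert_space, second_countable_topology}"
  assumes g: "g \<in> borel_measurable circle_measure" and sq: "integrable circle_measure (\<lambda>z. (norm (g z))\<^sup>2)"
  shows integrable_if_square_integrable: "integrable circle_measure g"
    and integral_norm_le: "0 < e \<Longrightarrow> (LINT z|circle_measure. norm (g z))
      \<le> e * measure circle_measure UNIV + (LINT z|circle_measure. (norm (g z))\<^sup>2) / e"
proof -
  interpret finite_measure circle_measure by (rule finite_measure_circle)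
  \<comment> \<open>Either x is at most e, or x e is at most x^2.\<close>
  have le: "x \<le> e + x\<^sup>2 / e" if "0 < e" "0 \<le> x" for x e :: real
  proof (cases "x \<le> e")
    case False
    then have "x * e \<le> x\<^sup>2" using that by (simp add: power2_eq_square mult_left_mono)
    then have "x \<le> x\<^sup>2 / e" using that by (simp add: pos_le_divide_eq)
    then show ?thesis using that by simp
  qed (use that in \<open>simp add: add_increasing2\<close>)
  have bound: "integrable circle_measure (\<lambda>z. e + (norm (g z))\<^sup>2 / e)" for e
    using sq by simp
  show int: "integrable circle_measure g"
    by (rule Bochner_Integration.integrable_bound[OF bound[of 1] g])
       (use le[of 1] in \<open>auto intro!: always_eventually\<close>)
  assume e: "0 < e"
  have "(LINT z|circle_measure. norm (g z)) \<le> (LINT z|circle_measure. e + (norm (g z))\<^sup>2 / e)"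
    by (rule integral_mono) (use int bound le e in auto)
  also have "\<dots> = e * measure circle_measure UNIV + (LINT z|circle_measure. (norm (g z))\<^sup>2) / e"
    using sq by (subst Bochner_Integration.integral_add) (auto simp: mult.commute)
  finally show "(LINT z|circle_measure. norm (g z))
      \<le> e * measure circle_measure UNIV + (LINT z|circle_measure. (norm (g z))\<^sup>2) / e" .
qed

text \<open>On a finite measure, L2-small functions are L1-small; \<open>e\<close> is uniform in
  \<open>g\<close>.\<close>

lemma integral_norm_small:
  fixes d :: real
  assumes "0 < d"
  obtains e where "0 < e" "\<And>g :: complex \<Rightarrow> 's::{chilbert_space, second_countable_topology}.
    g \<in> borel_measurable circle_measure \<Longrightarrow> integrable circle_measure (\<lambda>z. (norm (g z))\<^sup>2) \<Longrightarrow>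
    (LINT z|circle_measure. (norm (g z))\<^sup>2) < e \<Longrightarrow> (LINT z|circle_measure. norm (g z)) < d"
proof -
  define c where "c = measure circle_measure UNIV"
  \<comment> \<open>This weight keeps the first term of \<open>integral_norm_le\<close> at most d/2;
    \<open>c + 1\<close> avoids a division by zero. The threshold \<open>h * (d / 2)\<close> puts
    the second term below d/2.\<close>
  define h where "h = d / (2 * (c + 1))"
  have c: "c \<ge> 0" by (simp add: c_def)
  have h: "h > 0" using assms c by (simp add: h_def)
  have "h * c \<le> h * (c + 1)" using h by simp
  also have "\<dots> = d / 2" unfolding h_def using c by (simp add: field_simps)
  finally have hc: "h * c \<le> d / 2" .
  show thesis
  proof (rule that[of "h * (d / 2)"])
    show "0 < h * (d / 2)" using h assms by simp
    fix g :: "complex \<Rightarrow> 's"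
    assume g: "g \<in> borel_measurable circle_measure" "integrable circle_measure (\<lambda>z. (norm (g z))\<^sup>2)"
      and "(LINT z|circle_measure. (norm (g z))\<^sup>2) < h * (d / 2)"
    then have "(LINT z|circle_measure. (norm (g z))\<^sup>2) / h < d / 2"
      using h by (simp add: pos_divide_less_eq mult.commute)
    with hc have "h * c + (LINT z|circle_measure. (norm (g z))\<^sup>2) / h < d / 2 + d / 2"
      by (rule add_le_less_mono)
    with integral_norm_le[OF g h, folded c_def] show "(LINT z|circle_measure. norm (g z)) < d"
      by simp
  qed
qed

lemma norm_fourier_coeff_le:
  fixes g :: "complex \<Rightarrow> 's::{chilbert_space, second_countable_topology}"
  assumes g: "g \<in> borel_measurable circle_measure"
  shows "norm (fourier_coeff g n) \<le> (LINT z|circle_measure. norm (g z))"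
proof -
  have "norm (fourier_coeff g n) \<le> (LINT z|circle_measure. norm ((z powi - n) *\<^sub>C g z))"
    unfolding fourier_coeff_def by (rule integral_norm_bound)
  also have "\<dots> = (LINT z|circle_measure. norm (g z))"
  proof (rule integral_cong_AE)
    show "AE z in circle_measure. norm ((z powi - n) *\<^sub>C g z) = norm (g z)"
      using AE_circle_norm by (auto simp: norm_scaleC norm_power_int)
  qed (use g in measurable)
  finally show ?thesis .
qed

lemma square_integrable_diff:
  fixes f :: "complex \<Rightarrow> 's::{chilbert_space, second_countable_topology}"
  assumes "f \<in> borel_measurable M" "g \<in> borel_measurable M"
    "integrable M (\<lambda>z. (norm (f z))\<^sup>2)" "integrable M (\<lambda>z. (norm (g z))\<^sup>2)"
  shows "integrable M (\<lambda>z. (norm (f z - g z))\<^sup>2)"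
proof (rule Bochner_Integration.integrable_bound)
  show "integrable M (\<lambda>z. 2 * (norm (f z))\<^sup>2 + 2 * (norm (g z))\<^sup>2)" using assms by simp
  show "(\<lambda>z. (norm (f z - g z))\<^sup>2) \<in> borel_measurable M" using assms by measurable
  have "(norm (x - y))\<^sup>2 \<le> 2 * (norm x)\<^sup>2 + 2 * (norm y)\<^sup>2" for x y :: 's
  proof -
    have "(norm (x - y))\<^sup>2 + (norm (x + y))\<^sup>2 = 2 * (norm x)\<^sup>2 + 2 * (norm y)\<^sup>2"
      by (simp add: power2_norm_eq_inner inner_add_left inner_add_right inner_diff_left inner_diff_right inner_commute)
    then show ?thesis using zero_le_power2[of "norm (x + y)"] by linarith
  qed
  then show "AE z in M. norm ((norm (f z - g z))\<^sup>2) \<le> norm (2 * (norm (f z))\<^sup>2 + 2 * (norm (g z))\<^sup>2)"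
    by simp
qed

text \<open>Riesz-Fischer: the sequence is also L1-Cauchy, so a subsequence converges almost
  everywhere, and Fatou's lemma upgrades this to L2 convergence of the whole sequence. Fourier
  coefficients are bounded by the L1 norm, so the vanishing of the negative ones survives.\<close>

lemma hardy_fun_complete:
  fixes f :: "nat \<Rightarrow> complex \<Rightarrow> 's::{chilbert_space, second_countable_topology}"
  assumes f: "\<And>n. f n \<in> hardy_fun"
    and Cauchy: "\<forall>e>0. \<exists>N. \<forall>m\<ge>N. \<forall>n\<ge>N. (LINT z|circle_measure. (norm (f m z - f n z))\<^sup>2) < e"
  obtains g where "g \<in> hardy_fun"
    "\<forall>e>0. \<exists>N. \<forall>n\<ge>N. (LINT z|circle_measure. (norm (f n z - g z))\<^sup>2) \<le> e"
proof -
  note cauchy = Cauchy[THEN spec, THEN mp]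
  have fm [measurable]: "f n \<in> borel_measurable circle_measure" for n by (rule hardy_fun_measurable[OF f])
  have fsq: "integrable circle_measure (\<lambda>z. (norm (f n z))\<^sup>2)" for n using f[of n] by (simp add: hardy_fun_def)
  have dsq: "integrable circle_measure (\<lambda>z. (norm (f m z - f n z))\<^sup>2)" for m n
    by (rule square_integrable_diff[OF fm fm fsq fsq])
  have "\<exists>N. \<forall>i\<ge>N. \<forall>j\<ge>N. (LINT z|circle_measure. norm (f i z - f j z)) < e" if e: "e > 0" for e
  proof -
    obtain d where d: "d > 0" "\<And>g :: complex \<Rightarrow> 's. g \<in> borel_measurable circle_measure \<Longrightarrow>
        integrable circle_measure (\<lambda>z. (norm (g z))\<^sup>2) \<Longrightarrow>
        (LINT z|circle_measure. (norm (g z))\<^sup>2) < d \<Longrightarrow> (LINT z|circle_measure. norm (g z)) < e"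
      using integral_norm_small[OF e] by blast
    obtain N where N: "\<And>m n. m \<ge> N \<Longrightarrow> n \<ge> N \<Longrightarrow> (LINT z|circle_measure. (norm (f m z - f n z))\<^sup>2) < d"
      using cauchy[OF d(1)] by blast
    have "(LINT z|circle_measure. norm (f i z - f j z)) < e" if "i \<ge> N" "j \<ge> N" for i j
      by (rule d(2)[OF _ dsq N[OF that]]) measurable
    then show ?thesis by blast
  qed
  then obtain r where r: "strict_mono (r :: nat \<Rightarrow> nat)" and AE_r: "AE z in circle_measure. Cauchy (\<lambda>i. f (r i) z)"
    by (rule cauchy_L1_AE_cauchy_subseq[OF integrable_if_square_integrable[OF fm fsq]])
  \<comment> \<open>Where the subsequence diverges the value of \<open>lim\<close> is arbitrary;
    this happens only on a null set.\<close>
  define g where "g z = lim (\<lambda>i. f (r i) z)" for z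
  have gm [measurable]: "g \<in> borel_measurable circle_measure"
    unfolding g_def[abs_def] by (rule borel_measurable_lim_metric) simp
  have AE_g: "AE z in circle_measure. (\<lambda>i. f (r i) z) \<longlonglongrightarrow> g z"
    using AE_r by eventually_elim (simp add: g_def Cauchy_convergent_iff convergent_LIMSEQ_iff)
  have lim: "\<exists>N. \<forall>n\<ge>N. integrable circle_measure (\<lambda>z. (norm (f n z - g z))\<^sup>2) \<and>
      (LINT z|circle_measure. (norm (f n z - g z))\<^sup>2) \<le> e" if e: "e > 0" for e
  proof -
    obtain N where N: "\<And>m n. m \<ge> N \<Longrightarrow> n \<ge> N \<Longrightarrow> (LINT z|circle_measure. (norm (f m z - f n z))\<^sup>2) < e"
      using cauchy[OF e] by blast
    have "integrable circle_measure (\<lambda>z. (norm (f n z - g z))\<^sup>2) \<and>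
        (LINT z|circle_measure. (norm (f n z - g z))\<^sup>2) \<le> e" if n: "n \<ge> N" for n
    proof -
      have "(\<integral>\<^sup>+z. ennreal ((norm (f n z - g z))\<^sup>2) \<partial>circle_measure)
          = (\<integral>\<^sup>+z. liminf (\<lambda>i. ennreal ((norm (f n z - f (r i) z))\<^sup>2)) \<partial>circle_measure)"
      proof (rule nn_integral_cong_AE)
        show "AE z in circle_measure. ennreal ((norm (f n z - g z))\<^sup>2)
            = liminf (\<lambda>i. ennreal ((norm (f n z - f (r i) z))\<^sup>2))"
          using AE_g
        proof eventually_elim
          fix z assume "(\<lambda>i. f (r i) z) \<longlonglongrightarrow> g z"
          then have "(\<lambda>i. ennreal ((norm (f n z - f (r i) z))\<^sup>2)) \<longlonglongrightarrow> ennreal ((norm (f n z - g z))\<^sup>2)"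
            by (intro tendsto_ennrealI tendsto_intros)
          then show "ennreal ((norm (f n z - g z))\<^sup>2) = liminf (\<lambda>i. ennreal ((norm (f n z - f (r i) z))\<^sup>2))"
            by (rule lim_imp_Liminf[OF trivial_limit_sequentially, symmetric])
        qed
      qed
      \<comment> \<open>Fatou's lemma with \<open>n\<close> fixed and the second index running along
        the subsequence.\<close>
      also have "\<dots> \<le> liminf (\<lambda>i. \<integral>\<^sup>+z. ennreal ((norm (f n z - f (r i) z))\<^sup>2) \<partial>circle_measure)"
        by (rule nn_integral_liminf) measurable
      also have "\<dots> \<le> ennreal e"
      proof (rule Liminf_le)
        show "\<forall>\<^sub>F i in sequentially. (\<integral>\<^sup>+z. ennreal ((norm (f n z - f (r i) z))\<^sup>2) \<partial>circle_measure) \<le> ennreal e"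
          using eventually_ge_at_top[of N]
        proof eventually_elim
          fix i assume "N \<le> i"
          then have "N \<le> r i" using seq_suble[OF r, of i] by simp
          then have "(LINT z|circle_measure. (norm (f n z - f (r i) z))\<^sup>2) \<le> e"
            using N[OF n] less_imp_le by blast
          moreover have "(\<integral>\<^sup>+z. ennreal ((norm (f n z - f (r i) z))\<^sup>2) \<partial>circle_measure)
              = ennreal (LINT z|circle_measure. (norm (f n z - f (r i) z))\<^sup>2)"
            by (rule nn_integral_eq_integral[OF dsq]) simp
          ultimately show "(\<integral>\<^sup>+z. ennreal ((norm (f n z - f (r i) z))\<^sup>2) \<partial>circle_measure) \<le> ennreal e"
            by (simp add: ennreal_leI)
        qed
      qed simp
      finally have le: "(\<integral>\<^sup>+z. ennreal ((norm (f n z - g z))\<^sup>2) \<partial>circle_measure) \<le> ennreal e" .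
      have int: "integrable circle_measure (\<lambda>z. (norm (f n z - g z))\<^sup>2)"
      proof (rule integrableI_nonneg)
        show "(\<integral>\<^sup>+z. ennreal ((norm (f n z - g z))\<^sup>2) \<partial>circle_measure) < \<infinity>"
          using order_le_less_trans[OF le ennreal_less_top[of e]] by simp
      qed (auto, measurable)
      have "ennreal (LINT z|circle_measure. (norm (f n z - g z))\<^sup>2) \<le> ennreal e"
        using le nn_integral_eq_integral[OF int] by simp
      then show ?thesis using int e by (simp add: ennreal_le_iff)
    qed
    then show ?thesis by blast
  qed
  have "g \<in> hardy_fun"
    unfolding hardy_fun_def
  proof (intro CollectI conjI allI impI)
    obtain n where n: "integrable circle_measure (\<lambda>z. (norm (f n z - g z))\<^sup>2)"
      using lim[of 1] by auto
    \<comment> \<open>Square integrability of \<open>g\<close> is read off from g = f n - (f n -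
      g).\<close>
    have "integrable circle_measure (\<lambda>z. (norm (f n z - (f n z - g z)))\<^sup>2)"
      by (rule square_integrable_diff[OF fm _ fsq n]) measurable
    then show gsq: "integrable circle_measure (\<lambda>z. (norm (g z))\<^sup>2)" by simp
    fix k :: int assume k: "k < 0"
    have "norm (fourier_coeff g k) < e" if e: "e > 0" for e
    proof -
      obtain d where d: "d > 0" "\<And>g :: complex \<Rightarrow> 's. g \<in> borel_measurable circle_measure \<Longrightarrow>
          integrable circle_measure (\<lambda>z. (norm (g z))\<^sup>2) \<Longrightarrow>
          (LINT z|circle_measure. (norm (g z))\<^sup>2) < d \<Longrightarrow> (LINT z|circle_measure. norm (g z)) < e"
        using integral_norm_small[OF e] by blast
      obtain n where n: "integrable circle_measure (\<lambda>z. (norm (f n z - g z))\<^sup>2)"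
        "(LINT z|circle_measure. (norm (f n z - g z))\<^sup>2) \<le> d / 2"
        using lim[of "d / 2"] d(1) by auto
      have m: "(\<lambda>z. f n z - g z) \<in> borel_measurable circle_measure" by measurable
      have "fourier_coeff (\<lambda>z. f n z - g z) k = fourier_coeff (f n) k - fourier_coeff g k"
        using integrable_fourier_hardy[OF fm fsq] integrable_fourier_hardy[OF gm gsq]
        by (simp add: fourier_coeff_def scaleC.diff_right)
      \<comment> \<open>The coefficient of \<open>f n\<close> at the negative index \<open>k\<close>
        is 0.\<close>
      then have "norm (fourier_coeff g k) = norm (fourier_coeff (\<lambda>z. f n z - g z) k)"
        using f[of n] k by (simp add: hardy_fun_def)
      also have "\<dots> \<le> (LINT z|circle_measure. norm (f n z - g z))" by (rule norm_fourier_coeff_le[OF m])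
      also have "\<dots> < e" by (rule d(2)[OF m n(1)]) (use n(2) d(1) in simp)
      finally show ?thesis .
    qed
    then have "\<not> 0 < norm (fourier_coeff g k)" by blast
    then show "fourier_coeff g k = 0" by simp
  qed (rule gm)
  then show thesis using that lim by blast
qed

text \<open>Makes the adjoints, projections and spectral results above available on the Hardy
  space.\<close>

instance hardy :: ("{chilbert_space, second_countable_topology}") chilbert_space
proof
  fix X :: "nat \<Rightarrow> 'a hardy" assume X: "Cauchy X"
  have "\<exists>f. f \<in> hardy_fun \<and> X n = abs_hardy f" for n using hardy_cases[of "X n"] by blast
  then obtain f where f: "\<And>n. f n \<in> hardy_fun" "\<And>n. X n = abs_hardy (f n)" by metis
  have norm_diff: "(norm (X m - abs_hardy g))\<^sup>2 = (LINT z|circle_measure. (norm (f m z - g z))\<^sup>2)"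
    if "g \<in> hardy_fun" for m g
    using that f by (simp add: abs_hardy_diff norm_abs_hardy hardy_fun_diff)
  have "\<exists>N. \<forall>m\<ge>N. \<forall>n\<ge>N. (LINT z|circle_measure. (norm (f m z - f n z))\<^sup>2) < e" if e: "e > 0" for e
  proof -
    obtain N where N: "\<And>m n. m \<ge> N \<Longrightarrow> n \<ge> N \<Longrightarrow> norm (X m - X n) < sqrt e"
      using CauchyD[OF X, of "sqrt e"] e by auto
    have "(LINT z|circle_measure. (norm (f m z - f n z))\<^sup>2) < e" if "m \<ge> N" "n \<ge> N" for m n
    proof -
      have "(norm (X m - X n))\<^sup>2 < (sqrt e)\<^sup>2" by (intro power_strict_mono N that) simp_all
      then show ?thesis using norm_diff[OF f(1), of m n] f(2)[of n] e by simp
    qed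
    then show ?thesis by blast
  qed
  then have "\<forall>e>0. \<exists>N. \<forall>m\<ge>N. \<forall>n\<ge>N. (LINT z|circle_measure. (norm (f m z - f n z))\<^sup>2) < e" by blast
  from hardy_fun_complete[OF f(1) this] obtain g where g: "g \<in> hardy_fun"
    "\<forall>e>0. \<exists>N. \<forall>n\<ge>N. (LINT z|circle_measure. (norm (f n z - g z))\<^sup>2) \<le> e"
    by blast
  have "X \<longlonglongrightarrow> abs_hardy g"
  proof (rule LIMSEQ_I)
    fix e :: real assume e: "0 < e"
    obtain N where N: "\<And>n. n \<ge> N \<Longrightarrow> (LINT z|circle_measure. (norm (f n z - g z))\<^sup>2) \<le> (e / 2)\<^sup>2"
      using g(2)[THEN spec, of "(e / 2)\<^sup>2"] e by auto
    have "norm (X n - abs_hardy g) < e" if "n \<ge> N" for n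
    proof -
      have "(norm (X n - abs_hardy g))\<^sup>2 \<le> (e / 2)\<^sup>2" unfolding norm_diff[OF g(1)] by (rule N[OF that])
      then have "norm (X n - abs_hardy g) \<le> e / 2" by (rule power2_le_imp_le) (use e in simp)
      then show ?thesis using e by simp
    qed
    then show "\<exists>N. \<forall>n\<ge>N. norm (X n - abs_hardy g) < e" by blast
  qed
  then show "convergent X" by (auto simp: convergent_def)
qed

section \<open>BCL pairs\<close>

lemma hardy_fun_symbol:
  fixes A B :: "'s::{chilbert_space, second_countable_topology} \<Rightarrow> 's"
  assumes "f \<in> hardy_fun" "bounded_clinear A" "bounded_clinear B"
  shows "(\<lambda>z. A (f z) + z *\<^sub>C B (f z)) \<in> hardy_fun"
  by (rule hardy_fun_add[OF hardy_fun_compose[OF assms(1,2)]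
        hardy_fun_mult_z[OF hardy_fun_compose[OF assms(1,3)]]])

text \<open>Turns the two tensor terms into pointwise action of the symbol A + z B on a
  representative, so operator identities reduce to identities in z.\<close>

lemma abs_hardy_symbol:
  assumes "f \<in> hardy_fun" "bounded_clinear A" "bounded_clinear B"
  shows "id_tensor A (abs_hardy f) + mult_z (id_tensor B (abs_hardy f)) = abs_hardy (\<lambda>z. A (f z) + z *\<^sub>C B (f z))"
  unfolding abs_hardy_id_tensor[OF assms(1,2)] abs_hardy_id_tensor[OF assms(1,3)]
    abs_hardy_mult_z[OF hardy_fun_compose[OF assms(1,3)]]
  by (rule abs_hardy_add[OF hardy_fun_compose[OF assms(1,2)]
        hardy_fun_mult_z[OF hardy_fun_compose[OF assms(1,3)]]])

text \<open>The measure is concentrated on |z| = 1, so a symbol that is isometric there preserves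
  the integrand of the inner product almost everywhere.\<close>

lemma isometry_op_symbol:
  fixes A B :: "'s::{chilbert_space, second_countable_topology} \<Rightarrow> 's"
  assumes A: "bounded_clinear A" and B: "bounded_clinear B"
    and iso: "\<And>z x y. cmod z = 1 \<Longrightarrow> cinner (A x + z *\<^sub>C B x) (A y + z *\<^sub>C B y) = cinner x y"
  shows "isometry_op (\<lambda>F. id_tensor A F + mult_z (id_tensor B F))" (is "isometry_op ?\<Phi>")
proof -
  interpret A: bounded_linear A using A by (simp add: bounded_clinear_def)
  interpret B: bounded_linear B using B by (simp add: bounded_clinear_def)
  have sc: "A (c *\<^sub>C x) = c *\<^sub>C A x" "B (c *\<^sub>C x) = c *\<^sub>C B x" for c x
    using A B by (simp_all add: bounded_clinear_def)
  have add: "?\<Phi> (F + G) = ?\<Phi> F + ?\<Phi> G" for F G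
  proof -
    obtain f g where f: "f \<in> hardy_fun" "F = abs_hardy f" and g: "g \<in> hardy_fun" "G = abs_hardy g"
      by (metis hardy_cases)
    show ?thesis
      unfolding f g abs_hardy_add[OF f(1) g(1)] abs_hardy_symbol[OF hardy_fun_add[OF f(1) g(1)] A B]
        abs_hardy_symbol[OF f(1) A B] abs_hardy_symbol[OF g(1) A B]
        abs_hardy_add[OF hardy_fun_symbol[OF f(1) A B] hardy_fun_symbol[OF g(1) A B]]
      by (simp add: A.add B.add scaleC_add_right algebra_simps)
  qed
  have scale: "?\<Phi> (c *\<^sub>C F) = c *\<^sub>C ?\<Phi> F" for c F
  proof -
    obtain f where f: "f \<in> hardy_fun" "F = abs_hardy f" by (rule hardy_cases)
    show ?thesis
      unfolding f abs_hardy_scaleC[OF f(1)] abs_hardy_symbol[OF hardy_fun_scaleC[OF f(1)] A B]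
        abs_hardy_symbol[OF f(1) A B] abs_hardy_scaleC[OF hardy_fun_symbol[OF f(1) A B]]
      by (simp add: sc scaleC_add_right scaleC_scaleC mult.commute)
  qed
  have inner: "cinner (?\<Phi> F) (?\<Phi> G) = cinner F G" for F G
  proof -
    obtain f g where f: "f \<in> hardy_fun" "F = abs_hardy f" and g: "g \<in> hardy_fun" "G = abs_hardy g"
      by (metis hardy_cases)
    note \<Phi>fg = hardy_fun_symbol[OF f(1) A B] hardy_fun_symbol[OF g(1) A B]
    show ?thesis
      unfolding f g abs_hardy_symbol[OF f(1) A B] abs_hardy_symbol[OF g(1) A B]
        cinner_abs_hardy[OF \<Phi>fg] cinner_abs_hardy[OF f(1) g(1)]
    proof (rule integral_cong_AE)
      show "AE z in circle_measure. cinner (A (f z) + z *\<^sub>C B (f z)) (A (g z) + z *\<^sub>C B (g z)) = cinner (f z) (g z)"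
        using AE_circle_norm by eventually_elim (rule iso)
    qed (intro borel_measurable_cinner hardy_fun_measurable \<Phi>fg f(1) g(1))+
  qed
  have "norm (?\<Phi> F) = norm F" for F
  proof -
    have "complex_of_real ((norm (?\<Phi> F))\<^sup>2) = complex_of_real ((norm F)\<^sup>2)"
      unfolding cinner_self[symmetric] by (rule inner)
    then have "(norm (?\<Phi> F))\<^sup>2 = (norm F)\<^sup>2" by (simp only: of_real_eq_iff)
    then show ?thesis by simp
  qed
  moreover have "?\<Phi> (r *\<^sub>R F) = r *\<^sub>R ?\<Phi> F" for r F unfolding scaleR_eq_scaleC by (rule scale)
  ultimately have "bounded_linear ?\<Phi>"
    by (intro bounded_linear_intro[where K = 1] add) simp_all
  then show ?thesis unfolding isometry_op_def bounded_clinear_def using scale inner by blast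
qed

text \<open>The terms carrying a single z or its conjugate vanish by orthogonality, and |z|^2 = 1
  clears the last one. It serves for vectors from the ranges of \<open>P\<close> and
  \<open>perp P\<close>.\<close>

lemma cinner_add_unimodular:
  assumes z: "cmod z = 1" and "cinner a d = 0" "cinner b c = 0"
  shows "cinner (a + z *\<^sub>C b) (c + z *\<^sub>C d) = cinner a c + cinner b (d::'a::complex_inner)"
proof -
  have "z * cnj z = 1" using z by (simp add: complex_norm_square[symmetric])
  moreover from this have "cnj z * z = 1" by (simp only: mult.commute)
  moreover from calculation have "z * (cnj z * cinner b d) = cinner b d" by (simp only: mult.assoc[symmetric] mult_1)
  ultimately show ?thesis
    using assms(2,3) by (simp add: cinner.add_left cinner.add_right cinner_scaleC_left cinner_scaleC_right)
qed

text \<open>The symbols are (P + z P^perp) U* and U (P^perp + z P). Orthogonality of the two ranges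
  makes them isometric for |z| = 1, and the operators commute because both composites are
  multiplication by z.\<close>

lemma BCL_pair_isometries:
  fixes U P :: "'s::{chilbert_space, second_countable_topology} \<Rightarrow> 's"
  assumes "BCL_triple U P"
  shows "isometry_op (M_phi1 U P)" "isometry_op (M_phi2 U P)"
    "M_phi1 U P (M_phi2 U P F) = M_phi2 U P (M_phi1 U P F)"
proof -
  let ?U' = "cadjoint U"
  have U: "bounded_clinear U" "surj U" "\<And>x y. cinner (U x) (U y) = cinner x y"
    and P: "orthogonal_projection_op P"
    using assms by (auto simp: BCL_triple_def unitary_op_def)
  note PD = orthogonal_projection_opD[OF P]
  have iU: "isometry_op U" using U by (simp add: isometry_op_def)
  note U'U = cadjoint_isometry[OF iU]
  \<comment> \<open>Surjectivity turns the left inverse into a two-sided one.\<close>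
  have UU': "U (?U' x) = x" for x
    using U(2) U'U by (metis surj_def)
  have U': "bounded_clinear ?U'" by (rule bounded_clinear_cadjoint[OF U(1)])
  have U'_inner: "cinner (?U' x) (?U' y) = cinner x y" for x y
    using U(3)[of "?U' x" "?U' y"] by (simp add: UU')
  have perp: "bounded_clinear (perp P)"
    unfolding perp_def[abs_def] by (rule bounded_clinear_diff[OF bounded_clinear_ident PD(1)])
  have bl: "bounded_clinear (P \<circ> ?U')" "bounded_clinear (perp P \<circ> ?U')"
    "bounded_clinear (U \<circ> perp P)" "bounded_clinear (U \<circ> P)"
    unfolding o_def
    by (rule bounded_clinear_compose[OF PD(1) U'] bounded_clinear_compose[OF perp U']
        bounded_clinear_compose[OF U(1) perp] bounded_clinear_compose[OF U(1) PD(1)])+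
  have orth: "cinner (perp P x) (P y) = 0" for x y
  proof -
    have "cinner (perp P x) (P y) = cinner (P (perp P x)) y" by (rule PD(3)[symmetric])
    then show ?thesis by (simp add: perp_def PD(2,5))
  qed
  then have orth': "cinner (P x) (perp P y) = 0" for x y
    using cinner_eq_0_commute by blast
  have pyth: "cinner (P x) (P y) + cinner (perp P x) (perp P y) = cinner x y" for x y
    using orth[of x y] orth'[of x y] by (simp add: perp_def cinner.diff_left cinner.diff_right)
  have M1: "M_phi1 U P = (\<lambda>F. id_tensor (P \<circ> ?U') F + mult_z (id_tensor (perp P \<circ> ?U') F))"
    and M2: "M_phi2 U P = (\<lambda>F. id_tensor (U \<circ> perp P) F + mult_z (id_tensor (U \<circ> P) F))"
    by (auto simp: M_phi1_def M_phi2_def)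
  show "isometry_op (M_phi1 U P)"
    unfolding M1
  proof (rule isometry_op_symbol[OF bl(1,2)])
    fix z x y assume "cmod z = 1"
    then show "cinner ((P \<circ> ?U') x + z *\<^sub>C (perp P \<circ> ?U') x) ((P \<circ> ?U') y + z *\<^sub>C (perp P \<circ> ?U') y) = cinner x y"
      by (simp add: cinner_add_unimodular orth orth' pyth U'_inner)
  qed
  show "isometry_op (M_phi2 U P)"
    unfolding M2
  proof (rule isometry_op_symbol[OF bl(3,4)])
    fix z x y assume "cmod z = 1"
    then show "cinner ((U \<circ> perp P) x + z *\<^sub>C (U \<circ> P) x) ((U \<circ> perp P) y + z *\<^sub>C (U \<circ> P) y) = cinner x y"
      using pyth[of x y] by (simp add: cinner_add_unimodular orth orth' U(3) add.commute)
  qed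
  obtain f where f: "f \<in> hardy_fun" "F = abs_hardy f" by (rule hardy_cases)
  interpret U: bounded_linear U using U by (simp add: bounded_clinear_def)
  interpret U': bounded_linear ?U' using U' by (simp add: bounded_clinear_def)
  have sc: "U (c *\<^sub>C x) = c *\<^sub>C U x" "?U' (c *\<^sub>C x) = c *\<^sub>C ?U' x" "P (c *\<^sub>C x) = c *\<^sub>C P x" for c x
    using U(1) U' PD(1) by (simp_all add: bounded_clinear_def)
  have U'_symbol: "?U' (U a + z *\<^sub>C U b) = a + z *\<^sub>C b" for a b z
    by (simp add: U'.add sc(2) U'U)
  \<comment> \<open>After U* U cancels, (P + z P^perp)(P^perp + z P) = z. In the other order the
    projections multiply first, and U U* = I finishes.\<close>
  have "(P \<circ> ?U') ((U \<circ> perp P) x + z *\<^sub>C (U \<circ> P) x)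
      + z *\<^sub>C (perp P \<circ> ?U') ((U \<circ> perp P) x + z *\<^sub>C (U \<circ> P) x) = z *\<^sub>C x" for x z
    unfolding o_apply U'_symbol
    by (simp add: perp_def PD(2,4,5) sc(3) scaleC.diff_right)
  moreover have "(U \<circ> perp P) ((P \<circ> ?U') x + z *\<^sub>C (perp P \<circ> ?U') x)
      + z *\<^sub>C (U \<circ> P) ((P \<circ> ?U') x + z *\<^sub>C (perp P \<circ> ?U') x) = z *\<^sub>C x" for x z
  proof -
    have "perp P (P u + z *\<^sub>C perp P u) = z *\<^sub>C perp P u" "P (P u + z *\<^sub>C perp P u) = P u" for u
      by (simp_all add: perp_def PD(2,4,5) sc(3) scaleC.diff_right)
    then have "(U \<circ> perp P) ((P \<circ> ?U') x + z *\<^sub>C (perp P \<circ> ?U') x)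
      + z *\<^sub>C (U \<circ> P) ((P \<circ> ?U') x + z *\<^sub>C (perp P \<circ> ?U') x)
      = z *\<^sub>C U (perp P (?U' x) + P (?U' x))"
      by (simp add: sc(1) U.add scaleC_add_right)
    also have "perp P (?U' x) + P (?U' x) = ?U' x" by (simp add: perp_def)
    finally show ?thesis by (simp only: UU')
  qed
  ultimately show "M_phi1 U P (M_phi2 U P F) = M_phi2 U P (M_phi1 U P F)"
    by (simp only: M1 M2 f(2) abs_hardy_symbol[OF f(1) bl(1,2)] abs_hardy_symbol[OF f(1) bl(3,4)]
      abs_hardy_symbol[OF hardy_fun_symbol[OF f(1) bl(1,2)] bl(3,4)]
      abs_hardy_symbol[OF hardy_fun_symbol[OF f(1) bl(3,4)] bl(1,2)])
qed

theorem theorem3p14: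
  fixes U P :: "'s::{chilbert_space, second_countable_topology} \<Rightarrow> 's"
    and H :: "'s hardy \<Rightarrow> 's hardy"
  assumes "BCL_triple U P"
    and "H = H_op (M_phi1 U P) (M_phi2 U P)"
    and "compact_op H"
    and "contraction_op H"
  shows "unitarily_equivalent_on
           (nonzero_part_space H) H
           (block_space (complex_vector.dim (eigenspace H 1)) (E01_space H)
              (complex_vector.dim (eigenspace H (- 1))))
           (block_op (E01 H))"
  unfolding assms(2)
  using BCL_pair_isometries[OF assms(1)] assms(3)[unfolded assms(2)]
  by (intro unitarily_equivalent_H_op)

end
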